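(* Let $\alpha\in(c,1]^{\mathbb{Z}}$ be an environment such that $\liminf_{x\to-\infty}\alpha(x)=c$ and such that the limit $\overline{R}(\lambda):=\lim_{n\to+\infty}n^{-1}\sum_{x=-n}^0 R\!\left(\lambda/\alpha(x)\right)$ exists for every $\lambda\in[0,c)$; let $\rho_c:=\lim_{\lambda\uparrow c}\overline{R}(\lambda)\in[0,+\infty]$. Assume that the jump kernel $p(\cdot)$ is totally asymmetric (i.e. $p(z)=0$ for all $z\le 0$) and that $p(1)<1$. Then there exists $\eta_0\in\mathbb{N}^{\mathbb{Z}}$ satisfying $$\liminf_{n\to\infty}\frac1n\sum_{x=-n}^{-1}\eta_0(x)\ge\rho_c$$ such that the zero-range process $(\eta^\alpha_t)_{t\ge0}$ in environment $\alpha$ started from $\eta_0$ does not converge in distribution to $\mu_c^\alpha$ as $t\to+\infty$.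
   Context: Notation: $\mathbb{N}=\{0,1,2,\dots\}$, $\overline{\mathbb{N}}=\mathbb{N}\cup\{+\infty\}$, $\mathbf{X}=\overline{\mathbb{N}}^{\mathbb{Z}}$ (product topology). Fix $c\in(0,1)$. An environment is a sequence $\alpha=(\alpha(x))_{x\in\mathbb{Z}}\in(c,1]^{\mathbb{Z}}$. Let $g:\mathbb{N}\to[0,+\infty)$ be nondecreasing with $g(0)=0<g(1)\le\lim_{n\to\infty}g(n)=1$, extended by $g(+\infty)=1$. Process: for a jump kernel $p(\cdot)$ (a probability measure on $\mathbb{Z}$), $(\eta^\alpha_t)_{t\ge0}$ is the Markov process on $\mathbf{X}$ with generator, for cylinder functions $f$, $$L^\alpha f(\eta)=\sum_{x,y\in\mathbb{Z}}\alpha(x)p(y-x)g(\eta(x))\,[f(\eta^{x,y})-f(\eta)],$$ where $\eta^{x,y}=\eta-\delta_x+\delta_y$ is obtained by moving one particle from $x$ to $y$ (a site with infinitely many particles keeps the value $+\infty$ when it loses or gains a particle). It is constructed as follows (Harris graphical construction): independent rate-$1$ Poisson clocks are attached to the sites; at each ring of the clock at $x$, at time $t$, independent marks $U$ uniform on $(0,1)$ and $Z\sim p(\cdot)$ are drawn, and if $U\le\alpha(x)g(\eta_{t-}(x))$ then one particle moves from $x$ to $x+Z$. The environment $\alpha$ and initial configuration $\eta_0$ are deterministic. Invariant measures: for $\lambda\in[0,1)$, $\theta_\lambda$ is the probability measure on $\mathbb{N}$ with $\theta_\lambda(n)=Z(\lambda)^{-1}\lambda^n/g(n)!$, where $g(n)!=\prod_{k=1}^n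 g(k)$, $g(0)!=1$ and $Z(\lambda)=\sum_{n\ge0}\lambda^n/g(n)!$. Its mean is $R(\lambda)=\sum_{n\ge0}n\,\theta_\lambda(n)$. For $\lambda\in[0,c]$, $\mu^\alpha_\lambda$ is the product measure on $\mathbf{X}$ whose marginal at site $x$ is $\theta_{\lambda/\alpha(x)}$. *)

theory Defs
  imports "HOL-Probability.Probability"
begin

section \<open>Invariant measures\<close>

definition g_fact :: "(nat \<Rightarrow> real) \<Rightarrow> nat \<Rightarrow> real" where
  "g_fact g n = (\<Prod>k=1..n. g k)"

definition Z_fun :: "(nat \<Rightarrow> real) \<Rightarrow> real \<Rightarrow> real" where
  "Z_fun g l = (\<Sum>n. l ^ n / g_fact g n)"

text \<open>For the rate functions considered, the weights are nonnegative and sum to one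
  whenever \<open>0 \<le> l < 1\<close>, so the embedding is meaningful on that range.\<close>

definition theta :: "(nat \<Rightarrow> real) \<Rightarrow> real \<Rightarrow> nat pmf" where
  "theta g l = embed_pmf (\<lambda>n. l ^ n / g_fact g n / Z_fun g l)"

definition R_fun :: "(nat \<Rightarrow> real) \<Rightarrow> real \<Rightarrow> real" where
  "R_fun g l = (\<Sum>n. real n * pmf (theta g l) n)"

definition mu :: "(nat \<Rightarrow> real) \<Rightarrow> (int \<Rightarrow> real) \<Rightarrow> real \<Rightarrow> (int \<Rightarrow> enat) measure" where
  "mu g \<alpha> l = (\<Pi>\<^sub>M x\<in>UNIV. distr (measure_pmf (theta g (l / \<alpha> x))) borel enat)"

definition R_avg :: "(nat \<Rightarrow> real) \<Rightarrow> (int \<Rightarrow> real) \<Rightarrow> real \<Rightarrow> nat \<Rightarrow> real" where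
  "R_avg g \<alpha> l n = (\<Sum>x=-int n..0. R_fun g (l / \<alpha> x)) / real n"

definition R_bar :: "(nat \<Rightarrow> real) \<Rightarrow> (int \<Rightarrow> real) \<Rightarrow> real \<Rightarrow> real" where
  "R_bar g \<alpha> l = lim (R_avg g \<alpha> l)"

definition rho_c :: "real \<Rightarrow> (nat \<Rightarrow> real) \<Rightarrow> (int \<Rightarrow> real) \<Rightarrow> ereal" where
  "rho_c c g \<alpha> = Lim (at_left c) (\<lambda>l. ereal (R_bar g \<alpha> l))"


section \<open>The zero-range process via the Harris graphical construction\<close>

definition g_ext :: "(nat \<Rightarrow> real) \<Rightarrow> enat \<Rightarrow> real" where
  "g_ext g n = (case n of enat k \<Rightarrow> g k | \<infinity> \<Rightarrow> 1)"

text \<open>In \<^typ>\<open>enat\<close> we have \<open>\<infinity> - 1 = \<infinity>\<close> and \<open>\<infinity> + 1 = \<infinity>\<close>, so infinite sites keep their value.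
  The two updates are sequential, so that \<open>move x x\<close> does nothing when \<open>x\<close> is occupied.\<close>

definition move :: "int \<Rightarrow> int \<Rightarrow> (int \<Rightarrow> enat) \<Rightarrow> (int \<Rightarrow> enat)" where
  "move x y \<eta> = (let \<zeta> = \<eta>(x := \<eta> x - 1) in \<zeta>(y := \<zeta> y + 1))"

text \<open>\<open>E x k\<close> is the \<open>k\<close>-th waiting time of the clock at \<open>x\<close>; i.i.d. standard exponential
  waiting times are equivalent to a rate-1 Poisson clock. \<open>U x k\<close> and \<open>Z x k\<close> are the marks
  attached to the \<open>k\<close>-th ring (rings are counted from 0).\<close>

definition harris_system ::
  "'w measure \<Rightarrow> int pmf \<Rightarrow> (int \<Rightarrow> nat \<Rightarrow> 'w \<Rightarrow> real) \<Rightarrow> (int \<Rightarrow> nat \<Rightarrow> 'w \<Rightarrow> real)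
    \<Rightarrow> (int \<Rightarrow> nat \<Rightarrow> 'w \<Rightarrow> int) \<Rightarrow> bool" where
  "harris_system M p E U Z \<longleftrightarrow>
     prob_space M \<and>
     prob_space.indep_vars M (\<lambda>_. borel \<Otimes>\<^sub>M (borel \<Otimes>\<^sub>M count_space UNIV))
       (\<lambda>(x, k) \<omega>. (E x k \<omega>, (U x k \<omega>, Z x k \<omega>))) UNIV \<and>
     (\<forall>x k. distr M (borel \<Otimes>\<^sub>M (borel \<Otimes>\<^sub>M count_space UNIV)) (\<lambda>\<omega>. (E x k \<omega>, (U x k \<omega>, Z x k \<omega>)))
        = density lborel (exponential_density 1)
            \<Otimes>\<^sub>M (uniform_measure lborel {0<..<1} \<Otimes>\<^sub>M measure_pmf p))"

definition ring_time :: "(int \<Rightarrow> nat \<Rightarrow> 'w \<Rightarrow> real) \<Rightarrow> int \<Rightarrow> nat \<Rightarrow> 'w \<Rightarrow> real" where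
  "ring_time E x k \<omega> = (\<Sum>j\<le>k. E x j \<omega>)"

definition left_limit :: "(real \<Rightarrow> int \<Rightarrow> enat) \<Rightarrow> real \<Rightarrow> int \<Rightarrow> enat" where
  "left_limit \<xi> t = (\<lambda>z. Lim (at_left t) (\<lambda>s. \<xi> s z))"

text \<open>The deterministic evolution rule for one realization of the ring times \<open>T\<close> and marks
  \<open>U\<close>, \<open>Z\<close>. The ring times of all sites together are dense in time, so constancy between
  rings is imposed sitewise: the value at \<open>z\<close> changes only at rings whose source or target
  is \<open>z\<close>. Almost surely these are locally finite for each \<open>z\<close> (potential arrivals at \<open>z\<close> have
  total rate \<open>1\<close>), hence the left limits exist, and backward influence paths over a bounded
  time interval are finite in number, so the rule determines the trajectory.\<close>

definition harris_evolution ::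
  "(int \<Rightarrow> real) \<Rightarrow> (nat \<Rightarrow> real) \<Rightarrow> (int \<Rightarrow> nat \<Rightarrow> real) \<Rightarrow> (int \<Rightarrow> nat \<Rightarrow> real) \<Rightarrow> (int \<Rightarrow> nat \<Rightarrow> int)
    \<Rightarrow> (int \<Rightarrow> enat) \<Rightarrow> (real \<Rightarrow> int \<Rightarrow> enat) \<Rightarrow> bool" where
  "harris_evolution \<alpha> g T U Z \<zeta> \<xi> \<longleftrightarrow>
     \<xi> 0 = \<zeta> \<and>
     (\<forall>z s t. 0 \<le> s \<and> s \<le> t \<and> (\<forall>x k. T x k \<in> {s<..t} \<longrightarrow> z \<noteq> x \<and> z \<noteq> x + Z x k)
        \<longrightarrow> \<xi> t z = \<xi> s z) \<and>
     (\<forall>x k. let \<eta> = left_limit \<xi> (T x k) in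
        \<xi> (T x k) = (if U x k \<le> \<alpha> x * g_ext g (\<eta> x) then move x (x + Z x k) \<eta> else \<eta>))"

definition zero_range_process ::
  "'w measure \<Rightarrow> (int \<Rightarrow> real) \<Rightarrow> (nat \<Rightarrow> real) \<Rightarrow> int pmf
    \<Rightarrow> (int \<Rightarrow> nat \<Rightarrow> 'w \<Rightarrow> real) \<Rightarrow> (int \<Rightarrow> nat \<Rightarrow> 'w \<Rightarrow> real) \<Rightarrow> (int \<Rightarrow> nat \<Rightarrow> 'w \<Rightarrow> int)
    \<Rightarrow> (int \<Rightarrow> enat) \<Rightarrow> (real \<Rightarrow> 'w \<Rightarrow> int \<Rightarrow> enat) \<Rightarrow> bool" where
  "zero_range_process M \<alpha> g p E U Z \<zeta> \<eta> \<longleftrightarrow>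
     harris_system M p E U Z \<and>
     (\<forall>t\<ge>0. \<eta> t \<in> M \<rightarrow>\<^sub>M borel) \<and>
     (AE \<omega> in M. harris_evolution \<alpha> g (\<lambda>x k. ring_time E x k \<omega>) (\<lambda>x k. U x k \<omega>)
        (\<lambda>x k. Z x k \<omega>) \<zeta> (\<lambda>t. \<eta> t \<omega>))"


section \<open>Convergence in distribution\<close>

text \<open>The library's \<open>weak_conv_m\<close> covers only laws on the real line; this is the usual
  definition by bounded continuous test functions on a topological space.\<close>

definition converges_in_distribution ::
  "'w measure \<Rightarrow> (real \<Rightarrow> 'w \<Rightarrow> 'a::topological_space) \<Rightarrow> 'a measure \<Rightarrow> bool" where
  "converges_in_distribution M \<eta> \<mu> \<longleftrightarrow>
     (\<forall>f :: 'a \<Rightarrow> real. continuous_on UNIV f \<and> bounded (range f) \<longrightarrow>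
        ((\<lambda>t. integral\<^sup>L (distr M borel (\<eta> t)) f) \<longlongrightarrow> integral\<^sup>L \<mu> f) at_top)"

end

theory Submission
  imports Defs "HOL-Real_Asymp.Real_Asymp"
begin

text \<open>
  The idea is that a single site emits particles at rate at most \<open>\<alpha> \<le> 1\<close>, however many of them it
  holds. At equilibrium \<open>\<mu>\<^sub>c\<close> particles leave \<^emph>\<open>every\<close> site at mean rate \<open>c\<close>. A particle whose
  jumps are not all equal to \<open>1\<close> skips sites, so a stream of particles emitted by one far away
  site at rate close to \<open>c\<close> cannot visit both \<open>0\<close> and \<open>1\<close> at rate \<open>c\<close>: with \<open>V\<^sub>i\<close> the event that
  the particle visits \<open>i\<close>, we have \<open>P(V\<^sub>0) + P(V\<^sub>1) \<le> 1 + P(V\<^sub>0 \<inter> V\<^sub>1) \<le> 1 + p(1) < 2\<close>. If at certain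
  large times all recent traffic through \<open>0\<close> and \<open>1\<close> stems from one single slow site, the limit
  cannot be \<open>\<mu>\<^sub>c\<close>. Considering both sites at once makes the argument independent of the
  periodicity of \<open>p\<close>, and averaging over time makes the computation of transient laws
  superfluous.

  The initial configuration (\<open>stacks\<close>) consists of huge stacks at sparse sites \<open>w\<^sub>0 > w\<^sub>1 > \<dots>\<close> with
  \<open>\<alpha>(w\<^sub>k) \<rightarrow> c\<close>. The stack at \<open>w\<^sub>k\<close> has height \<open>(k + 1) |w\<^sub>k\<^sub>+\<^sub>1|\<close>, large compared with the position of
  the \<^emph>\<open>next\<close> stack, so the density is infinite (\<open>stacks_density\<close>). The site \<open>w\<^sub>k\<^sub>+\<^sub>1\<close> is chosen
  after \<open>w\<^sub>k\<close> and the time horizon \<open>T\<^sub>k\<close>, so far away that with probability close to one nothing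
  emitted at or beyond \<open>w\<^sub>k\<^sub>+\<^sub>1\<close> arrives in the window \<open>[w\<^sub>k, 1]\<close> before time \<open>T\<^sub>k\<close>. The horizon in
  turn is much larger than the total mass \<open>N\<^sub>k\<close> of the stacks to the right of \<open>w\<^sub>k\<close>. Up to time
  \<open>T\<^sub>k\<close> the sites \<open>0\<close> and \<open>1\<close> thus see at most the \<open>\<alpha>(w\<^sub>k) T\<^sub>k\<close> particles emitted by \<open>w\<^sub>k\<close> in the
  mean, plus \<open>N\<^sub>k\<close> others, and the average over \<open>[0, T\<^sub>k]\<close> of \<open>E[\<alpha>(0) g(\<eta>\<^sub>t(0)) + \<alpha>(1) g(\<eta>\<^sub>t(1))]\<close> is
  asymptotically at most \<open>(1 + p(1)) c < 2 c\<close>. This expression is the expectation of a bounded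
  continuous function whose integral under \<open>\<mu>\<^sub>c\<close> is \<open>2 c\<close> (\<open>service_under_mu\<close>).

  The probabilistic work is carried by three facts.

  \<^item> \<open>campbell\<close>: rings of a site form a Poisson process, in the form of an identity for one ring,
    obtained by resampling its waiting time and marks. The totally asymmetric dynamics inside a
    window can be written as a recursion from left to right, site by site and ring by ring
    (\<open>departs\<close>). Hence what a ring acts on is visibly independent of that ring, and the formula
    gives the mean number of departures as the integrated mean service rate
    (\<open>expected_departures\<close>).

  \<^item> \<open>flux_le\<close>: conservation of particles. The mean flux across the bond \<open>(y, y + 1)\<close> is
    \<open>\<Sum>\<^sub>x\<^sub>\<le>\<^sub>y D(x) P(Z > y - x)\<close> with \<open>D(x)\<close> the mean number of departures from \<open>x\<close>; it is bounded by
    the mean output of the leftmost site plus the initial mass to the right of it. For \<open>y = 1\<close> it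
    contains \<open>D(1) + (1 - p(1)) D(0)\<close>, which is what yields the constant \<open>1 + p(1)\<close> in place of
    \<open>2\<close>.

  \<^item> \<open>chains_expectation_le\<close>: finite speed of propagation. A particle in the window that comes from
    outside leaves behind a chain of rings, increasing in space and time. The mean number of
    chains with \<open>m\<close> steps in time \<open>t\<close> which end at a given site is \<open>t\<^sup>m / m!\<close>, no matter how many
    particles there are.

  A trajectory satisfying the evolution rule is identified with the recursion by purely
  deterministic arguments: occupation numbers equal initial values plus arrivals minus departures
  (\<open>occupancy\<close>), and in the absence of chains from outside the departures in the window are those
  of the recursion (\<open>evolution_eq_queue\<close>).
\<close>

section \<open>The driving noise and its Palm formula\<close>

definition mark_law :: "int pmf \<Rightarrow> (real \<times> int) measure" where
  "mark_law p = uniform_measure lborel {0<..<1} \<Otimes>\<^sub>M measure_pmf p"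

definition event_law :: "int pmf \<Rightarrow> (real \<times> real \<times> int) measure" where
  "event_law p = density lborel (exponential_density 1) \<Otimes>\<^sub>M mark_law p"

text \<open>
  All expectations are computed on this canonical space of driving noises; a point \<open>X\<close> assigns to
  the \<open>k\<close>-th ring at site \<open>x\<close> its waiting time \<open>fst (X (x, k))\<close> and its pair of marks.
\<close>

definition canonical :: "int pmf \<Rightarrow> (int \<times> nat \<Rightarrow> real \<times> real \<times> int) measure" where
  "canonical p = (\<Pi>\<^sub>M i\<in>UNIV. event_law p)"

definition mark :: "(int \<times> nat \<Rightarrow> real \<times> real \<times> int) \<Rightarrow> int \<Rightarrow> nat \<Rightarrow> real \<times> int" where
  "mark X x k = snd (X (x, k))"

text \<open>
  The clock is shifted by one with respect to the rings: \<open>clock X x k\<close> is the time from which on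
  the ring number \<open>k\<close> is awaited, so that \<open>[clock X x k, ring X x k)\<close> is the \<open>k\<close>-th waiting
  period.
\<close>

definition clock :: "(int \<times> nat \<Rightarrow> real \<times> real \<times> int) \<Rightarrow> int \<Rightarrow> nat \<Rightarrow> real" where
  "clock X x k = (\<Sum>j<k. fst (X (x, j)))"

abbreviation ring :: "(int \<times> nat \<Rightarrow> real \<times> real \<times> int) \<Rightarrow> int \<Rightarrow> nat \<Rightarrow> real" where
  "ring X x k \<equiv> clock X x (Suc k)"

lemma clock_0[simp]: "clock X x 0 = 0"
  by (simp add: clock_def)

lemma sets_mark_law[measurable_cong]: "sets (mark_law p) = sets (borel \<Otimes>\<^sub>M count_space UNIV)"
  unfolding mark_law_def by (intro sets_pair_measure_cong) auto

lemma sets_event_law[measurable_cong]: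
  "sets (event_law p) = sets (borel \<Otimes>\<^sub>M (borel \<Otimes>\<^sub>M count_space UNIV))"
  unfolding event_law_def by (intro sets_pair_measure_cong sets_mark_law) auto

lemma sets_canonical:
  "sets (canonical p) = sets (\<Pi>\<^sub>M i\<in>UNIV. borel \<Otimes>\<^sub>M (borel \<Otimes>\<^sub>M count_space UNIV))"
  unfolding canonical_def by (intro sets_PiM_cong sets_event_law refl)

lemma prob_space_uniform01: "prob_space (uniform_measure lborel {0<..<1::real})"
  by (rule prob_space_uniform_measure) auto

lemma prob_space_mark_law: "prob_space (mark_law p)"
  unfolding mark_law_def
  by (intro prob_space_pair prob_space_uniform01 measure_pmf.prob_space_axioms)

lemma prob_space_event_law: "prob_space (event_law p)"
  unfolding event_law_def
  by (intro prob_space_pair prob_space_exponential_density prob_space_mark_law) auto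

lemma prob_space_canonical: "prob_space (canonical p)"
  unfolding canonical_def by (intro prob_space_PiM prob_space_event_law)

lemma coord_measurable:
  "(\<lambda>X. X i) \<in> canonical p \<rightarrow>\<^sub>M borel \<Otimes>\<^sub>M (borel \<Otimes>\<^sub>M count_space UNIV)"
  unfolding canonical_def event_law_def mark_law_def by measurable

lemma clock_measurable[measurable]: "(\<lambda>X. clock X x k) \<in> borel_measurable (canonical p)"
  unfolding clock_def
  by (intro borel_measurable_sum measurable_compose[OF coord_measurable measurable_fst])

lemma mark_measurable[measurable]:
  "(\<lambda>X. mark X x k) \<in> canonical p \<rightarrow>\<^sub>M borel \<Otimes>\<^sub>M count_space UNIV"
  unfolding mark_def by (rule measurable_compose[OF coord_measurable measurable_snd])

text \<open>
  Replacing one coordinate of an independent family by a fresh copy does not change the law. All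
  uses of independence below are instances of this identity.
\<close>

lemma resample:
  assumes [measurable]: "F \<in> borel_measurable (canonical p)"
  shows "(\<integral>\<^sup>+X. F X \<partial>canonical p) = (\<integral>\<^sup>+X. \<integral>\<^sup>+v. F (X(i := v)) \<partial>event_law p \<partial>canonical p)"
proof -
  interpret ev: prob_space "event_law p" by (rule prob_space_event_law)
  interpret ca: prob_space "canonical p" by (rule prob_space_canonical)
  interpret pair_sigma_finite "event_law p" "canonical p" ..
  have upd[measurable]: "(\<lambda>(x, X). X(i := x)) \<in> event_law p \<Otimes>\<^sub>M canonical p \<rightarrow>\<^sub>M canonical p"
    unfolding canonical_def split_beta'
    by (rule measurable_fun_upd[where J = UNIV]) auto
  have "canonical p = distr (event_law p \<Otimes>\<^sub>M canonical p) (canonical p) (\<lambda>(x, X). X(i := x))"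
    using distr_pair_PiM_eq_PiM[of UNIV "\<lambda>_. event_law p" i] prob_space_event_law
    by (simp add: canonical_def)
  then have "(\<integral>\<^sup>+X. F X \<partial>canonical p) =
      (\<integral>\<^sup>+X. F X \<partial>distr (event_law p \<Otimes>\<^sub>M canonical p) (canonical p) (\<lambda>(x, X). X(i := x)))"
    by simp
  also have "\<dots> = (\<integral>\<^sup>+v. F (case v of (x, X) \<Rightarrow> X(i := x)) \<partial>(event_law p \<Otimes>\<^sub>M canonical p))"
    by (rule nn_integral_distr) auto
  also have "\<dots> = (\<integral>\<^sup>+X. \<integral>\<^sup>+v. F (X(i := v)) \<partial>event_law p \<partial>canonical p)"
    by (subst nn_integral_snd[symmetric]) (auto simp: split_beta')
  finally show ?thesis .
qed

lemma nn_integral_event_law: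
  assumes [measurable]: "F \<in> borel_measurable (event_law p)"
  shows "(\<integral>\<^sup>+v. F v \<partial>event_law p) =
    (\<integral>\<^sup>+e. ennreal (exponential_density 1 e) * (\<integral>\<^sup>+m. F (e, m) \<partial>mark_law p) \<partial>lborel)"
proof -
  interpret ml: prob_space "mark_law p" by (rule prob_space_mark_law)
  have [measurable]: "F \<in> borel_measurable (borel \<Otimes>\<^sub>M mark_law p)"
    using assms by (simp cong: measurable_cong_sets add: sets_event_law sets_mark_law)
  have "(\<integral>\<^sup>+v. F v \<partial>event_law p) =
     (\<integral>\<^sup>+e. (\<integral>\<^sup>+m. F (e, m) \<partial>mark_law p) \<partial>density lborel (exponential_density 1))"
    unfolding event_law_def
    by (rule ml.nn_integral_fst[symmetric]) (use assms in \<open>simp add: event_law_def\<close>)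
  also have "\<dots> = (\<integral>\<^sup>+e. ennreal (exponential_density 1 e) * (\<integral>\<^sup>+m. F (e, m) \<partial>mark_law p) \<partial>lborel)"
    by (rule nn_integral_density) measurable
  finally show ?thesis .
qed

lemma exponential_tail:
  "(\<integral>\<^sup>+e. ennreal (exponential_density 1 e) * indicator {a<..} e \<partial>lborel) = ennreal (exp (- a))" if
    "0 \<le> a"
proof -
  have "(\<integral>\<^sup>+e. ennreal (exponential_density 1 e) * indicator {a<..} e \<partial>lborel) =
    (\<integral>\<^sup>+e. ennreal (exp (- e)) * indicator {a..} e \<partial>lborel)"
    using that AE_lborel_singleton[of a]
    by (intro nn_integral_cong_AE) (auto simp: exponential_density_def indicator_def elim!:
      eventually_mono)
  also have "\<dots> = ennreal (0 - - exp (- a))"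
  proof (rule nn_integral_FTC_atLeast[where F = "\<lambda>x. - exp (- x)"])
    show "((\<lambda>x. - exp (- x)) \<longlongrightarrow> (0::real)) at_top"
      by real_asymp
  qed (auto intro!: derivative_eq_intros)
  finally show ?thesis by simp
qed

text \<open>
  Let \<open>F\<close> be a random function of time and marks that does not look at the ring \<open>(x, k)\<close>. Given
  all other coordinates, the ring has the density \<open>exp (a - s)\<close> on \<open>s \<ge> a\<close>, where \<open>a\<close> is the
  beginning of the waiting period, and \<open>exp (a - s)\<close> is also the probability that the ring has
  not yet occurred at time \<open>s\<close>. So evaluating \<open>F\<close> at the ring and integrating \<open>F\<close> over the
  waiting period have the same mean. Summed over \<open>k\<close>, this is Campbell's formula for the Poisson
  process.
\<close>

lemma campbell:
  assumes F[measurable]: "(\<lambda>(X, s, m). F X s m) \<in> borel_measurable (canonical p \<Otimes>\<^sub>M borel \<Otimes>\<^sub>M borel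
    \<Otimes>\<^sub>M count_space UNIV)"
    and indep: "\<And>X v. F (X((x, k) := v)) = F X"
  shows "(\<integral>\<^sup>+X. F X (ring X x k) (mark X x k) \<partial>canonical p) =
    (\<integral>\<^sup>+X. \<integral>\<^sup>+s. indicator {clock X x k..<ring X x k} s * (\<integral>\<^sup>+m. F X s m \<partial>mark_law p) \<partial>lborel
      \<partial>canonical p)"
proof -
  interpret ml: prob_space "mark_law p" by (rule prob_space_mark_law)
  interpret ev: prob_space "event_law p" by (rule prob_space_event_law)
  interpret sf: pair_sigma_finite "event_law p" lborel
    by standard
  define G where "G X s = (\<integral>\<^sup>+m. F X s m \<partial>mark_law p)" for X s
  have F'[measurable]: "(\<lambda>v. F (fst (fst v)) (snd (fst v)) (snd v))
      \<in> borel_measurable ((canonical p \<Otimes>\<^sub>M borel) \<Otimes>\<^sub>M (borel \<Otimes>\<^sub>M count_space UNIV))"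
  proof -
    have "(\<lambda>v. (fst (fst v), snd (fst v), snd v))
        \<in> ((canonical p \<Otimes>\<^sub>M borel) \<Otimes>\<^sub>M (borel \<Otimes>\<^sub>M count_space UNIV)) \<rightarrow>\<^sub>M
          (canonical p \<Otimes>\<^sub>M borel \<Otimes>\<^sub>M borel \<Otimes>\<^sub>M count_space UNIV)"
      by measurable
    from measurable_compose[OF this F] show ?thesis by simp
  qed
  have G[measurable]: "(\<lambda>(X, s). G X s) \<in> borel_measurable (canonical p \<Otimes>\<^sub>M borel)"
    unfolding G_def split_beta' by measurable
  have Gs[measurable]: "G X \<in> borel_measurable borel" for X
  proof -
    have "X \<in> space (canonical p)" by (simp add: canonical_def space_PiM event_law_def mark_law_def
      space_pair_measure)
    from measurable_compose[OF measurable_Pair1'[OF this] G] show ?thesis by simp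
  qed
  have Fs[measurable]: "(\<lambda>v. F X (fst v) (snd v)) \<in> borel_measurable (borel \<Otimes>\<^sub>M (borel \<Otimes>\<^sub>M
    count_space UNIV))" for X
  proof -
    have [measurable]: "X \<in> space (canonical p)"
      by (simp add: canonical_def space_PiM event_law_def mark_law_def space_pair_measure)
    have "(\<lambda>v. ((X, fst v), snd v)) \<in> borel \<Otimes>\<^sub>M (borel \<Otimes>\<^sub>M count_space UNIV) \<rightarrow>\<^sub>M
        (canonical p \<Otimes>\<^sub>M borel) \<Otimes>\<^sub>M (borel \<Otimes>\<^sub>M count_space UNIV)"
      by measurable
    from measurable_compose[OF this F'] show ?thesis by simp
  qed
  have cl: "clock (X((x, k) := v)) x k = clock X x k" for X v
    by (simp add: clock_def)
  have rg: "ring (X((x, k) := v)) x k = clock X x k + fst v" for X v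
    by (simp add: clock_def)
  have mk: "mark (X((x, k) := v)) x k = snd v" for X v
    by (simp add: mark_def)
  have "(\<integral>\<^sup>+X. F X (ring X x k) (mark X x k) \<partial>canonical p) =
    (\<integral>\<^sup>+X. \<integral>\<^sup>+v. F X (clock X x k + fst v) (snd v) \<partial>event_law p \<partial>canonical p)"
  proof (subst resample[where i = "(x, k)"])
    show "(\<lambda>X. F X (ring X x k) (mark X x k)) \<in> borel_measurable (canonical p)"
    proof -
      have "(\<lambda>X. ((X, ring X x k), mark X x k)) \<in> canonical p \<rightarrow>\<^sub>M
          (canonical p \<Otimes>\<^sub>M borel) \<Otimes>\<^sub>M (borel \<Otimes>\<^sub>M count_space UNIV)"
        by measurable
      from measurable_compose[OF this F'] show ?thesis by simp
    qed
  qed (simp only: rg mk indep)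
  also have "\<dots> = (\<integral>\<^sup>+X. \<integral>\<^sup>+s. ennreal (exponential_density 1 (s - clock X x k)) * G X s \<partial>lborel
    \<partial>canonical p)"
  proof (rule nn_integral_cong)
    fix X
    have "(\<integral>\<^sup>+v. F X (clock X x k + fst v) (snd v) \<partial>event_law p) =
        (\<integral>\<^sup>+e. ennreal (exponential_density 1 e) * G X (clock X x k + e) \<partial>lborel)"
    proof (subst nn_integral_event_law)
      have "(\<lambda>v. (a + fst v, snd v)) \<in> event_law p \<rightarrow>\<^sub>M
          borel \<Otimes>\<^sub>M (borel \<Otimes>\<^sub>M count_space UNIV)" for a :: real
        by measurable
      from measurable_compose[OF this Fs]
      show "(\<lambda>v. F X (clock X x k + fst v) (snd v)) \<in> borel_measurable (event_law p)"
        by simp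
    qed (simp add: G_def)
    also have "\<dots> = (\<integral>\<^sup>+s. ennreal (exponential_density 1 (s - clock X x k)) * G X s \<partial>lborel)"
      by (subst (2) nn_integral_real_affine[where c = 1 and t = "clock X x k"]) auto
    finally show "(\<integral>\<^sup>+v. F X (clock X x k + fst v) (snd v) \<partial>event_law p) = \<dots>" .
  qed
  \<comment> \<open>the density at \<open>s - clock X x k\<close> is turned into the probability that a fresh waiting time exceeds
    \<open>s - clock X x k\<close>\<close>
  also have "\<dots> = (\<integral>\<^sup>+X. \<integral>\<^sup>+v. \<integral>\<^sup>+s. indicator {clock X x k..<clock X x k + fst v} s * G X s \<partial>lborel
    \<partial>event_law p \<partial>canonical p)"
  proof (rule nn_integral_cong)
    fix X
    let ?c = "clock X x k"
    have "(\<integral>\<^sup>+v. \<integral>\<^sup>+s. indicator {?c..<?c + fst v} s * G X s \<partial>lborel \<partial>event_law p) =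
        (\<integral>\<^sup>+v. \<integral>\<^sup>+s. (if ?c \<le> s \<and> s < ?c + fst v then G X s else 0) \<partial>lborel \<partial>event_law p)"
      by (intro nn_integral_cong) (auto simp: indicator_def)
    also have "\<dots> = (\<integral>\<^sup>+s. \<integral>\<^sup>+v. (if ?c \<le> s \<and> s < ?c + fst v then G X s else 0) \<partial>event_law p \<partial>lborel)"
      by (rule sf.Fubini'[symmetric]) measurable
    also have "\<dots> = (\<integral>\<^sup>+s. ennreal (exponential_density 1 (s - clock X x k)) * G X s \<partial>lborel)"
    proof (rule nn_integral_cong)
      fix s
      have "(\<integral>\<^sup>+v. (if ?c \<le> s \<and> s < ?c + fst v then G X s else 0) \<partial>event_law p) =
        (\<integral>\<^sup>+e. (ennreal (exponential_density 1 e) * indicator {s - ?c<..} e) * (if ?c \<le> s then G X s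
          else 0) \<partial>lborel)"
        by (subst nn_integral_event_law) (auto simp: ml.emeasure_space_1 indicator_def algebra_simps
          intro!: nn_integral_cong)
      also have "\<dots> = (\<integral>\<^sup>+e. (ennreal (exponential_density 1 e) * indicator {s - ?c<..} e) \<partial>lborel) *
        (if ?c \<le> s then G X s else 0)"
        by (rule nn_integral_multc) auto
      also have "\<dots> = ennreal (exponential_density 1 (s - clock X x k)) * G X s"
        using exponential_tail[of "s - ?c"] by (auto simp: exponential_density_def[of 1 "s - ?c"])
      finally show "(\<integral>\<^sup>+v. (if ?c \<le> s \<and> s < ?c + fst v then G X s else 0) \<partial>event_law p) = \<dots>" .
    qed
    finally show "(\<integral>\<^sup>+s. ennreal (exponential_density 1 (s - clock X x k)) * G X s \<partial>lborel) =
      (\<integral>\<^sup>+v. \<integral>\<^sup>+s. indicator {?c..<?c + fst v} s * G X s \<partial>lborel \<partial>event_law p)" ..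
  qed
  also have "\<dots> = (\<integral>\<^sup>+X. \<integral>\<^sup>+s. indicator {clock X x k..<ring X x k} s * G X s \<partial>lborel \<partial>canonical p)"
  proof (subst (2) resample[where i = "(x, k)"])
    have "(\<lambda>X. \<integral>\<^sup>+s. (if clock X x k \<le> s \<and> s < ring X x k then G X s else 0) \<partial>lborel) \<in>
      borel_measurable (canonical p)"
      by measurable
    also have "(\<lambda>X. \<integral>\<^sup>+s. (if clock X x k \<le> s \<and> s < ring X x k then G X s else 0) \<partial>lborel) =
       (\<lambda>X. \<integral>\<^sup>+s. indicator {clock X x k..<ring X x k} s * G X s \<partial>lborel)"
      by (intro ext nn_integral_cong) (auto simp: indicator_def)
    finally show "\<dots> \<in> borel_measurable (canonical p)" .
  qed (simp only: rg cl indep fun_upd_same G_def)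
  finally show ?thesis by (simp add: G_def)
qed

text \<open>
  A Harris system on an arbitrary probability space, read as a point of the canonical space.
\<close>

definition noise :: "(int \<Rightarrow> nat \<Rightarrow> 'w \<Rightarrow> real) \<Rightarrow> (int \<Rightarrow> nat \<Rightarrow> 'w \<Rightarrow> real) \<Rightarrow> (int \<Rightarrow> nat \<Rightarrow> 'w \<Rightarrow> int)
    \<Rightarrow> 'w \<Rightarrow> int \<times> nat \<Rightarrow> real \<times> real \<times> int" where
  "noise E U Z \<omega> = (\<lambda>(x, k). (E x k \<omega>, U x k \<omega>, Z x k \<omega>))"

lemma noise_distr:
  assumes "harris_system M p E U Z"
  shows "noise E U Z \<in> M \<rightarrow>\<^sub>M canonical p" "distr M (canonical p) (noise E U Z) = canonical p"
proof -
  interpret prob_space M using assms by (simp add: harris_system_def)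
  define Y where "Y = (\<lambda>i \<omega>. case i of (x, k) \<Rightarrow> (E x k \<omega>, (U x k \<omega>, Z x k \<omega>)))"
  let ?S = "borel \<Otimes>\<^sub>M (borel \<Otimes>\<^sub>M count_space UNIV) :: (real \<times> real \<times> int) measure"
  have ind: "indep_vars (\<lambda>_. ?S) Y UNIV"
    using assms by (simp add: harris_system_def Y_def case_prod_beta')
  then have rv: "Y i \<in> M \<rightarrow>\<^sub>M ?S" for i
    unfolding indep_vars_def by blast
  have d: "distr M ?S (Y i) = event_law p" for i
    using assms by (cases i) (simp add: harris_system_def Y_def event_law_def mark_law_def)
  have eq: "noise E U Z = (\<lambda>\<omega>. \<lambda>i\<in>UNIV. Y i \<omega>)"
    by (auto simp: noise_def Y_def fun_eq_iff)
  have "distr M (\<Pi>\<^sub>M i\<in>UNIV. ?S) (noise E U Z) = canonical p"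
    using ind indep_vars_iff_distr_eq_PiM[where I = UNIV and M' = "\<lambda>_. ?S" and X = Y, OF
      UNIV_not_empty rv] d
    by (simp add: eq canonical_def)
  moreover have "distr M (\<Pi>\<^sub>M i\<in>UNIV. ?S) (noise E U Z) = distr M (canonical p) (noise E U Z)"
    by (rule distr_cong) (simp_all add: sets_canonical)
  ultimately show "distr M (canonical p) (noise E U Z) = canonical p" by simp
  have "noise E U Z \<in> M \<rightarrow>\<^sub>M (\<Pi>\<^sub>M i\<in>UNIV. ?S)"
    unfolding eq using rv by (intro measurable_restrict)
  then show "noise E U Z \<in> M \<rightarrow>\<^sub>M canonical p"
    by (simp add: measurable_cong_sets[OF refl sets_canonical])
qed

lemma AE_mark_law:
  "AE m in mark_law p. 0 < fst m \<and> fst m < 1 \<and> snd m \<in> set_pmf p"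
proof -
  interpret u: prob_space "uniform_measure lborel {0<..<1::real}" by (rule prob_space_uniform01)
  interpret pair_prob_space "uniform_measure lborel {0<..<1::real}" "measure_pmf p" ..
  show ?thesis unfolding mark_law_def
  proof (rule AE_pair_measure)
    show "AE x in uniform_measure lborel {0<..<1::real}. AE y in measure_pmf p.
      0 < fst (x, y) \<and> fst (x, y) < 1 \<and> snd (x, y) \<in> set_pmf p"
      by (rule AE_uniform_measureI) (auto simp: AE_measure_pmf_iff)
    have "Measurable.pred (borel \<Otimes>\<^sub>M count_space UNIV) (\<lambda>m. 0 < fst m \<and> fst m < (1::real) \<and> snd m \<in>
      set_pmf p)"
      by measurable
    then show "{x \<in> space (uniform_measure lborel {0<..<1::real} \<Otimes>\<^sub>M measure_pmf p).
        0 < fst x \<and> fst x < 1 \<and> snd x \<in> set_pmf p} \<in> sets (uniform_measure lborel {0<..<1} \<Otimes>\<^sub>M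
          measure_pmf p)"
      using sets_mark_law[of p] by (simp add: pred_def space_pair_measure mark_law_def)
  qed
qed

lemma emeasure_uniform01: "0 \<le> a \<Longrightarrow> a \<le> 1 \<Longrightarrow> emeasure (uniform_measure lborel {0<..<1::real}) {..a} =
  ennreal a"
proof -
  assume a: "0 \<le> a" "a \<le> 1"
  have "emeasure lborel ({0<..<1} \<inter> {..a}) = emeasure lborel {0..a}"
    using a AE_lborel_singleton[of 0] AE_lborel_singleton[of 1]
    by (intro emeasure_eq_AE) (auto elim!: eventually_elim2)
  then show ?thesis using a by (simp add: emeasure_uniform_measure divide_ennreal_def)
qed

lemma emeasure_mark_law:
  "B \<in> sets borel \<Longrightarrow> emeasure (mark_law p) (B \<times> D) =
    emeasure (uniform_measure lborel {0<..<1}) B * emeasure (measure_pmf p) D"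
  unfolding mark_law_def by (intro measure_pmf.emeasure_pair_measure_Times) auto

lemma AE_event_law: "AE v in event_law p. 0 < fst v \<and> 0 < fst (snd v) \<and> snd (snd v) \<in> set_pmf p"
proof -
  interpret ml: prob_space "mark_law p" by (rule prob_space_mark_law)
  interpret ex: prob_space "density lborel (exponential_density 1)"
    by (rule prob_space_exponential_density) simp
  interpret pair_prob_space "density lborel (exponential_density 1)" "mark_law p" ..
  show ?thesis unfolding event_law_def
  proof (rule AE_pair_measure)
    have "AE e in lborel. e \<noteq> (0::real)" by (rule AE_lborel_singleton)
    then have "AE e in lborel. 0 < ennreal (exponential_density 1 e) \<longrightarrow> (0::real) < e"
      by eventually_elim (auto simp: exponential_density_def split: if_splits)
    then have pos: "AE e in density lborel (exponential_density 1). (0::real) < e"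
      by (subst AE_density) auto
    then show "AE x in density lborel (exponential_density 1). AE y in mark_law p.
        0 < fst (x, y) \<and> 0 < fst (snd (x, y)) \<and> snd (snd (x, y)) \<in> set_pmf p"
      using AE_mark_law[of p] by (auto elim!: eventually_mono)
  qed measurable
qed

lemma AE_canonical_positive:
  assumes "\<And>z. z \<le> 0 \<Longrightarrow> pmf p z = 0"
  shows "AE X in canonical p. \<forall>x k. 0 < fst (X (x, k)) \<and> 0 < fst (mark X x k) \<and> 0 < snd (mark X x k)"
proof -
  have "AE X in canonical p. 0 < fst (X (x, k)) \<and> 0 < fst (snd (X (x, k))) \<and> snd (snd (X (x, k))) \<in>
    set_pmf p" for x k
    unfolding canonical_def
    by (rule AE_PiM_component[of UNIV "\<lambda>_. event_law p" "(x, k)", OF prob_space_event_law UNIV_I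
      AE_event_law])
  then have "AE X in canonical p. \<forall>x k. 0 < fst (X (x, k)) \<and> 0 < fst (snd (X (x, k))) \<and> snd (snd (X
    (x, k))) \<in> set_pmf p"
    by (simp add: AE_all_countable)
  then show ?thesis
  proof eventually_elim
    case (elim X)
    then show ?case using assms by (auto simp: mark_def set_pmf_iff) (metis not_le)
  qed
qed

lemma suminf_clock_intervals_le:
  assumes "\<And>k. 0 < fst (X (x, k))"
  shows "(\<Sum>k. indicator {clock X x k..<ring X x k} s) \<le> (indicator {0..} s :: ennreal)"
proof -
  have mono: "mono (clock X x)"
    using assms by (auto simp: mono_iff_le_Suc clock_def intro: less_imp_le)
  have nonneg: "0 \<le> clock X x k" for k using monoD[OF mono, of 0 k] by simp
  have "disjoint_family (\<lambda>k. {clock X x k..<ring X x k})"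
    unfolding disjoint_family_on_def
  proof (intro ballI impI)
    fix k l :: nat assume "k \<noteq> l"
    then consider "Suc k \<le> l" | "Suc l \<le> k" by linarith
    then show "{clock X x k..<ring X x k} \<inter> {clock X x l..<ring X x l} = {}"
      using monoD[OF mono, of "Suc k" l] monoD[OF mono, of "Suc l" k] by cases force+
  qed
  then have "(\<Sum>k. indicator {clock X x k..<ring X x k} s) =
      (indicator (\<Union>k. {clock X x k..<ring X x k}) s :: ennreal)"
    by (rule suminf_indicator)
  also have "\<dots> \<le> indicator {0..} s"
    using nonneg by (auto simp: indicator_def intro: order_trans)
  finally show ?thesis .
qed

lemma space_canonical[simp]: "space (canonical p) = UNIV"
  by (auto simp: canonical_def space_PiM event_law_def mark_law_def space_pair_measure)

text \<open>
  If \<open>F\<close> depends on no ring at \<open>x\<close> at all, Campbell's formula can be summed over \<open>k\<close>, as the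
  waiting periods of a site are disjoint.
\<close>

lemma sum_campbell_le:
  assumes pos: "\<And>z. z \<le> 0 \<Longrightarrow> pmf p z = 0"
    and F[measurable]: "(\<lambda>(X, s, m). F X s m) \<in> borel_measurable (canonical p \<Otimes>\<^sub>M borel \<Otimes>\<^sub>M borel
      \<Otimes>\<^sub>M count_space UNIV)"
    and indep: "\<And>X k v. F (X((x, k) := v)) = F X"
  shows "(\<Sum>k. \<integral>\<^sup>+X. F X (ring X x k) (mark X x k) \<partial>canonical p) \<le>
    (\<integral>\<^sup>+X. \<integral>\<^sup>+s. indicator {0..} s * (\<integral>\<^sup>+m. F X s m \<partial>mark_law p) \<partial>lborel \<partial>canonical p)"
proof -
  interpret ml: prob_space "mark_law p" by (rule prob_space_mark_law)
  define G where "G X s = (\<integral>\<^sup>+m. F X s m \<partial>mark_law p)" for X s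
  have posX: "AE X in canonical p. \<forall>x k. 0 < fst (X (x, k)) \<and> 0 < fst (mark X x k) \<and> 0 < snd (mark X
    x k)"
    by (rule AE_canonical_positive) (rule pos)
  have "(\<lambda>v. (fst (fst v), snd (fst v), snd v))
      \<in> ((canonical p \<Otimes>\<^sub>M borel) \<Otimes>\<^sub>M (borel \<Otimes>\<^sub>M count_space UNIV)) \<rightarrow>\<^sub>M
        (canonical p \<Otimes>\<^sub>M borel \<Otimes>\<^sub>M borel \<Otimes>\<^sub>M count_space UNIV)"
    by measurable
  from measurable_compose[OF this F]
  have [measurable]: "(\<lambda>v. F (fst (fst v)) (snd (fst v)) (snd v))
      \<in> borel_measurable ((canonical p \<Otimes>\<^sub>M borel) \<Otimes>\<^sub>M (borel \<Otimes>\<^sub>M count_space UNIV))"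
    by simp
  have G[measurable]: "(\<lambda>v. G (fst v) (snd v)) \<in> borel_measurable (canonical p \<Otimes>\<^sub>M borel)"
    unfolding G_def by measurable
  have Gs[measurable]: "G X \<in> borel_measurable borel" for X
    using measurable_compose[OF measurable_Pair1'[of X "canonical p"] G] by simp
  have ind: "(\<lambda>v. indicator {clock (fst v) x k..<ring (fst v) x k} (snd v) :: ennreal) \<in>
    borel_measurable (canonical p \<Otimes>\<^sub>M borel)" for k
  proof -
    have "Measurable.pred (canonical p \<Otimes>\<^sub>M borel) (\<lambda>v. clock (fst v) x k \<le> snd v \<and> snd v < ring (fst
      v) x k)"
      by measurable
    then show ?thesis unfolding indicator_def by simp
  qed
  have m: "(\<lambda>X. \<integral>\<^sup>+s. indicator {clock X x k..<ring X x k} s * G X s \<partial>lborel) \<in> borel_measurable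
    (canonical p)" for k
  proof -
    have "(\<lambda>v. indicator {clock (fst v) x k..<ring (fst v) x k} (snd v) * G (fst v) (snd v)) \<in>
      borel_measurable (canonical p \<Otimes>\<^sub>M lborel)"
      using ind[of k] by measurable
    then show ?thesis
      by (intro lborel.borel_measurable_nn_integral) (simp add: split_beta')
  qed
  have "(\<Sum>k. \<integral>\<^sup>+X. F X (ring X x k) (mark X x k) \<partial>canonical p) =
    (\<Sum>k. \<integral>\<^sup>+X. \<integral>\<^sup>+s. indicator {clock X x k..<ring X x k} s * G X s \<partial>lborel \<partial>canonical p)"
    unfolding G_def by (intro suminf_cong campbell F indep)
  also have "\<dots> = (\<integral>\<^sup>+X. (\<Sum>k. \<integral>\<^sup>+s. indicator {clock X x k..<ring X x k} s * G X s \<partial>lborel)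
    \<partial>canonical p)"
    by (rule nn_integral_suminf[symmetric]) (rule m)
  also have "\<dots> \<le> (\<integral>\<^sup>+X. \<integral>\<^sup>+s. indicator {0..} s * G X s \<partial>lborel \<partial>canonical p)"
  proof (rule nn_integral_mono_AE)
    show "AE X in canonical p. (\<Sum>k. \<integral>\<^sup>+s. indicator {clock X x k..<ring X x k} s * G X s \<partial>lborel)
        \<le> (\<integral>\<^sup>+s. indicator {0..} s * G X s \<partial>lborel)"
      using posX
    proof eventually_elim
      case (elim X)
      have "(\<Sum>k. \<integral>\<^sup>+s. indicator {clock X x k..<ring X x k} s * G X s \<partial>lborel) =
          (\<integral>\<^sup>+s. (\<Sum>k. indicator {clock X x k..<ring X x k} s * G X s) \<partial>lborel)"
        by (intro nn_integral_suminf[symmetric]) auto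
      also have "\<dots> = (\<integral>\<^sup>+s. (\<Sum>k. indicator {clock X x k..<ring X x k} s) * G X s \<partial>lborel)"
        by simp
      also have "\<dots> \<le> (\<integral>\<^sup>+s. indicator {0..} s * G X s \<partial>lborel)"
        using elim by (intro nn_integral_mono mult_right_mono suminf_clock_intervals_le) auto
      finally show ?case .
    qed
  qed
  finally show ?thesis by (simp add: G_def)
qed

section \<open>Occupation numbers as arrivals minus departures\<close>

text \<open>
  The properties of almost every noise on which the deterministic part relies. The third one says
  that only finitely many potential arrivals occur at a given site in finite time.
\<close>

definition regular :: "(int \<times> nat \<Rightarrow> real \<times> real \<times> int) \<Rightarrow> bool" where
  "regular X \<longleftrightarrow>
     (\<forall>x k. 0 < fst (X (x, k)) \<and> 0 < fst (mark X x k) \<and> 0 < snd (mark X x k)) \<and>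
     (\<forall>x t. finite {k. ring X x k \<le> t}) \<and>
     (\<forall>z t. finite {(x, k). ring X x k \<le> t \<and> x + snd (mark X x k) = z}) \<and>
     (\<forall>x k x' k'. ring X x k = ring X x' k' \<longrightarrow> x = x' \<and> k = k')"

lemma regularD:
  assumes "regular X"
  shows "0 < fst (mark X x k)" "0 < snd (mark X x k)" "finite {k. ring X x k \<le> t}"
    "finite {(x, k). ring X x k \<le> t \<and> x + snd (mark X x k) = z}"
    "ring X x k = ring X x' k' \<Longrightarrow> x = x' \<and> k = k'"
  using assms unfolding regular_def by (auto 0 3)

lemma regular_strict_mono: assumes "regular X" shows "strict_mono (clock X x)"
  using assms by (auto simp: strict_mono_Suc_iff regular_def clock_def)

lemma regular_ring_less: assumes "regular X" shows "ring X x k < ring X x l \<longleftrightarrow> k < l"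
  using strict_mono_less[OF regular_strict_mono[OF assms]] by simp

lemma regular_ring_pos: assumes "regular X" shows "0 < ring X x k"
  using strict_mono_less[OF regular_strict_mono[OF assms], of x 0 "Suc k"] by simp

definition fires ::
  "(int \<Rightarrow> real) \<Rightarrow> (nat \<Rightarrow> real) \<Rightarrow> (int \<times> nat \<Rightarrow> real \<times> real \<times> int) \<Rightarrow> (real \<Rightarrow> int \<Rightarrow> enat) \<Rightarrow> int \<Rightarrow> nat \<Rightarrow>
    bool"
  where "fires \<alpha> g X \<xi> x k \<longleftrightarrow>
    fst (mark X x k) \<le> \<alpha> x * g_ext g (left_limit \<xi> (ring X x k) x)"

abbreviation evolves ::
  "(int \<Rightarrow> real) \<Rightarrow> (nat \<Rightarrow> real) \<Rightarrow> (int \<times> nat \<Rightarrow> real \<times> real \<times> int) \<Rightarrow> (int \<Rightarrow> nat) \<Rightarrow> (real \<Rightarrow> int \<Rightarrow> enat)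
    \<Rightarrow> bool"
  where "evolves \<alpha> g X \<zeta> \<xi> \<equiv> harris_evolution \<alpha> g (ring X) (\<lambda>x k. fst (mark X x k))
     (\<lambda>x k. snd (mark X x k)) (\<lambda>x. enat (\<zeta> x)) \<xi>"

context
  fixes \<alpha> :: "int \<Rightarrow> real" and g :: "nat \<Rightarrow> real" and X :: "int \<times> nat \<Rightarrow> real \<times> real \<times> int"
    and \<zeta> :: "int \<Rightarrow> nat" and \<xi> :: "real \<Rightarrow> int \<Rightarrow> enat"
  assumes g0: "g 0 = 0" and reg: "regular X" and evo: "evolves \<alpha> g X \<zeta> \<xi>"
begin

lemma fires_occupied:
  assumes "fires \<alpha> g X \<xi> x k" shows "left_limit \<xi> (ring X x k) x \<noteq> 0"
proof
  assume "left_limit \<xi> (ring X x k) x = 0"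
  then have "fst (mark X x k) \<le> 0"
    using assms by (simp add: fires_def g_ext_def zero_enat_def g0)
  with regularD(1)[OF reg, of x k] show False by simp
qed

lemma constant_between:
  assumes "0 \<le> s" "s \<le> t" "\<And>x k. ring X x k \<in> {s<..t} \<Longrightarrow> z \<noteq> x \<and> z \<noteq> x + snd (mark X x k)"
  shows "\<xi> t z = \<xi> s z"
  using evo assms unfolding harris_evolution_def by blast

lemma finite_relevant:
  "finite {(x, k). ring X x k \<le> t \<and> (x = z \<or> x + snd (mark X x k) = z)}"
proof -
  have "{(x, k). ring X x k \<le> t \<and> (x = z \<or> x + snd (mark X x k) = z)} \<subseteq>
    Pair z ` {k. ring X z k \<le> t} \<union> {(x, k). ring X x k \<le> t \<and> x + snd (mark X x k) = z}"
    by auto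
  then show ?thesis
    using regularD(3)[OF reg, of z t] regularD(4)[OF reg, of t z] by (meson finite_UnI finite_imageI
      finite_subset)
qed

text \<open>
  Only finitely many rings before time \<open>t\<close> have \<open>z\<close> as their source or target. After the last of
  them the trajectory is constant at \<open>z\<close>, and so the left limit is the value at an earlier time.
\<close>

lemma quiet_before:
  assumes "0 < t"
  obtains s where "0 \<le> s" "s < t"
    "\<And>x k. ring X x k \<in> {s<..<t} \<Longrightarrow> z \<noteq> x \<and> z \<noteq> x + snd (mark X x k)"
    "left_limit \<xi> t z = \<xi> s z"
proof -
  define A where "A = {(x, k). ring X x k \<le> t \<and> (x = z \<or> x + snd (mark X x k) = z)}"
  define s where "s = Max (insert 0 {r \<in> (\<lambda>(x, k). ring X x k) ` A. r < t})"
  have fin: "finite (insert 0 {r \<in> (\<lambda>(x, k). ring X x k) ` A. r < t})"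
    using finite_relevant[of t z] by (auto simp: A_def)
  have s: "0 \<le> s" "s < t"
    using fin assms by (auto simp: s_def)
  have q: "z \<noteq> x \<and> z \<noteq> x + snd (mark X x k)" if "ring X x k \<in> {s<..<t}" for x k
  proof (rule ccontr)
    assume "\<not> ?thesis"
    then have "(x, k) \<in> A" using that by (auto simp: A_def)
    then have "ring X x k \<le> s"
      unfolding s_def using fin that by (intro Max_ge) auto
    with that show False by simp
  qed
  have "\<xi> r z = \<xi> s z" if "s < r" "r < t" for r
  proof (rule constant_between)
    fix x k assume "ring X x k \<in> {s<..r}"
    with that show "z \<noteq> x \<and> z \<noteq> x + snd (mark X x k)" by (intro q) auto
  qed (use that s in auto)
  then have "eventually (\<lambda>r. \<xi> r z = \<xi> s z) (at_left t)"
    using s by (auto simp: eventually_at_left intro!: exI[of _ s])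
  then have "((\<lambda>r. \<xi> r z) \<longlongrightarrow> \<xi> s z) (at_left t)"
    by (rule tendsto_eventually)
  then have "left_limit \<xi> t z = \<xi> s z"
    unfolding left_limit_def by (intro tendsto_Lim) simp_all
  with s q show ?thesis by (rule that)
qed

text \<open>
  Induction on the number of rings up to time \<open>t\<close> that concern \<open>z\<close>: the last of these rings
  changes both sides in the same way. Departures are added on the left so that no subtraction is
  needed; in particular the equation shows that \<open>\<xi> t z\<close> is finite.
\<close>

lemma occupancy:
  assumes "0 \<le> t"
  shows "\<xi> t z + enat (card {k. ring X z k \<le> t \<and> fires \<alpha> g X \<xi> z k}) =
    enat (\<zeta> z + card {(x, k). ring X x k \<le> t \<and> x + snd (mark X x k) = z \<and> fires \<alpha> g X \<xi> x k})"
  using assms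
proof (induction "card {(x, k). ring X x k \<le> t \<and> (x = z \<or> x + snd (mark X x k) = z)}"
    arbitrary: t rule: less_induct)
  case less
  define A where "A t = {(x, k). ring X x k \<le> t \<and> (x = z \<or> x + snd (mark X x k) = z)}" for t
  define I where "I t = {(x, k). ring X x k \<le> t \<and> x + snd (mark X x k) = z \<and> fires \<alpha> g X \<xi> x k}" for t
  define D where "D t = {k. ring X z k \<le> t \<and> fires \<alpha> g X \<xi> z k}" for t
  have finA: "finite (A t)" for t unfolding A_def by (rule finite_relevant)
  have finI: "finite (I t)" for t
    by (rule finite_subset[OF _ finA[of t]]) (auto simp: I_def A_def)
  have finD: "finite (D t)" for t
    by (rule finite_subset[OF _ regularD(3)[OF reg, of z t]]) (auto simp: D_def)
  show ?case
  proof (cases "A t = {}")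
    case True
    then have "\<xi> t z = \<xi> 0 z"
      using less.prems by (intro constant_between) (auto simp: A_def)
    moreover have "\<xi> 0 z = enat (\<zeta> z)"
      using evo by (simp add: harris_evolution_def)
    moreover have "I t = {}" "D t = {}"
      using True by (auto simp: I_def D_def A_def)
    ultimately show ?thesis by (simp flip: I_def D_def)
  next
    case False
    define \<tau> where "\<tau> = Max ((\<lambda>(x, k). ring X x k) ` A t)"
    have "\<tau> \<in> (\<lambda>(x, k). ring X x k) ` A t"
      unfolding \<tau>_def using False finA by (intro Max_in) auto
    then obtain x k where xk: "(x, k) \<in> A t" "\<tau> = ring X x k" by auto
    have max: "ring X x' k' \<le> \<tau>" if "(x', k') \<in> A t" for x' k'
      unfolding \<tau>_def using that finA by (intro Max_ge) force+
    have \<tau>: "0 < \<tau>" "\<tau> \<le> t"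
      using xk regular_ring_pos[OF reg] by (auto simp: A_def)
    have "\<xi> t z = \<xi> \<tau> z"
      using \<tau> max by (intro constant_between) (force simp: A_def)+
    obtain s where s: "0 \<le> s" "s < \<tau>"
      "\<And>x k. ring X x k \<in> {s<..<\<tau>} \<Longrightarrow> z \<noteq> x \<and> z \<noteq> x + snd (mark X x k)"
      "left_limit \<xi> \<tau> z = \<xi> s z"
      using quiet_before[OF \<tau>(1), of z] by blast
    have "A s \<subset> A t"
    proof
      show "A s \<subseteq> A t" using s \<tau> by (auto simp: A_def)
      have "(x, k) \<notin> A s" using xk s by (simp add: A_def)
      with xk show "A s \<noteq> A t" by blast
    qed
    then have "card (A s) < card (A t)" using finA by (intro psubset_card_mono)
    then have IH: "\<xi> s z + enat (card (D s)) = enat (\<zeta> z + card (I s))"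
      using less.hyps[of s] s(1) by (simp add: A_def I_def D_def)
    \<comment> \<open>no two rings are simultaneous, so \<open>(x, k)\<close> is the only new ring after time \<open>s\<close>\<close>
    have split: "ring X x' k' \<le> t \<longleftrightarrow> ring X x' k' \<le> s \<or> (x', k') = (x, k)"
      if "x' = z \<or> x' + snd (mark X x' k') = z" for x' k'
    proof
      assume a: "ring X x' k' \<le> t"
      then have "ring X x' k' \<le> \<tau>" using max that by (simp add: A_def)
      then show "ring X x' k' \<le> s \<or> (x', k') = (x, k)"
        using s(3)[of x' k'] that regularD(5)[OF reg, of x' k' x k] xk(2) by force
    next
      assume "ring X x' k' \<le> s \<or> (x', k') = (x, k)"
      then show "ring X x' k' \<le> t" using s \<tau> xk by auto
    qed
    have I: "I t = I s \<union> {e. e = (x, k) \<and> x + snd (mark X x k) = z \<and> fires \<alpha> g X \<xi> x k}"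
      using split by (auto simp: I_def)
    have D: "D t = D s \<union> {l. l = k \<and> x = z \<and> fires \<alpha> g X \<xi> x k}"
      using split by (auto simp: D_def)
    have new: "(x, k) \<notin> I s" "x = z \<Longrightarrow> k \<notin> D s" using s xk by (auto simp: I_def D_def)
    define \<eta> where "\<eta> = left_limit \<xi> \<tau>"
    have rule: "\<xi> \<tau> = (if fires \<alpha> g X \<xi> x k then move x (x + snd (mark X x k)) \<eta> else \<eta>)"
      using evo unfolding harris_evolution_def fires_def \<eta>_def xk(2) Let_def by blast
    have zp: "0 < snd (mark X x k)" by (rule regularD(2)[OF reg])
    have "\<xi> \<tau> z + enat (card (D t)) = enat (\<zeta> z + card (I t))"
    proof (cases "fires \<alpha> g X \<xi> x k")
      case False
      then show ?thesis using rule s(4) IH I D by (simp add: \<eta>_def)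
    next
      case True
      have "x = z \<or> x + snd (mark X x k) = z" using xk by (simp add: A_def)
      then show ?thesis
      proof
        assume xz: "x = z"
        then have "\<eta> z \<noteq> 0" using fires_occupied[OF True] xk by (simp add: \<eta>_def)
        moreover have "\<xi> \<tau> z = \<eta> z - 1"
          using rule True xz zp by (simp add: move_def Let_def)
        moreover have "card (D t) = Suc (card (D s))"
          using new(2)[OF xz] True xz by (simp add: D finD)
        moreover have "I t = I s" using xz zp by (auto simp: I)
        ultimately show ?thesis
          using IH s(4) unfolding \<eta>_def[symmetric]
          by (cases "\<eta> z") (auto simp: \<eta>_def zero_enat_def one_enat_def)
      next
        assume xz: "x + snd (mark X x k) = z"
        then have "x \<noteq> z" using zp by auto
        moreover have "\<xi> \<tau> z = \<eta> z + 1"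
          using rule True xz \<open>x \<noteq> z\<close> by (simp add: move_def Let_def)
        moreover have "card (I t) = Suc (card (I s))"
          using new(1) True xz by (simp add: I finI)
        moreover have "D t = D s" using \<open>x \<noteq> z\<close> by (auto simp: D)
        ultimately show ?thesis
          using IH s(4) unfolding \<eta>_def[symmetric]
          by (cases "\<eta> z") (auto simp: \<eta>_def zero_enat_def one_enat_def)
      qed
    qed
    with \<open>\<xi> t z = \<xi> \<tau> z\<close> show ?thesis by (simp add: I_def D_def)
  qed
qed

lemma left_occupancy:
  assumes "0 < t"
  shows "left_limit \<xi> t z + enat (card {k. ring X z k < t \<and> fires \<alpha> g X \<xi> z k}) =
    enat (\<zeta> z + card {(x, k). ring X x k < t \<and> x + snd (mark X x k) = z \<and> fires \<alpha> g X \<xi> x k})"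
proof -
  obtain s where s: "0 \<le> s" "s < t"
    "\<And>x k. ring X x k \<in> {s<..<t} \<Longrightarrow> z \<noteq> x \<and> z \<noteq> x + snd (mark X x k)"
    "left_limit \<xi> t z = \<xi> s z"
    using quiet_before[OF assms, of z] by blast
  have "{k. ring X z k < t \<and> fires \<alpha> g X \<xi> z k} = {k. ring X z k \<le> s \<and> fires \<alpha> g X \<xi> z k}"
    using s(2) s(3)[of z] by force
  moreover have "{(x, k). ring X x k < t \<and> x + snd (mark X x k) = z \<and> fires \<alpha> g X \<xi> x k} =
      {(x, k). ring X x k \<le> s \<and> x + snd (mark X x k) = z \<and> fires \<alpha> g X \<xi> x k}"
    using s(2,3) by force
  ultimately show ?thesis using occupancy[OF s(1), of z] s(4) by simp
qed

end

section \<open>The process in a window, as a tandem of queues\<close>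

text \<open>
  The initial configuration \<open>\<zeta>\<close> is part of the fixed data; the left end \<open>w\<close> of the window and the
  noise \<open>X\<close> remain explicit arguments.
\<close>

locale zero_range =
  fixes \<alpha> :: "int \<Rightarrow> real" and g :: "nat \<Rightarrow> real" and p :: "int pmf" and \<zeta> :: "int \<Rightarrow> nat"
  assumes \<alpha>_pos: "0 < \<alpha> x" and \<alpha>_le_1: "\<alpha> x \<le> 1"
    and g_mono: "mono g" and g_0: "g 0 = 0" and g_le_1: "g n \<le> 1"
    and p_pos: "z \<le> 0 \<Longrightarrow> pmf p z = 0"
begin

text \<open>
  The bound \<open>l < k\<close> in the second set of the recursion below must be visible to the termination
  proof.
\<close>

declare conj_cong[fundef_cong]

text \<open>
  Which rings are effective for the process restricted to the sites \<open>\<ge> w\<close>, started from \<open>\<zeta>\<close>. As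
  all jumps go to the right, a site is a queue whose arrivals are determined by the sites on its
  left, so it is possible to recurse over sites first and over the rings of a site second,
  without merging the rings of all sites into one time order. For regular noise no ring at
  \<open>x < y\<close> is simultaneous with a ring at \<open>y\<close>, so \<open>\<le>\<close> counts exactly the arrivals strictly before
  the ring. The marks \<open>snd (mark X y k)\<close> of \<open>y\<close> itself do not occur: the departures from \<open>y\<close> are
  independent of their jump lengths.
\<close>

function departs :: "int \<Rightarrow> (int \<times> nat \<Rightarrow> real \<times> real \<times> int) \<Rightarrow> int \<Rightarrow> nat \<Rightarrow> bool" where
  "departs w X y k \<longleftrightarrow> fst (mark X y k) \<le> \<alpha> y * g (\<zeta> y +
     (\<Sum>x\<in>{w..<y}. card {l. ring X x l \<le> ring X y k \<and> snd (mark X x l) = y - x \<and> departs w X x l}) -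
     card {l. l < k \<and> departs w X y l})"
  by auto
termination
  by (relation "inv_image (less_than <*lex*> less_than) (\<lambda>(w, X, y, k). (nat (y - w), k))") auto

declare departs.simps[simp del]

definition arrived :: "int \<Rightarrow> (int \<times> nat \<Rightarrow> real \<times> real \<times> int) \<Rightarrow> int \<Rightarrow> real \<Rightarrow> nat" where
  "arrived w X y t =
     (\<Sum>x\<in>{w..<y}. card {l. ring X x l \<le> t \<and> snd (mark X x l) = y - x \<and> departs w X x l})"

definition departed :: "int \<Rightarrow> (int \<times> nat \<Rightarrow> real \<times> real \<times> int) \<Rightarrow> int \<Rightarrow> real \<Rightarrow> nat" where
  "departed w X y t = card {k. ring X y k \<le> t \<and> departs w X y k}"

definition queue :: "int \<Rightarrow> (int \<times> nat \<Rightarrow> real \<times> real \<times> int) \<Rightarrow> int \<Rightarrow> real \<Rightarrow> nat" where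
  "queue w X y t = \<zeta> y + arrived w X y t - departed w X y t"

lemma departs_iff:
  "departs w X y k \<longleftrightarrow> fst (mark X y k) \<le>
     \<alpha> y * g (\<zeta> y + arrived w X y (ring X y k) - card {l. l < k \<and> departs w X y l})"
  by (subst departs.simps) (simp only: arrived_def)

lemma g_nonneg: "0 \<le> g n"
  using monoD[OF g_mono, of 0 n] by (simp add: g_0)

end

text \<open>
  \<open>chains L X m y t\<close> counts the chains of rings that end with an arrival at \<open>y\<close> up to time \<open>t\<close>,
  followed backwards for \<open>m\<close> steps or until a site \<open>\<le> L\<close> is reached, whichever comes first. Each
  ring of a chain has as its target the source of the next ring, which rings later. It does not
  depend on a trajectory, so that it controls all trajectories and its mean can be computed.
\<close>

primrec chains :: "int \<Rightarrow> (int \<times> nat \<Rightarrow> real \<times> real \<times> int) \<Rightarrow> nat \<Rightarrow> int \<Rightarrow> real \<Rightarrow> ennreal" where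
  "chains L X 0 y t = 1"
| "chains L X (Suc m) y t = (if y \<le> L then 1 else
     (\<Sum>d. \<Sum>k. if ring X (y - int (Suc d)) k \<le> t \<and> snd (mark X (y - int (Suc d)) k) = int (Suc d)
        then chains L X m (y - int (Suc d)) (ring X (y - int (Suc d)) k) else 0))"

lemma ennreal_term_le_suminf: "f i \<le> (\<Sum>i. f i :: ennreal)"
  using sum_le_suminf[OF summableI, of "{i}" f] by simp

lemma chains_step:
  assumes "ring X x k \<le> t" "x + snd (mark X x k) = y" "0 < snd (mark X x k)"
    and "1 \<le> chains L X m x (ring X x k)"
  shows "1 \<le> chains L X (Suc m) y t"
proof (cases "y \<le> L")
  case False
  define d where "d = nat (y - x - 1)"
  have d: "y - int (Suc d) = x" "int (Suc d) = y - x"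
    using assms(2,3) by (auto simp: d_def)
  let ?f = "\<lambda>d k. if ring X (y - int (Suc d)) k \<le> t \<and> snd (mark X (y - int (Suc d)) k) = int (Suc d)
        then chains L X m (y - int (Suc d)) (ring X (y - int (Suc d)) k) else 0"
  have "1 \<le> ?f d k" unfolding d using assms by auto
  also have "\<dots> \<le> (\<Sum>k. ?f d k)" by (rule ennreal_term_le_suminf)
  also have "\<dots> \<le> (\<Sum>d. \<Sum>k. ?f d k)" by (rule ennreal_term_le_suminf[of "\<lambda>d. \<Sum>k. ?f d k"])
  finally show ?thesis using False by simp
qed simp

context zero_range
begin

context
  fixes X :: "int \<times> nat \<Rightarrow> real \<times> real \<times> int" and \<xi> :: "real \<Rightarrow> int \<Rightarrow> enat"
  assumes reg: "regular X" and evo: "evolves \<alpha> g X \<zeta> \<xi>"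
begin

lemmas occ = occupancy[OF g_0 reg evo] and left_occ = left_occupancy[OF g_0 reg evo]
lemmas occupied = fires_occupied[OF g_0 reg evo]

text \<open>
  An occupied site that was empty initially has received a particle from an occupied site.
  Following particles back in this way yields chains of every length \<open>m\<close>, unless the zone \<open>\<le> L\<close>
  of initially occupied sites is reached before.
\<close>

lemma chains_of_occupied:
  assumes empty: "\<And>x. L < x \<Longrightarrow> x < w \<Longrightarrow> \<zeta> x = 0"
    and "y < w" "0 < t" "left_limit \<xi> t y \<noteq> 0"
  shows "1 \<le> chains L X m y t"
  using assms(2-)
proof (induction m arbitrary: y t)
  case (Suc m)
  show ?case
  proof (cases "y \<le> L")
    case False
    have "{(x, k). ring X x k < t \<and> x + snd (mark X x k) = y \<and> fires \<alpha> g X \<xi> x k} \<noteq> {}"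
    proof
      assume "{(x, k). ring X x k < t \<and> x + snd (mark X x k) = y \<and> fires \<alpha> g X \<xi> x k} = {}"
      then have "left_limit \<xi> t y + enat (card {k. ring X y k < t \<and> fires \<alpha> g X \<xi> y k}) = 0"
        using left_occ[OF Suc.prems(2), of y] empty[of y] False Suc.prems(1)
        by (simp only: card.empty) (simp add: zero_enat_def)
      with Suc.prems show False by simp
    qed
    then obtain x k where xk: "ring X x k < t" "x + snd (mark X x k) = y" "fires \<alpha> g X \<xi> x k"
      by auto
    have "0 < snd (mark X x k)" by (rule regularD(2)[OF reg])
    then have "1 \<le> chains L X m x (ring X x k)"
      using xk Suc.prems regular_ring_pos[OF reg] occupied by (intro Suc.IH) auto
    then show ?thesis
      by (intro chains_step[of X x k]) (use xk \<open>0 < snd (mark X x k)\<close> in auto)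
  qed simp
qed simp

lemma no_arrivals_from_outside:
  assumes empty: "\<And>x. L < x \<Longrightarrow> x < w \<Longrightarrow> \<zeta> x = 0"
    and few: "(\<Sum>y\<in>{w..b}. chains L X (Suc m) y T) < 1"
    and "ring X x k \<le> T" "x < w" "x + snd (mark X x k) \<in> {w..b}"
  shows "\<not> fires \<alpha> g X \<xi> x k"
proof
  assume "fires \<alpha> g X \<xi> x k"
  then have "1 \<le> chains L X m x (ring X x k)"
    using assms occupied regular_ring_pos[OF reg] by (intro chains_of_occupied[OF empty]) auto
  then have "1 \<le> chains L X (Suc m) (x + snd (mark X x k)) T"
    using assms by (intro chains_step[OF _ refl regularD(2)[OF reg]])
  also have "\<dots> \<le> (\<Sum>y\<in>{w..b}. chains L X (Suc m) y T)"
    using assms by (intro member_le_sum) auto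
  finally show False using few by simp
qed

lemma card_arrivals:
  assumes "finite {(x, l). Q x l \<and> x + snd (mark X x l) = y}"
    and "\<And>x l. Q x l \<Longrightarrow> x + snd (mark X x l) = y \<Longrightarrow> w \<le> x"
  shows "card {(x, l). Q x l \<and> x + snd (mark X x l) = y} =
    (\<Sum>x\<in>{w..<y}. card {l. Q x l \<and> snd (mark X x l) = y - x})"
proof -
  have zp: "0 < snd (mark X x l)" for x l by (rule regularD(2)[OF reg])
  have "{(x, l). Q x l \<and> x + snd (mark X x l) = y} =
      (SIGMA x:{w..<y}. {l. Q x l \<and> snd (mark X x l) = y - x})"
  proof (intro set_eqI iffI)
    fix e assume "e \<in> {(x, l). Q x l \<and> x + snd (mark X x l) = y}"
    then show "e \<in> (SIGMA x:{w..<y}. {l. Q x l \<and> snd (mark X x l) = y - x})"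
      using assms(2) zp[of "fst e" "snd e"] by (auto simp: algebra_simps)
  qed auto
  moreover have "finite {l. Q x l \<and> snd (mark X x l) = y - x}" for x
    by (rule finite_subset[OF _ finite_vimageI[OF assms(1), of "Pair x"]]) (auto simp: inj_on_def)
  ultimately show ?thesis by (simp add: card_SigmaI)
qed

text \<open>
  If nothing enters from the left of \<open>w\<close> until time \<open>T\<close>, the actual process in the window obeys
  the same recursion as the restricted one. The induction follows the recursion of \<open>departs\<close>.
\<close>

lemma fires_iff_departs:
  assumes out: "\<And>x k. ring X x k \<le> T \<Longrightarrow> x < w \<Longrightarrow> x + snd (mark X x k) \<in> {w..b} \<Longrightarrow> \<not> fires \<alpha> g X \<xi> x k"
    and "y \<in> {w..b}" "ring X y k \<le> T"
  shows "fires \<alpha> g X \<xi> y k \<longleftrightarrow> departs w X y k"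
  using assms(2-)
proof (induction "nat (y - w)" arbitrary: y k rule: less_induct)
  case less
  note IHy = less.hyps
  have y: "y \<in> {w..b}" by fact
  show ?case using less.prems(2)
  proof (induction k rule: less_induct)
    case (less k)
    define t where "t = ring X y k"
    have t: "0 < t" "t \<le> T" using less.prems regular_ring_pos[OF reg] by (auto simp: t_def)
    have zp: "0 < snd (mark X x l)" for x l by (rule regularD(2)[OF reg])
    have own: "{l. ring X y l < t \<and> fires \<alpha> g X \<xi> y l} = {l. l < k \<and> departs w X y l}"
    proof (intro set_eqI)
      fix l
      have "ring X y l \<le> T" if "l < k"
        using that regular_ring_less[OF reg, of y l k] less.prems by simp
      then show "l \<in> {l. ring X y l < t \<and> fires \<alpha> g X \<xi> y l} \<longleftrightarrow> l \<in> {l. l < k \<and> departs w X y l}"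
        using less.IH[of l] by (auto simp: t_def regular_ring_less[OF reg])
    qed
    have "card {(x, l). (ring X x l < t \<and> fires \<alpha> g X \<xi> x l) \<and> x + snd (mark X x l) = y} =
        (\<Sum>x\<in>{w..<y}. card {l. (ring X x l < t \<and> fires \<alpha> g X \<xi> x l) \<and> snd (mark X x l) = y - x})"
    proof (rule card_arrivals)
      show "finite {(x, l). (ring X x l < t \<and> fires \<alpha> g X \<xi> x l) \<and> x + snd (mark X x l) = y}"
        by (rule finite_subset[OF _ regularD(4)[OF reg, of t y]]) auto
      show "w \<le> x" if "ring X x l < t \<and> fires \<alpha> g X \<xi> x l" "x + snd (mark X x l) = y" for x l
        using out[of x l] that t y by force
    qed
    also have "\<dots> = arrived w X y t"
      unfolding arrived_def
    proof (intro sum.cong refl arg_cong[where f = card] set_eqI)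
      fix x l assume x: "x \<in> {w..<y}"
      have "ring X x l < t \<longleftrightarrow> ring X x l \<le> t"
        using regularD(5)[OF reg, of x l y k] x by (force simp: t_def)
      moreover have "fires \<alpha> g X \<xi> x l \<longleftrightarrow> departs w X x l" if "ring X x l \<le> t"
        using x that t y by (intro IHy) auto
      ultimately show "l \<in> {l. (ring X x l < t \<and> fires \<alpha> g X \<xi> x l) \<and> snd (mark X x l) = y - x} \<longleftrightarrow>
          l \<in> {l. ring X x l \<le> t \<and> snd (mark X x l) = y - x \<and> departs w X x l}"
        by auto
    qed
    finally have arr: "card {(x, l). ring X x l < t \<and> x + snd (mark X x l) = y \<and> fires \<alpha> g X \<xi> x l} =
      arrived w X y t" by (simp only: conj_ac)
    have "left_limit \<xi> t y = enat (\<zeta> y + arrived w X y t - card {l. l < k \<and> departs w X y l})"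
      using left_occ[OF t(1), of y] unfolding own arr by (cases "left_limit \<xi> t y") auto
    then show ?case
      unfolding fires_def departs_iff[of w X y k] t_def[symmetric] by (simp add: g_ext_def)
  qed
qed

lemma evolution_eq_queue:
  assumes out: "\<And>x k. ring X x k \<le> T \<Longrightarrow> x < w \<Longrightarrow> x + snd (mark X x k) \<in> {w..b} \<Longrightarrow> \<not> fires \<alpha> g X \<xi> x k"
    and y: "y \<in> {w..b}" and t: "0 \<le> t" "t \<le> T"
  shows "\<xi> t y = enat (queue w X y t)"
proof -
  have own: "{k. ring X y k \<le> t \<and> fires \<alpha> g X \<xi> y k} = {k. ring X y k \<le> t \<and> departs w X y k}"
    using fires_iff_departs[OF out y] t by fastforce
  have "card {(x, l). (ring X x l \<le> t \<and> fires \<alpha> g X \<xi> x l) \<and> x + snd (mark X x l) = y} =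
      (\<Sum>x\<in>{w..<y}. card {l. (ring X x l \<le> t \<and> fires \<alpha> g X \<xi> x l) \<and> snd (mark X x l) = y - x})"
  proof (rule card_arrivals)
    show "finite {(x, l). (ring X x l \<le> t \<and> fires \<alpha> g X \<xi> x l) \<and> x + snd (mark X x l) = y}"
      by (rule finite_subset[OF _ regularD(4)[OF reg, of t y]]) auto
    show "w \<le> x" if "ring X x l \<le> t \<and> fires \<alpha> g X \<xi> x l" "x + snd (mark X x l) = y" for x l
      using out[of x l] that t y by force
  qed
  also have "\<dots> = arrived w X y t"
    unfolding arrived_def
  proof (intro sum.cong refl arg_cong[where f = card] set_eqI)
    fix x l assume x: "x \<in> {w..<y}"
    have "fires \<alpha> g X \<xi> x l \<longleftrightarrow> departs w X x l" if "ring X x l \<le> t"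
      using x that t y by (intro fires_iff_departs[OF out]) auto
    then show "l \<in> {l. (ring X x l \<le> t \<and> fires \<alpha> g X \<xi> x l) \<and> snd (mark X x l) = y - x} \<longleftrightarrow>
        l \<in> {l. ring X x l \<le> t \<and> snd (mark X x l) = y - x \<and> departs w X x l}"
      by auto
  qed
  finally have arr: "card {(x, l). ring X x l \<le> t \<and> x + snd (mark X x l) = y \<and> fires \<alpha> g X \<xi> x l} =
    arrived w X y t" by (simp only: conj_ac)
  show ?thesis
    using occ[OF t(1), of y] unfolding own arr queue_def departed_def by (cases "\<xi> t y") auto
qed

end

text \<open>
  An empty queue is not served: as \<open>g 0 = 0\<close> and the uniform marks are positive, the last
  departure has found a particle. In particular the truncated subtraction in \<open>queue\<close> never
  truncates.
\<close>

lemma departed_le: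
  assumes reg: "regular X"
  shows "departed w X y t \<le> \<zeta> y + arrived w X y t"
proof (cases "{k. ring X y k \<le> t \<and> departs w X y k} = {}")
  case False
  define D where "D = {k. ring X y k \<le> t \<and> departs w X y k}"
  have fin: "finite D"
    by (rule finite_subset[OF _ regularD(3)[OF reg, of y t]]) (auto simp: D_def)
  define k where "k = Max D"
  have k: "k \<in> D" unfolding k_def using False fin by (intro Max_in) (auto simp: D_def)
  have "D = insert k {l. l < k \<and> departs w X y l}"
  proof (intro set_eqI iffI)
    fix l assume "l \<in> D"
    then show "l \<in> insert k {l. l < k \<and> departs w X y l}"
      using Max_ge[OF fin \<open>l \<in> D\<close>] unfolding k_def[symmetric] by (auto simp: D_def)
  next
    fix l assume "l \<in> insert k {l. l < k \<and> departs w X y l}"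
    then show "l \<in> D"
      using k regular_ring_less[OF reg, of y l k] by (auto simp: D_def)
  qed
  then have "card D = Suc (card {l. l < k \<and> departs w X y l})" by simp
  moreover have "\<not> \<zeta> y + arrived w X y (ring X y k) - card {l. l < k \<and> departs w X y l} = 0"
  proof
    assume "\<zeta> y + arrived w X y (ring X y k) - card {l. l < k \<and> departs w X y l} = 0"
    moreover have "departs w X y k" using k by (simp add: D_def)
    ultimately have "fst (mark X y k) \<le> 0" unfolding departs_iff[of w X y k] by (simp only: g_0)
    with regularD(1)[OF reg, of y k] show False by simp
  qed
  moreover have "arrived w X y (ring X y k) \<le> arrived w X y t"
    unfolding arrived_def
  proof (intro sum_mono card_mono)
    fix x show "finite {l. ring X x l \<le> t \<and> snd (mark X x l) = y - x \<and> departs w X x l}"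
      by (rule finite_subset[OF _ regularD(3)[OF reg, of x t]]) auto
  qed (use k in \<open>auto simp: D_def\<close>)
  ultimately show ?thesis unfolding departed_def D_def[symmetric] by simp
next
  case True
  then show ?thesis by (simp only: departed_def card.empty)
qed

end

section \<open>Influence chains from far away are rare\<close>

lemma chains_measurable:
  "(\<lambda>v. chains L (fst v) m y (snd v)) \<in> borel_measurable (canonical p \<Otimes>\<^sub>M borel)"
proof (induction m arbitrary: y)
  case (Suc m)
  show ?case
  proof (cases "y \<le> L")
    case False
    have [measurable]: "(\<lambda>v. chains L (fst v) m x (ring (fst v) x k)) \<in> borel_measurable (canonical
      p \<Otimes>\<^sub>M borel)" for x k
    proof -
      have "(\<lambda>v. (fst v, ring (fst v) x k)) \<in> (canonical p \<Otimes>\<^sub>M borel) \<rightarrow>\<^sub>M (canonical p \<Otimes>\<^sub>M borel)"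
        by measurable
      from measurable_compose[OF this Suc.IH[of x]] show ?thesis by simp
    qed
    show ?thesis using False by simp
  qed simp
qed simp

lemma clock_upd: "x < y \<or> k < l \<Longrightarrow> clock (X((y, l) := v)) x k = clock X x k"
  by (auto simp: clock_def intro!: sum.cong)

lemma mark_upd: "x < y \<or> k < l \<Longrightarrow> mark (X((y, l) := v)) x k = mark X x k"
  by (auto simp: mark_def)

text \<open>
  Chains ending at \<open>y\<close> use only rings at sites to the left of \<open>y\<close>.
\<close>

lemma chains_upd: "y \<le> x \<Longrightarrow> chains L (X((x, k) := v)) m y t = chains L X m y t"
proof (induction m arbitrary: y t)
  case (Suc m)
  have "chains L (X((x, k) := v)) m (y - int (Suc d)) s = chains L X m (y - int (Suc d)) s" for d s
    using Suc.prems by (intro Suc.IH) simp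
  then show ?case
    using Suc.prems by (simp add: clock_upd mark_upd cong: if_cong del: fun_upd_apply of_nat_Suc)
qed simp

text \<open>
  The probability that a random walk with jump law \<open>p\<close>, started at \<open>0\<close>, reaches \<open>[n, \<infinity>)\<close> within
  \<open>m\<close> steps.
\<close>

primrec walk_tail :: "int pmf \<Rightarrow> nat \<Rightarrow> int \<Rightarrow> ennreal" where
  "walk_tail p 0 n = (if n \<le> 0 then 1 else 0)"
| "walk_tail p (Suc m) n = (if n \<le> 0 then 1 else \<integral>\<^sup>+z. walk_tail p m (n - z) \<partial>measure_pmf p)"

lemma walk_tail_le_1: "walk_tail p m n \<le> 1"
proof (induction m arbitrary: n)
  case (Suc m)
  have "(\<integral>\<^sup>+z. walk_tail p m (n - z) \<partial>measure_pmf p) \<le> (\<integral>\<^sup>+z. 1 \<partial>measure_pmf p)"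
    by (intro nn_integral_mono Suc)
  then show ?case by simp
qed simp

lemma walk_tail_tendsto_0: "(\<lambda>n. walk_tail p m (y + int n)) \<longlonglongrightarrow> 0"
proof (induction m arbitrary: y)
  case 0
  have "eventually (\<lambda>n. walk_tail p 0 (y + int n) = 0) sequentially"
    using eventually_ge_at_top[of "nat (1 - y)"] by eventually_elim auto
  then show ?case by (rule tendsto_eventually)
next
  case (Suc m)
  have "(\<lambda>n. \<integral>\<^sup>+z. walk_tail p m (y + int n - z) \<partial>measure_pmf p) \<longlonglongrightarrow>
      (\<integral>\<^sup>+z. 0 \<partial>measure_pmf p)"
  proof (rule nn_integral_dominated_convergence[where w = "\<lambda>_. 1"])
    show "AE z in measure_pmf p. (\<lambda>n. walk_tail p m (y + int n - z)) \<longlonglongrightarrow> 0"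
      using Suc[of "y - z" for z] by (intro AE_I2) (simp add: algebra_simps)
  qed (auto simp: walk_tail_le_1)
  moreover have "eventually (\<lambda>n. (\<integral>\<^sup>+z. walk_tail p m (y + int n - z) \<partial>measure_pmf p) =
      walk_tail p (Suc m) (y + int n)) sequentially"
    using eventually_ge_at_top[of "nat (1 - y)"] by eventually_elim auto
  ultimately show ?case by (auto intro: Lim_transform_eventually)
qed

text \<open>
  Jump lengths are enumerated as \<open>1, 2, \<dots>\<close>.
\<close>

lemma suminf_pmf_le:
  "(\<Sum>d. ennreal (pmf p (int (Suc d))) * f (int (Suc d))) \<le> (\<integral>\<^sup>+z. f z \<partial>measure_pmf p)"
proof -
  have "(\<Sum>d. ennreal (pmf p (int (Suc d))) * f (int (Suc d))) =
      (\<integral>\<^sup>+d. ennreal (pmf p (int (Suc d))) * f (int (Suc d)) \<partial>count_space UNIV)"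
    by (rule nn_integral_count_space_nat[symmetric])
  also have "\<dots> = (\<integral>\<^sup>+z. ennreal (pmf p z) * f z \<partial>count_space (range (\<lambda>d. int (Suc d))))"
    by (rule nn_integral_bij_count_space) (auto simp: bij_betw_def inj_on_def)
  also have "\<dots> \<le> (\<integral>\<^sup>+z. ennreal (pmf p z) * f z \<partial>count_space UNIV)"
    by (subst nn_integral_count_space_indicator, simp, intro nn_integral_mono) (auto simp:
      indicator_def)
  also have "\<dots> = (\<integral>\<^sup>+z. f z \<partial>measure_pmf p)"
    by (rule nn_integral_measure_pmf[symmetric])
  finally show ?thesis .
qed

text \<open>
  The last ring of a chain is independent of the rest of the chain, which lives on sites further
  to the left. By Campbell's formula the mean \<open>e\<^sub>m(y, t)\<close> therefore satisfies
  \<open>e\<^sub>m\<^sub>+\<^sub>1(y, t) \<le> \<integral>\<^sub>0\<^sup>t \<Sum>\<^sub>d p(d) e\<^sub>m(y - d, s) ds\<close> for \<open>y > L\<close>. The first term of the bound accounts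
  for the chains with all \<open>m\<close> steps, the second one for those reaching \<open>(-\<infinity>, L]\<close>; the factor \<open>e\<^sup>t\<close>
  absorbs the sum over all lengths.
\<close>

lemma chains_expectation_le:
  assumes pos: "\<And>z. z \<le> 0 \<Longrightarrow> pmf p z = 0" and "0 \<le> t"
  shows "(\<integral>\<^sup>+X. chains L X m y t \<partial>canonical p) \<le>
    ennreal (t ^ m / fact m) + ennreal (exp t) * walk_tail p m (y - L)"
  using \<open>0 \<le> t\<close>
proof (induction m arbitrary: y t)
  case 0
  interpret ca: prob_space "canonical p" by (rule prob_space_canonical)
  show ?case by (simp add: ca.emeasure_space_1[simplified])
next
  case (Suc m)
  interpret ca: prob_space "canonical p" by (rule prob_space_canonical)
  interpret ml: prob_space "mark_law p" by (rule prob_space_mark_law)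
  interpret pair_sigma_finite "canonical p" lborel ..
  have exp_ge_1: "1 \<le> ennreal (exp t)" using Suc.prems by (simp flip: ennreal_1)
  show ?case
  proof (cases "y \<le> L")
    case True
    then show ?thesis
      using exp_ge_1 by (simp add: ca.emeasure_space_1[simplified] add_increasing)
  next
    case False
    \<comment> \<open>the last ring of the chain has jump length \<open>Suc d\<close>; the remaining chain ends at \<open>y - Suc d\<close>\<close>
    define F where "F d X s m' = (if s \<le> t \<and> snd m' = int (Suc d)
        then chains L X m (y - int (Suc d)) s else 0)" for d X s and m' :: "real \<times> int"
    have ch[measurable]: "(\<lambda>v. chains L (fst v) m x (snd v)) \<in> borel_measurable (canonical p \<Otimes>\<^sub>M
      borel)" for x
      by (rule chains_measurable)
    have m1: "(\<lambda>s. indicator {0..t} s * chains L X m x s) \<in> borel_measurable lborel" for X x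
      using measurable_compose[OF measurable_Pair1'[of X "canonical p"] ch[of x]] by simp
    have m2: "(\<lambda>X. \<integral>\<^sup>+s. indicator {0..t} s * chains L X m x s \<partial>lborel) \<in> borel_measurable
      (canonical p)" for x
      by (rule lborel.borel_measurable_nn_integral) (simp add: split_beta')
    have F[measurable]: "(\<lambda>(X, s, m'). F d X s m') \<in>
        borel_measurable (canonical p \<Otimes>\<^sub>M borel \<Otimes>\<^sub>M borel \<Otimes>\<^sub>M count_space UNIV)" for d
    proof -
      have "(\<lambda>v. (fst v, fst (snd v))) \<in> canonical p \<Otimes>\<^sub>M borel \<Otimes>\<^sub>M (borel \<Otimes>\<^sub>M count_space UNIV)
          \<rightarrow>\<^sub>M canonical p \<Otimes>\<^sub>M borel"
        by measurable
      from measurable_compose[OF this ch[of "y - int (Suc d)"]]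
      have [measurable]: "(\<lambda>v. chains L (fst v) m (y - int (Suc d)) (fst (snd v))) \<in>
          borel_measurable (canonical p \<Otimes>\<^sub>M borel \<Otimes>\<^sub>M (borel \<Otimes>\<^sub>M count_space UNIV))"
        by simp
      show ?thesis unfolding F_def split_beta' by measurable
    qed
    have Fbar: "(\<integral>\<^sup>+m'. F d X s m' \<partial>mark_law p) = 
        ennreal (pmf p (int (Suc d))) * (indicator {..t} s * chains L X m (y - int (Suc d)) s)" for
          d X s
    proof -
      interpret u: prob_space "uniform_measure lborel {0<..<1::real}" by (rule prob_space_uniform01)
      have "(\<integral>\<^sup>+m'. F d X s m' \<partial>mark_law p) = (\<integral>\<^sup>+m'. (indicator {..t} s * chains L X m (y - int
        (Suc d)) s) *
          indicator (UNIV \<times> {int (Suc d)}) m' \<partial>mark_law p)"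
        by (intro nn_integral_cong) (auto simp: F_def indicator_def mem_Times_iff)
      also have "\<dots> = (indicator {..t} s * chains L X m (y - int (Suc d)) s) * emeasure (mark_law p)
        (UNIV \<times> {int (Suc d)})"
        by (rule nn_integral_cmult_indicator) (simp add: sets_mark_law pair_measureI)
      also have "emeasure (mark_law p) (UNIV \<times> {int (Suc d)}) = ennreal (pmf p (int (Suc d)))"
        using u.emeasure_space_1 by (simp add: emeasure_mark_law emeasure_pmf_single)
      finally show ?thesis by (simp only: mult.commute)
    qed
    have "(\<integral>\<^sup>+X. chains L X (Suc m) y t \<partial>canonical p) =
        (\<integral>\<^sup>+X. (\<Sum>d. \<Sum>k. F d X (ring X (y - int (Suc d)) k) (mark X (y - int (Suc d)) k)) \<partial>canonical p)"
      using False by (simp add: F_def del: of_nat_Suc)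
    also have "\<dots> = (\<Sum>d. \<Sum>k. \<integral>\<^sup>+X. F d X (ring X (y - int (Suc d)) k) (mark X (y - int (Suc d)) k)
      \<partial>canonical p)"
    proof -
      have [measurable]: "(\<lambda>X. F d X (ring X x k) (mark X x k)) \<in> borel_measurable (canonical p)"
        for d x k
      proof -
        have "(\<lambda>X. (X, ring X x k, mark X x k)) \<in> canonical p \<rightarrow>\<^sub>M
            canonical p \<Otimes>\<^sub>M borel \<Otimes>\<^sub>M borel \<Otimes>\<^sub>M count_space UNIV"
          by measurable
        from measurable_compose[OF this F] show ?thesis by simp
      qed
      show ?thesis by (subst nn_integral_suminf, measurable, intro suminf_cong nn_integral_suminf,
        measurable)
    qed
    also have "\<dots> \<le> (\<Sum>d. ennreal (pmf p (int (Suc d))) *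
        (\<integral>\<^sup>+X. \<integral>\<^sup>+s. indicator {0..t} s * chains L X m (y - int (Suc d)) s \<partial>lborel \<partial>canonical p))"
    proof (intro suminf_le summableI)
      fix d
      have "(\<Sum>k. \<integral>\<^sup>+X. F d X (ring X (y - int (Suc d)) k) (mark X (y - int (Suc d)) k) \<partial>canonical p)
        \<le> (\<integral>\<^sup>+X. \<integral>\<^sup>+s. indicator {0..} s * (\<integral>\<^sup>+m'. F d X s m' \<partial>mark_law p) \<partial>lborel \<partial>canonical p)"
      proof (rule sum_campbell_le[OF _ F])
        show "F d (X((y - int (Suc d), k) := v)) = F d X" for X k v
          by (intro ext) (simp add: F_def chains_upd del: fun_upd_apply of_nat_Suc)
      qed (rule pos)
      also have "\<dots> = (\<integral>\<^sup>+X. \<integral>\<^sup>+s. ennreal (pmf p (int (Suc d))) *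
          (indicator {0..t} s * chains L X m (y - int (Suc d)) s) \<partial>lborel \<partial>canonical p)"
        unfolding Fbar by (intro nn_integral_cong) (auto simp: indicator_def)
      also have "\<dots> = ennreal (pmf p (int (Suc d))) *
        (\<integral>\<^sup>+X. \<integral>\<^sup>+s. indicator {0..t} s * chains L X m (y - int (Suc d)) s \<partial>lborel \<partial>canonical p)"
        by (subst nn_integral_cmult[OF m1], rule nn_integral_cmult[OF m2])
      finally show "(\<Sum>k. \<integral>\<^sup>+X. F d X (ring X (y - int (Suc d)) k) (mark X (y - int (Suc d)) k)
        \<partial>canonical p) \<le> \<dots>" .
    qed
    also have "\<dots> \<le> (\<Sum>d. ennreal (pmf p (int (Suc d))) *
        (ennreal (t ^ Suc m / fact (Suc m)) + ennreal (exp t) * walk_tail p m (y - L - int (Suc d))))"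
    proof (intro suminf_le summableI mult_left_mono)
      fix d
      let ?x = "y - int (Suc d)"
      have "(\<integral>\<^sup>+X. \<integral>\<^sup>+s. indicator {0..t} s * chains L X m ?x s \<partial>lborel \<partial>canonical p) =
          (\<integral>\<^sup>+s. \<integral>\<^sup>+X. indicator {0..t} s * chains L X m ?x s \<partial>canonical p \<partial>lborel)"
        by (rule Fubini'[symmetric]) (simp add: split_beta')
      also have "\<dots> \<le> (\<integral>\<^sup>+s. (ennreal (s ^ m / fact m) * indicator {0..t} s +
          walk_tail p m (?x - L) * (ennreal (exp s) * indicator {0..t} s)) \<partial>lborel)"
      proof (rule nn_integral_mono)
        fix s
        have "(\<integral>\<^sup>+X. indicator {0..t} s * chains L X m ?x s \<partial>canonical p) =
            indicator {0..t} s * (\<integral>\<^sup>+X. chains L X m ?x s \<partial>canonical p)"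
          using measurable_compose[OF measurable_Pair2'[of s borel] ch[of ?x]]
          by (intro nn_integral_cmult) simp
        also have "\<dots> \<le> ennreal (s ^ m / fact m) * indicator {0..t} s +
            walk_tail p m (?x - L) * (ennreal (exp s) * indicator {0..t} s)"
          using Suc.IH[of s ?x] by (auto simp: indicator_def mult.commute)
        finally show "(\<integral>\<^sup>+X. indicator {0..t} s * chains L X m ?x s \<partial>canonical p) \<le> \<dots>" .
      qed
      also have "\<dots> = (\<integral>\<^sup>+s. ennreal (s ^ m / fact m) * indicator {0..t} s \<partial>lborel) +
          walk_tail p m (?x - L) * (\<integral>\<^sup>+s. ennreal (exp s) * indicator {0..t} s \<partial>lborel)"
        by (subst nn_integral_add, simp, simp, subst nn_integral_cmult) auto
      also have "(\<integral>\<^sup>+s. ennreal (s ^ m / fact m) * indicator {0..t} s \<partial>lborel) =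
          ennreal (t ^ Suc m / fact (Suc m) - 0 ^ Suc m / fact (Suc m))"
      proof (rule nn_integral_FTC_Icc)
        show "((\<lambda>s. s ^ Suc m / fact (Suc m)) has_real_derivative s ^ m / fact m) (at s)" for s :: real
          by (rule DERIV_cong[OF DERIV_cdivide[OF DERIV_pow]]) (simp del: of_nat_Suc)
      qed (use Suc.prems in auto)
      also have "(\<integral>\<^sup>+s. ennreal (exp s) * indicator {0..t} s \<partial>lborel) = ennreal (exp t - exp 0)"
        using Suc.prems by (intro nn_integral_FTC_Icc) (auto intro!: derivative_eq_intros)
      also have "ennreal (t ^ Suc m / fact (Suc m) - 0 ^ Suc m / fact (Suc m)) + walk_tail p m (?x -
        L) * ennreal (exp t - exp 0)
        \<le> ennreal (t ^ Suc m / fact (Suc m)) + ennreal (exp t) * walk_tail p m (y - L - int (Suc d))"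
        by (intro add_mono) (auto simp: algebra_simps intro!: mult_right_mono ennreal_leI)
      finally show "(\<integral>\<^sup>+X. \<integral>\<^sup>+s. indicator {0..t} s * chains L X m ?x s \<partial>lborel \<partial>canonical p) \<le> \<dots>" .
    qed simp
    also have "\<dots> \<le> (\<integral>\<^sup>+z. (ennreal (t ^ Suc m / fact (Suc m)) + ennreal (exp t) * walk_tail p m (y -
      L - z)) \<partial>measure_pmf p)"
      by (rule suminf_pmf_le)
    also have "\<dots> = ennreal (t ^ Suc m / fact (Suc m)) + ennreal (exp t) * walk_tail p (Suc m) (y - L)"
      using False by (simp add: nn_integral_add nn_integral_cmult
        measure_pmf.emeasure_space_1[simplified])
    finally show ?thesis .
  qed
qed

section \<open>Almost sure regularity of the noise\<close>

lemma nat_op_measurable: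
  fixes f h :: "'a \<Rightarrow> nat"
  assumes "f \<in> M \<rightarrow>\<^sub>M count_space UNIV" "h \<in> M \<rightarrow>\<^sub>M count_space UNIV"
  shows "(\<lambda>x. F (f x) (h x) :: nat) \<in> M \<rightarrow>\<^sub>M count_space (UNIV :: nat set)"
  by (rule measurable_compose_countable[OF _ assms(1), of "\<lambda>a x. F a (h x)"])
    (rule measurable_compose[OF assms(2)], simp)

lemma nat_sum_measurable:
  assumes "\<And>i. i \<in> I \<Longrightarrow> f i \<in> M \<rightarrow>\<^sub>M count_space UNIV"
  shows "(\<lambda>x. \<Sum>i\<in>I. f i x :: nat) \<in> M \<rightarrow>\<^sub>M count_space UNIV"
  using assms
proof (induction I rule: infinite_finite_induct)
  case (insert i I)
  then show ?case by (simp add: nat_op_measurable[where F = "(+)"])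
qed simp_all

lemma suminf_finite_imp:
  assumes "(\<Sum>d. f d) < (\<infinity> :: ennreal)"
  shows "finite {d. 1 \<le> f d}"
proof (rule ccontr)
  assume inf: "infinite {d. 1 \<le> f d}"
  have "of_nat n \<le> (\<Sum>d. f d)" for n
  proof -
    obtain T where T: "finite T" "card T = n" "T \<subseteq> {d. 1 \<le> f d}"
      using infinite_arbitrarily_large[OF inf] by blast
    have "(of_nat n :: ennreal) = (\<Sum>d\<in>T. 1)" using T by simp
    also have "\<dots> \<le> (\<Sum>d\<in>T. f d)" using T by (intro sum_mono) auto
    also have "\<dots> \<le> (\<Sum>d. f d)" by (rule sum_le_suminf) (use T in auto)
    finally show ?thesis .
  qed
  moreover obtain n where "(\<Sum>d. f d) < of_nat n"
    using assms ennreal_Ex_less_of_nat[of "\<Sum>d. f d"] by auto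
  ultimately show False by (metis leD)
qed

lemma card_eq_suminf:
  assumes "finite {k. Q k}"
  shows "of_nat (card {k. Q k}) = (\<Sum>k::nat. if Q k then 1 else (0::ennreal))"
  using assms by (subst suminf_finite[of "{k. Q k}"]) (auto simp: sum.If_cases)

context zero_range
begin

lemma arrived_measurable_aux:
  assumes "\<And>x l. x \<in> {w..<y} \<Longrightarrow> Measurable.pred (canonical p) (\<lambda>X. departs w X x l)"
  shows "(\<lambda>v. arrived w (fst v) y (snd v)) \<in> (canonical p \<Otimes>\<^sub>M borel) \<rightarrow>\<^sub>M count_space UNIV"
  unfolding arrived_def
proof (rule nat_sum_measurable)
  fix x assume "x \<in> {w..<y}"
  then have [measurable]: "Measurable.pred (canonical p) (\<lambda>X. departs w X x l)" for l by (rule assms)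
  show "(\<lambda>v. card {l. ring (fst v) x l \<le> snd v \<and> snd (mark (fst v) x l) = y - x \<and> departs w (fst v)
    x l})
    \<in> (canonical p \<Otimes>\<^sub>M borel) \<rightarrow>\<^sub>M count_space UNIV"
    by measurable
qed

lemma departs_measurable[measurable]: "Measurable.pred (canonical p) (\<lambda>X. departs w X y k)"
proof (induction "nat (y - w)" arbitrary: y k rule: less_induct)
  case less
  note IHy = less.hyps
  have arr: "(\<lambda>v. arrived w (fst v) y (snd v)) \<in> (canonical p \<Otimes>\<^sub>M borel) \<rightarrow>\<^sub>M count_space UNIV"
    by (intro arrived_measurable_aux IHy) auto
  show ?case
  proof (induction k rule: less_induct)
    case (less k)
    have "(\<lambda>X. (X, ring X y k)) \<in> canonical p \<rightarrow>\<^sub>M canonical p \<Otimes>\<^sub>M borel" by measurable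
    from measurable_compose[OF this arr]
    have 1: "(\<lambda>X. arrived w X y (ring X y k)) \<in> canonical p \<rightarrow>\<^sub>M count_space UNIV" by simp
    have 2: "(\<lambda>X. card {l. l < k \<and> departs w X y l}) \<in> canonical p \<rightarrow>\<^sub>M count_space UNIV"
    proof (rule measurable_card)
      show "{X \<in> space (canonical p). i \<in> {l. l < k \<and> departs w X y l}} \<in> sets (canonical p)" for i
        using less.IH[of i] by (cases "i < k") (simp_all add: pred_def)
    qed
    have h: "(\<lambda>X. \<zeta> y + arrived w X y (ring X y k) - card {l. l < k \<and> departs w X y l})
        \<in> canonical p \<rightarrow>\<^sub>M count_space UNIV"
      by (rule nat_op_measurable[OF 1 2, where F = "\<lambda>a b. \<zeta> y + a - b"])
    have m: "(\<lambda>X. g (\<zeta> y + arrived w X y (ring X y k) - card {l. l < k \<and> departs w X y l}))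
        \<in> borel_measurable (canonical p)"
      by (rule measurable_compose[OF h]) simp
    have "(\<lambda>X. fst (mark X y k)) \<in> borel_measurable (canonical p)" by measurable
    moreover have "(\<lambda>X. \<alpha> y * g (\<zeta> y + arrived w X y (ring X y k) - card {l. l < k \<and> departs w X y l}))
        \<in> borel_measurable (canonical p)"
      using m by (rule borel_measurable_times[OF borel_measurable_const])
    ultimately show ?case unfolding departs_iff[of w _ y k]
      unfolding pred_def by (rule borel_measurable_le)
  qed
qed

lemma arrived_measurable:
  "(\<lambda>v. arrived w (fst v) y (snd v)) \<in> (canonical p \<Otimes>\<^sub>M borel) \<rightarrow>\<^sub>M count_space UNIV"
  by (rule arrived_measurable_aux) measurable

lemma departed_measurable:
  "(\<lambda>v. departed w (fst v) y (snd v)) \<in> (canonical p \<Otimes>\<^sub>M borel) \<rightarrow>\<^sub>M count_space UNIV"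
  unfolding departed_def by measurable

lemma queue_measurable:
  "(\<lambda>v. queue w (fst v) y (snd v)) \<in> (canonical p \<Otimes>\<^sub>M borel) \<rightarrow>\<^sub>M count_space UNIV"
  unfolding queue_def
  by (rule nat_op_measurable[OF arrived_measurable departed_measurable, where F = "\<lambda>a b. \<zeta> y + a - b"])

text \<open>
  The departures of \<open>x\<close> until its ring \<open>l\<close> do not use the noise further to the right, nor the
  later rings of \<open>x\<close>.
\<close>

lemma departs_upd:
  assumes "x < y \<or> x = y \<and> l < k"
  shows "departs w (X((y, k) := v)) x l = departs w X x l"
  using assms
proof (induction "nat (x - w)" arbitrary: x l rule: less_induct)
  case less
  note IHx = less.hyps
  show ?case using less.prems
  proof (induction l rule: less_induct)
    case (less l)
    have c: "ring (X((y, k) := v)) x l = ring X x l" "mark (X((y, k) := v)) x l = mark X x l"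
      using less.prems by (auto simp: clock_def mark_def intro!: sum.cong)
    have "arrived w (X((y, k) := v)) x t = arrived w X x t" for t
      unfolding arrived_def
    proof (intro sum.cong refl arg_cong[where f = card] Collect_cong)
      fix x' j assume x': "x' \<in> {w..<x}"
      have "departs w (X((y, k) := v)) x' j = departs w X x' j"
        using x' less.prems by (intro IHx) auto
      moreover have "ring (X((y, k) := v)) x' j = ring X x' j" "mark (X((y, k) := v)) x' j = mark X
        x' j"
        using x' less.prems by (auto simp: clock_def mark_def intro!: sum.cong)
      ultimately show "(ring (X((y, k) := v)) x' j \<le> t \<and> snd (mark (X((y, k) := v)) x' j) = x - x' \<and>
        departs w (X((y, k) := v)) x' j)
        = (ring X x' j \<le> t \<and> snd (mark X x' j) = x - x' \<and> departs w X x' j)" by (simp only:)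
    qed
    moreover have "{j. j < l \<and> departs w (X((y, k) := v)) x j} = {j. j < l \<and> departs w X x j}"
      using less.IH less.prems by (auto simp del: fun_upd_apply)
    ultimately show ?case unfolding departs_iff[of w _ x l] c by (simp only:)
  qed
qed

lemma arrived_upd: "arrived w (X((y, k) := v)) y t = arrived w X y t"
  unfolding arrived_def
  by (intro sum.cong refl arg_cong[where f = card] Collect_cong)
    (simp add: departs_upd clock_upd mark_upd del: fun_upd_apply)

lemma AE_finite_rings:
  "AE X in canonical p. \<forall>x t. finite {k. ring X x k \<le> t}"
proof -
  interpret ca: prob_space "canonical p" by (rule prob_space_canonical)
  interpret ml: prob_space "mark_law p" by (rule prob_space_mark_law)
  have "AE X in canonical p. (\<Sum>k. if ring X x k \<le> real n then 1 else (0::ennreal)) < \<infinity>" for x and n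
    :: nat
  proof -
    have "(\<integral>\<^sup>+X. (\<Sum>k. if ring X x k \<le> real n then 1 else (0::ennreal)) \<partial>canonical p) =
        (\<Sum>k. \<integral>\<^sup>+X. (if ring X x k \<le> real n then 1 else (0::ennreal)) \<partial>canonical p)"
      by (rule nn_integral_suminf) measurable
    also have "\<dots> \<le> (\<integral>\<^sup>+X. \<integral>\<^sup>+s. indicator {0..} s * (\<integral>\<^sup>+m. (if s \<le> real n then 1 else 0) \<partial>mark_law
      p) \<partial>lborel \<partial>canonical p)"
      using p_pos by (intro sum_campbell_le) auto
    also have "\<dots> = (\<integral>\<^sup>+X. \<integral>\<^sup>+s. indicator {0..real n} s \<partial>lborel \<partial>canonical p)"
      by (intro nn_integral_cong) (auto simp: indicator_def ml.emeasure_space_1)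
    also have "\<dots> = ennreal (real n)"
      by (simp add: ca.emeasure_space_1[simplified])
    finally have fin: "(\<integral>\<^sup>+X. (\<Sum>k. if ring X x k \<le> real n then 1 else (0::ennreal)) \<partial>canonical p) < \<infinity>"
      by (rule order.strict_trans1) simp
    show ?thesis
      using fin by (intro nn_integral_PInf_AE[THEN eventually_mono]) (auto simp: less_top)
  qed
  then have "AE X in canonical p. \<forall>x (n::nat). (\<Sum>k. if ring X x k \<le> real n then 1 else (0::ennreal))
    < \<infinity>"
    by (simp add: AE_all_countable)
  then show ?thesis
  proof eventually_elim
    case (elim X)
    show ?case
    proof (intro allI)
      fix x t
      obtain n :: nat where "t \<le> real n" using real_arch_simple by blast
      then have "{k. ring X x k \<le> t} \<subseteq> {k. 1 \<le> (if ring X x k \<le> real n then 1 else (0::ennreal))}"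
        by auto
      then show "finite {k. ring X x k \<le> t}"
        using suminf_finite_imp[of "\<lambda>k. if ring X x k \<le> real n then 1 else (0::ennreal)"] elim
        by (blast intro: finite_subset)
    qed
  qed
qed

text \<open>
  The potential arrivals at \<open>z\<close> are the one-step chains ending there; by the choice \<open>L = z - 1\<close>
  no chain is cut off earlier.
\<close>

lemma AE_finite_arrivals:
  "AE X in canonical p. \<forall>z t. finite {(d, k). ring X (z - int (Suc d)) k \<le> t \<and> snd (mark X (z - int
    (Suc d)) k) = int (Suc d)}"
proof -
  have "AE X in canonical p. chains (z - 1) X 1 z (real n) < \<infinity>" for z and n :: nat
  proof -
    have "(\<integral>\<^sup>+X. chains (z - 1) X 1 z (real n) \<partial>canonical p) \<le>
      ennreal (real n ^ 1 / fact 1) + ennreal (exp (real n)) * walk_tail p 1 (z - (z - 1))"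
      using p_pos by (intro chains_expectation_le) auto
    also have "\<dots> \<le> ennreal (real n ^ 1 / fact 1) + ennreal (exp (real n)) * 1"
      by (intro add_left_mono mult_left_mono walk_tail_le_1) simp
    also have "\<dots> < \<infinity>" by simp
    finally have fin: "(\<integral>\<^sup>+X. chains (z - 1) X 1 z (real n) \<partial>canonical p) < \<infinity>" .
    have "(\<lambda>X. chains (z - 1) X 1 z (real n)) \<in> borel_measurable (canonical p)"
      using measurable_compose[OF measurable_Pair2'[of "real n" borel "canonical p"]
        chains_measurable[of "z - 1" 1 z]] by simp
    then show ?thesis
      using fin by (intro nn_integral_PInf_AE[THEN eventually_mono]) (auto simp: less_top)
  qed
  then have "AE X in canonical p. \<forall>z (n::nat). chains (z - 1) X 1 z (real n) < \<infinity>"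
    by (simp add: AE_all_countable)
  then show ?thesis
  proof eventually_elim
    case (elim X)
    show ?case
    proof (intro allI)
      fix z t
      obtain n :: nat where n: "t \<le> real n" using real_arch_simple by blast
      define Q where "Q d k \<longleftrightarrow> ring X (z - int (Suc d)) k \<le> real n \<and> snd (mark X (z - int (Suc d)) k)
        = int (Suc d)" for d k
      have "(\<Sum>d. \<Sum>k. if Q d k then 1 else 0) < (\<infinity>::ennreal)"
        using elim[rule_format, of z n] by (simp add: Q_def cong: if_cong del: of_nat_Suc)
      then have fin_d: "finite {d. 1 \<le> (\<Sum>k. if Q d k then 1 else (0::ennreal))}" and
        each: "(\<Sum>k. if Q d k then 1 else (0::ennreal)) < \<infinity>" for d
        using ennreal_term_le_suminf[of "\<lambda>d. \<Sum>k. if Q d k then 1 else 0" d]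
        by (auto intro: suminf_finite_imp order.strict_trans1)
      have fin_k: "finite {k. Q d k}" for d
        using suminf_finite_imp[OF each[of d]] by (rule rev_finite_subset) auto
      have "{(d, k). Q d k} \<subseteq> (SIGMA d:{d. 1 \<le> (\<Sum>k. if Q d k then 1 else (0::ennreal))}. {k. Q d k})"
        using ennreal_term_le_suminf[of "\<lambda>k. if Q d k then 1 else 0" for d] by (force simp: split:
          if_splits)
      then have "finite {(d, k). Q d k}"
        by (rule finite_subset) (rule finite_SigmaI[OF fin_d fin_k])
      moreover have "{(d, k). ring X (z - int (Suc d)) k \<le> t \<and> snd (mark X (z - int (Suc d)) k) =
        int (Suc d)} \<subseteq> {(d, k). Q d k}"
        using n by (auto simp: Q_def)
      ultimately show "finite {(d, k). ring X (z - int (Suc d)) k \<le> t \<and> snd (mark X (z - int (Suc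
        d)) k) = int (Suc d)}"
        by (rule rev_finite_subset)
    qed
  qed
qed

lemma AE_no_simultaneous_rings:
  "AE X in canonical p. \<forall>x k x' k'. x \<noteq> x' \<longrightarrow> ring X x k \<noteq> ring X x' k'"
proof -
  interpret ml: prob_space "mark_law p" by (rule prob_space_mark_law)
  have "AE X in canonical p. ring X x k \<noteq> ring X x' k'" if "x \<noteq> x'" for x k x' k'
  proof -
    define F where "F X s m = (if s = ring X x' k' then 1 else (0::ennreal))" for X s and m :: "real
      \<times> int"
    have "(\<integral>\<^sup>+X. F X (ring X x k) (mark X x k) \<partial>canonical p) =
        (\<integral>\<^sup>+X. \<integral>\<^sup>+s. indicator {clock X x k..<ring X x k} s * (\<integral>\<^sup>+m. F X s m \<partial>mark_law p) \<partial>lborel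
          \<partial>canonical p)"
    proof (rule campbell[where F = F])
      show "(\<lambda>(X, s, m). F X s m) \<in>
          borel_measurable (canonical p \<Otimes>\<^sub>M borel \<Otimes>\<^sub>M borel \<Otimes>\<^sub>M count_space UNIV)"
        unfolding split_beta' F_def by measurable
      have "ring (X((x, k) := v)) x' k' = ring X x' k'" for X v
        using that by (auto simp: clock_def intro!: sum.cong)
      then show "F (X((x, k) := v)) = F X" for X v
        by (intro ext) (simp only: F_def)
    qed
    also have "\<dots> = (\<integral>\<^sup>+X. \<integral>\<^sup>+s. 0 \<partial>(lborel :: real measure) \<partial>canonical p)"
    proof (rule nn_integral_cong, rule nn_integral_cong_AE)
      fix X
      show "AE s in lborel. indicator {clock X x k..<ring X x k} s * (\<integral>\<^sup>+m. F X s m \<partial>mark_law p) = 0"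
        using AE_lborel_singleton[of "ring X x' k'"] by eventually_elim (simp add: F_def)
    qed
    finally have "(\<integral>\<^sup>+X. (if ring X x k = ring X x' k' then 1 else (0::ennreal)) \<partial>canonical p) = 0"
      by (simp add: F_def)
    then show ?thesis
      by (subst (asm) nn_integral_0_iff_AE) (auto elim!: eventually_mono split: if_splits)
  qed
  then show ?thesis by (simp add: AE_all_countable)
qed

lemma AE_regular: "AE X in canonical p. regular X"
proof -
  have "AE X in canonical p. \<forall>x k. 0 < fst (X (x, k)) \<and> 0 < fst (mark X x k) \<and> 0 < snd (mark X x k)"
    by (rule AE_canonical_positive) (rule p_pos)
  then show ?thesis using AE_finite_rings AE_finite_arrivals AE_no_simultaneous_rings
  proof eventually_elim
    case (elim X)
    have mono: "strict_mono (clock X x)" for x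
      using elim(1) by (auto simp: strict_mono_Suc_iff clock_def)
    have "finite {(x, k). ring X x k \<le> t \<and> x + snd (mark X x k) = z}" for z t
    proof (rule finite_surj)
      show "finite {(d, k). ring X (z - int (Suc d)) k \<le> t \<and> snd (mark X (z - int (Suc d)) k) = int
        (Suc d)}"
        using elim(3) by blast
      show "{(x, k). ring X x k \<le> t \<and> x + snd (mark X x k) = z} \<subseteq> (\<lambda>(d, k). (z - int (Suc d), k)) `
          {(d, k). ring X (z - int (Suc d)) k \<le> t \<and> snd (mark X (z - int (Suc d)) k) = int (Suc d)}"
      proof
        fix e assume e: "e \<in> {(x, k). ring X x k \<le> t \<and> x + snd (mark X x k) = z}"
        obtain x k where xk: "e = (x, k)" by fastforce
        define d where "d = nat (snd (mark X x k) - 1)"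
        have d: "int (Suc d) = snd (mark X x k)" using elim(1)[rule_format, of x k] by (simp add: d_def)
        then have "z - int (Suc d) = x" using e xk by simp
        then show "e \<in> (\<lambda>(d, k). (z - int (Suc d), k)) `
            {(d, k). ring X (z - int (Suc d)) k \<le> t \<and> snd (mark X (z - int (Suc d)) k) = int (Suc d)}"
          using e xk d by (intro image_eqI[where x = "(d, k)"]) simp_all
      qed
    qed
    moreover have "x = x' \<and> k = k'" if "ring X x k = ring X x' k'" for x k x' k'
    proof -
      have "x = x'" using elim(4) that by blast
      then show ?thesis using that strict_mono_eq[OF mono, of x' "Suc k" "Suc k'"] by simp
    qed
    ultimately have "\<forall>z t. finite {(x, k). ring X x k \<le> t \<and> x + snd (mark X x k) = z}"
      "\<forall>x k x' k'. ring X x k = ring X x' k' \<longrightarrow> x = x' \<and> k = k'"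
      by (blast, blast)
    then show ?case
      unfolding regular_def using elim(1,2) by (simp only: simp_thms)
  qed
qed

end

section \<open>Expected departures and conservation of flux\<close>

lemma clock_interval:
  assumes "regular X" "0 \<le> s"
  obtains k where "clock X x k \<le> s" "s < ring X x k" "\<And>l. ring X x l \<le> s \<longleftrightarrow> l < k"
    "\<And>l. clock X x l \<le> s \<and> s < ring X x l \<longleftrightarrow> l = k"
proof -
  note mono = regular_strict_mono[OF assms(1), of x]
  have fin: "finite {l. ring X x l \<le> s}" by (rule regularD(3)[OF assms(1)])
  have "{l. ring X x l \<le> s} \<noteq> UNIV" using fin by auto
  then obtain m where m: "\<not> ring X x m \<le> s" by blast
  define k where "k = (LEAST m. s < ring X x m)"
  have k: "s < ring X x k" 
    unfolding k_def by (rule LeastI[of "\<lambda>m. s < ring X x m" m]) (use m in simp)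
  have iff: "ring X x l \<le> s \<longleftrightarrow> l < k" for l
  proof
    assume "ring X x l \<le> s"
    then have "ring X x l < ring X x k" using k by simp
    then show "l < k" by (simp only: regular_ring_less[OF assms(1)])
  next
    assume "l < k"
    then show "ring X x l \<le> s" using not_less_Least[of l "\<lambda>m. s < ring X x m"]
      unfolding k_def by (simp only: not_less)
  qed
  have lo: "clock X x k \<le> s"
    using iff[of "k - 1"] assms(2) by (cases k) auto
  have "l = k" if "clock X x l \<le> s" "s < ring X x l" for l
  proof (rule antisym)
    have "\<not> l < k" using that(2) iff[of l] by simp
    then show "k \<le> l" by simp
    show "l \<le> k"
    proof (rule ccontr)
      assume "\<not> l \<le> k"
      then have "ring X x k \<le> clock X x l" using strict_mono_mono[OF mono] by (simp add: monoD)
      with that k show False by simp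
    qed
  qed
  then show ?thesis using that[OF lo k iff] lo k by blast
qed

context zero_range
begin

lemma service_le_1: "\<alpha> y * g n \<le> 1" "0 \<le> \<alpha> y * g n"
  using mult_le_one[OF \<alpha>_le_1 g_nonneg g_le_1, of y n] \<alpha>_pos[of y] g_nonneg[of n]
  by simp_all

text \<open>
  Campbell's formula for the departures from \<open>y\<close> with jump length in \<open>B\<close>. During the \<open>k\<close>-th
  waiting period exactly the rings \<open>l < k\<close> have occurred, so the configuration which the ring \<open>k\<close>
  will find is the current queue; the uniform mark produces the factor \<open>\<alpha> y * g\<close>, and the jump
  length contributes the independent factor \<open>p(B)\<close>.
\<close>

lemma expected_departures:
  assumes "0 \<le> t"
  shows "(\<integral>\<^sup>+X. of_nat (card {k. ring X y k \<le> t \<and> snd (mark X y k) \<in> B \<and> departs w X y k})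
    \<partial>canonical p) =
    emeasure (measure_pmf p) B *
      (\<integral>\<^sup>+X. \<integral>\<^sup>+s. indicator {0..t} s * ennreal (\<alpha> y * g (queue w X y s)) \<partial>lborel \<partial>canonical p)"
proof -
  \<comment> \<open>the queue as it is seen by the ring \<open>k\<close> if this ring occurs at time \<open>s\<close>\<close>
  define q where "q k X s = \<zeta> y + arrived w X y s - card {l. l < k \<and> departs w X y l}" for k X s
  define F where "F k X s m = (if s \<le> t \<and> snd m \<in> B \<and> fst m \<le> \<alpha> y * g (q k X s) then 1 else
    (0::ennreal))"
    for k X s and m :: "real \<times> int"
  define c where "c = emeasure (measure_pmf p) B"
  have lborel_sets: "borel_measurable (canonical p \<Otimes>\<^sub>M lborel) = borel_measurable (canonical p \<Otimes>\<^sub>M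
    borel)"
    by (intro measurable_cong_sets sets_pair_measure_cong) auto
  have own: "(\<lambda>X. card {l. l < k \<and> departs w X y l}) \<in> canonical p \<rightarrow>\<^sub>M count_space UNIV" for k
    by measurable
  have q[measurable]: "(\<lambda>v. q k (fst v) (snd v)) \<in> (canonical p \<Otimes>\<^sub>M borel) \<rightarrow>\<^sub>M count_space UNIV" for k
    unfolding q_def
    by (rule nat_op_measurable[OF arrived_measurable measurable_compose[OF measurable_fst own],
      where F = "\<lambda>a b. \<zeta> y + a - b"])
  have gq: "(\<lambda>v. g (q k (fst v) (snd v))) \<in> borel_measurable (canonical p \<Otimes>\<^sub>M borel)" for k
    by (rule measurable_compose[OF q]) simp
  have F: "(\<lambda>(X, s, m). F k X s m) \<in> borel_measurable (canonical p \<Otimes>\<^sub>M borel \<Otimes>\<^sub>M borel \<Otimes>\<^sub>M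
    count_space UNIV)" for k
  proof -
    have "(\<lambda>v. (fst v, fst (snd v))) \<in> canonical p \<Otimes>\<^sub>M borel \<Otimes>\<^sub>M (borel \<Otimes>\<^sub>M count_space UNIV)
        \<rightarrow>\<^sub>M canonical p \<Otimes>\<^sub>M borel"
      by measurable
    from measurable_compose[OF this gq[of k]]
    have [measurable]: "(\<lambda>v. g (q k (fst v) (fst (snd v)))) \<in>
        borel_measurable (canonical p \<Otimes>\<^sub>M borel \<Otimes>\<^sub>M (borel \<Otimes>\<^sub>M count_space UNIV))"
      by simp
    show ?thesis unfolding F_def split_beta' by measurable
  qed
  have indep: "F k (X((y, k) := v)) = F k X" for k X v
  proof -
    have "{l. l < k \<and> departs w (X((y, k) := v)) y l} = {l. l < k \<and> departs w X y l}"
      by (auto simp: departs_upd simp del: fun_upd_apply)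
    then have "q k (X((y, k) := v)) = q k X"
      by (intro ext) (simp only: q_def arrived_upd)
    then show ?thesis by (intro ext) (simp only: F_def)
  qed
  have Fbar: "(\<integral>\<^sup>+m. F k X s m \<partial>mark_law p) = c * (indicator {..t} s * ennreal (\<alpha> y * g (q k X s)))"
    for k X s
  proof -
    have "(\<integral>\<^sup>+m. F k X s m \<partial>mark_law p) =
        (\<integral>\<^sup>+m. indicator {..t} s * indicator ({..\<alpha> y * g (q k X s)} \<times> B) m \<partial>mark_law p)"
      by (intro nn_integral_cong) (auto simp: F_def indicator_def mem_Times_iff)
    also have "\<dots> = indicator {..t} s * emeasure (mark_law p) ({..\<alpha> y * g (q k X s)} \<times> B)"
      by (rule nn_integral_cmult_indicator) (simp add: sets_mark_law pair_measureI)
    also have "emeasure (mark_law p) ({..\<alpha> y * g (q k X s)} \<times> B) = ennreal (\<alpha> y * g (q k X s)) * c"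
      by (subst emeasure_mark_law) (simp_all only: emeasure_uniform01[OF service_le_1(2,1)] c_def, simp)
    finally show ?thesis by (simp only: ac_simps)
  qed
  have AEr: "AE X in canonical p. regular X" by (rule AE_regular)
  have "(\<integral>\<^sup>+X. of_nat (card {k. ring X y k \<le> t \<and> snd (mark X y k) \<in> B \<and> departs w X y k}) \<partial>canonical
    p) =
    (\<integral>\<^sup>+X. (\<Sum>k. F k X (ring X y k) (mark X y k)) \<partial>canonical p)"
  proof (rule nn_integral_cong_AE)
    show "AE X in canonical p. of_nat (card {k. ring X y k \<le> t \<and> snd (mark X y k) \<in> B \<and> departs w X
      y k}) =
        (\<Sum>k. F k X (ring X y k) (mark X y k))"
      using AEr
    proof eventually_elim
      case (elim X)
      have "finite {k. ring X y k \<le> t \<and> snd (mark X y k) \<in> B \<and> departs w X y k}"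
        by (rule finite_subset[OF _ regularD(3)[OF elim, of y t]]) auto
      then have "of_nat (card {k. ring X y k \<le> t \<and> snd (mark X y k) \<in> B \<and> departs w X y k}) =
          (\<Sum>k. if ring X y k \<le> t \<and> snd (mark X y k) \<in> B \<and> departs w X y k then 1 else (0::ennreal))"
        by (rule card_eq_suminf)
      also have "\<dots> = (\<Sum>k. F k X (ring X y k) (mark X y k))"
        unfolding F_def q_def by (intro suminf_cong if_cong refl conj_cong departs_iff)
      finally show ?case .
    qed
  qed
  also have "\<dots> = (\<Sum>k. \<integral>\<^sup>+X. F k X (ring X y k) (mark X y k) \<partial>canonical p)"
  proof (rule nn_integral_suminf)
    have m: "(\<lambda>X. (X, ring X y k, mark X y k)) \<in> canonical p \<rightarrow>\<^sub>M
        canonical p \<Otimes>\<^sub>M borel \<Otimes>\<^sub>M borel \<Otimes>\<^sub>M count_space UNIV" for k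
      by measurable
    show "(\<lambda>X. F k X (ring X y k) (mark X y k)) \<in> borel_measurable (canonical p)" for k
      using measurable_compose[OF m F[of k]] by simp
  qed
  also have "\<dots> = (\<Sum>k. \<integral>\<^sup>+X. \<integral>\<^sup>+s. indicator {clock X y k..<ring X y k} s *
      (c * (indicator {..t} s * ennreal (\<alpha> y * g (q k X s)))) \<partial>lborel \<partial>canonical p)"
    by (intro suminf_cong) (simp only: campbell[OF F indep] Fbar)
  also have "\<dots> = (\<integral>\<^sup>+X. \<integral>\<^sup>+s. (\<Sum>k. indicator {clock X y k..<ring X y k} s *
      (c * (indicator {..t} s * ennreal (\<alpha> y * g (q k X s))))) \<partial>lborel \<partial>canonical p)"
    (is "(\<Sum>k. \<integral>\<^sup>+X. \<integral>\<^sup>+s. ?H k X s \<partial>lborel \<partial>_) = _")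
  proof -
    have H: "(\<lambda>v. ?H k (fst v) (snd v)) \<in> borel_measurable (canonical p \<Otimes>\<^sub>M lborel)" for k
    proof -
      have 1: "(\<lambda>v. indicator {clock (fst v) y k..<ring (fst v) y k} (snd v) :: ennreal) \<in>
        borel_measurable (canonical p \<Otimes>\<^sub>M borel)"
      proof -
        have "Measurable.pred (canonical p \<Otimes>\<^sub>M borel) (\<lambda>v. clock (fst v) y k \<le> snd v \<and> snd v < ring
          (fst v) y k)"
          by measurable
        then show ?thesis unfolding indicator_def by simp
      qed
      have 2: "(\<lambda>v. indicator {..t} (snd v) :: ennreal) \<in> borel_measurable (canonical p \<Otimes>\<^sub>M borel)"
        by measurable
      have 3: "(\<lambda>v. ennreal (\<alpha> y * g (q k (fst v) (snd v)))) \<in> borel_measurable (canonical p \<Otimes>\<^sub>M borel)"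
        by (rule measurable_compose[OF borel_measurable_times[OF borel_measurable_const gq]
          measurable_ennreal])
      show ?thesis
        unfolding lborel_sets
        by (intro borel_measurable_times_ennreal borel_measurable_const 1 2 3)
    qed
    have Hs: "(\<lambda>s. ?H k X s) \<in> borel_measurable lborel" for k X
      using measurable_compose[OF measurable_Pair1'[of X "canonical p" lborel] H[of k]] by simp
    have HX: "(\<lambda>X. \<integral>\<^sup>+s. ?H k X s \<partial>lborel) \<in> borel_measurable (canonical p)" for k
      by (rule lborel.borel_measurable_nn_integral) (simp only: split_beta' H)
    show ?thesis
      by (simp only: nn_integral_suminf[OF HX, symmetric] nn_integral_suminf[OF Hs, symmetric])
  qed
  also have "\<dots> = (\<integral>\<^sup>+X. \<integral>\<^sup>+s. c * (indicator {0..t} s * ennreal (\<alpha> y * g (queue w X y s))) \<partial>lborel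
    \<partial>canonical p)"
  proof (rule nn_integral_cong_AE)
    show "AE X in canonical p. (\<integral>\<^sup>+s. (\<Sum>k. indicator {clock X y k..<ring X y k} s *
        (c * (indicator {..t} s * ennreal (\<alpha> y * g (q k X s))))) \<partial>lborel) =
        (\<integral>\<^sup>+s. c * (indicator {0..t} s * ennreal (\<alpha> y * g (queue w X y s))) \<partial>lborel)"
      using AEr
    proof eventually_elim
      case (elim X)
      show ?case
      proof (rule nn_integral_cong)
        fix s
        show "(\<Sum>k. indicator {clock X y k..<ring X y k} s *
            (c * (indicator {..t} s * ennreal (\<alpha> y * g (q k X s))))) =
            c * (indicator {0..t} s * ennreal (\<alpha> y * g (queue w X y s)))"
        proof (cases "0 \<le> s")
          case False
          have "0 \<le> clock X y k" for k
            using strict_mono_mono[OF regular_strict_mono[OF elim, of y], THEN monoD, of 0 k] by simp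
          then have "\<not> clock X y k \<le> s" for k using False by (meson order_trans)
          then show ?thesis using False by (simp add: indicator_def)
        next
          case True
          obtain k where k: "\<And>l. ring X y l \<le> s \<longleftrightarrow> l < k"
            "\<And>l. clock X y l \<le> s \<and> s < ring X y l \<longleftrightarrow> l = k"
            using clock_interval[OF elim True, of y] by metis
          have "q k X s = queue w X y s"
            by (simp only: q_def queue_def departed_def k)
          then show ?thesis
            using True by (subst suminf_finite[of "{k}"]) (auto simp: indicator_def k)
        qed
      qed
    qed
  qed
  also have "\<dots> = c * (\<integral>\<^sup>+X. \<integral>\<^sup>+s. indicator {0..t} s * ennreal (\<alpha> y * g (queue w X y s)) \<partial>lborel
    \<partial>canonical p)"
  proof -
    have gq: "(\<lambda>v. g (queue w (fst v) y (snd v))) \<in> borel_measurable (canonical p \<Otimes>\<^sub>M borel)"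
      by (rule measurable_compose[OF queue_measurable]) simp
    have 1: "(\<lambda>v. ennreal (\<alpha> y * g (queue w (fst v) y (snd v)))) \<in> borel_measurable (canonical p \<Otimes>\<^sub>M
      borel)"
      by (rule measurable_compose[OF borel_measurable_times[OF borel_measurable_const gq]
        measurable_ennreal])
    have 2: "(\<lambda>v. indicator {0..t} (snd v) :: ennreal) \<in> borel_measurable (canonical p \<Otimes>\<^sub>M borel)"
      by measurable
    have H: "(\<lambda>v. indicator {0..t} (snd v) * ennreal (\<alpha> y * g (queue w (fst v) y (snd v)))) \<in>
      borel_measurable (canonical p \<Otimes>\<^sub>M lborel)"
      unfolding lborel_sets by (intro borel_measurable_times_ennreal 1 2)
    have Hs: "(\<lambda>s. indicator {0..t} s * ennreal (\<alpha> y * g (queue w X y s))) \<in> borel_measurable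
      lborel" for X
      using measurable_compose[OF measurable_Pair1'[of X "canonical p" lborel] H] by simp
    have HX: "(\<lambda>X. \<integral>\<^sup>+s. indicator {0..t} s * ennreal (\<alpha> y * g (queue w X y s)) \<partial>lborel) \<in>
      borel_measurable (canonical p)"
      by (rule lborel.borel_measurable_nn_integral) (simp only: split_beta' H)
    show ?thesis by (subst nn_integral_cmult[OF Hs], rule nn_integral_cmult[OF HX])
  qed
  finally show ?thesis by (simp only: c_def)
qed

end

context zero_range
begin

text \<open>
  By \<open>expected_departures\<close> this is the mean number of departures from \<open>y\<close> until time \<open>t\<close>.
\<close>

definition outflow :: "int \<Rightarrow> int \<Rightarrow> real \<Rightarrow> ennreal" where
  "outflow w y t =
     (\<integral>\<^sup>+X. \<integral>\<^sup>+s. indicator {0..t} s * ennreal (\<alpha> y * g (queue w X y s)) \<partial>lborel \<partial>canonical p)"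

lemma outflow_le:
  assumes "0 \<le> t" shows "outflow w y t \<le> ennreal (\<alpha> y * t)"
proof -
  interpret ca: prob_space "canonical p" by (rule prob_space_canonical)
  have "outflow w y t \<le> (\<integral>\<^sup>+X. \<integral>\<^sup>+s. ennreal (\<alpha> y) * indicator {0..t} s \<partial>lborel \<partial>canonical p)"
    unfolding outflow_def
  proof (intro nn_integral_mono)
    fix X s
    have "\<alpha> y * g n \<le> \<alpha> y" for n
      using mult_left_mono[OF g_le_1, of "\<alpha> y" n] \<alpha>_pos[of y] by simp
    then show "indicator {0..t} s * ennreal (\<alpha> y * g (queue w X y s)) \<le> ennreal (\<alpha> y) * indicator
      {0..t} s"
      by (auto simp: indicator_def intro!: ennreal_leI)
  qed
  also have "\<dots> = ennreal (\<alpha> y * t)"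
    using assms \<alpha>_pos[of y] by (simp add: nn_integral_cmult_indicator
      ca.emeasure_space_1[simplified] ennreal_mult)
  finally show ?thesis .
qed

lemma outflow_finite: "0 \<le> t \<Longrightarrow> outflow w y t < \<infinity>"
  unfolding infinity_ennreal_def by (rule order.strict_trans1[OF outflow_le ennreal_less_top])

text \<open>
  Departures are bounded by initial particles plus arrivals, and the arrivals from \<open>x\<close> are the
  departures from \<open>x\<close> with jump length \<open>y - x\<close>.
\<close>

lemma outflow_recursion:
  assumes "0 \<le> t"
  shows "outflow w y t \<le> of_nat (\<zeta> y) + (\<Sum>x\<in>{w..<y}. ennreal (pmf p (y - x)) * outflow w x t)"
proof -
  interpret ca: prob_space "canonical p" by (rule prob_space_canonical)
  have m: "(\<lambda>X. of_nat (card {l. ring X x l \<le> t \<and> snd (mark X x l) = z \<and> departs w X x l}) :: ennreal)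
    \<in> borel_measurable (canonical p)" for x z
  proof -
    have "(\<lambda>X. card {l. ring X x l \<le> t \<and> snd (mark X x l) = z \<and> departs w X x l}) \<in> canonical p \<rightarrow>\<^sub>M
      count_space UNIV"
      by measurable
    then show ?thesis by (rule measurable_compose) simp
  qed
  have "outflow w y t = (\<integral>\<^sup>+X. of_nat (departed w X y t) \<partial>canonical p)"
    using expected_departures[OF assms, of y UNIV w]
    by (simp add: departed_def outflow_def)
  also have "\<dots> \<le> (\<integral>\<^sup>+X. of_nat (\<zeta> y) +
      (\<Sum>x\<in>{w..<y}. of_nat (card {l. ring X x l \<le> t \<and> snd (mark X x l) = y - x \<and> departs w X x l}))
        \<partial>canonical p)"
  proof (rule nn_integral_mono_AE)
    show "AE X in canonical p. of_nat (departed w X y t) \<le> of_nat (\<zeta> y) +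
      (\<Sum>x\<in>{w..<y}. of_nat (card {l. ring X x l \<le> t \<and> snd (mark X x l) = y - x \<and> departs w X x l}) ::
        ennreal)"
      using AE_regular
    proof eventually_elim
      case (elim X)
      have "(of_nat (departed w X y t) :: ennreal) \<le> of_nat (\<zeta> y + arrived w X y t)"
        using departed_le[OF elim] by (rule of_nat_mono)
      then show ?case by (simp add: arrived_def)
    qed
  qed
  also have "\<dots> = of_nat (\<zeta> y) + (\<Sum>x\<in>{w..<y}.
      \<integral>\<^sup>+X. of_nat (card {l. ring X x l \<le> t \<and> snd (mark X x l) = y - x \<and> departs w X x l})
        \<partial>canonical p)"
    using m by (subst nn_integral_add, simp, simp, subst nn_integral_sum) (auto simp:
      ca.emeasure_space_1[simplified])
  also have "\<dots> = of_nat (\<zeta> y) + (\<Sum>x\<in>{w..<y}. ennreal (pmf p (y - x)) * outflow w x t)"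
    using expected_departures[OF assms, of x "{y - x}" w for x]
    by (simp add: outflow_def emeasure_pmf_single)
  finally show ?thesis .
qed

definition flow :: "int \<Rightarrow> int \<Rightarrow> real \<Rightarrow> real" where
  "flow w y t = enn2real (outflow w y t)"

lemma ennreal_flow: "0 \<le> t \<Longrightarrow> ennreal (flow w y t) = outflow w y t"
  unfolding flow_def using outflow_finite[of t w y] by (simp add: less_top)

lemma flow_nonneg: "0 \<le> flow w y t"
  by (simp add: flow_def)

lemma flow_source: "0 \<le> t \<Longrightarrow> flow w y t \<le> \<alpha> y * t"
  using outflow_le[of t w y] \<alpha>_pos[of y] by (simp add: ennreal_flow[symmetric])

lemma flow_recursion:
  assumes "0 \<le> t"
  shows "flow w y t \<le> real (\<zeta> y) + (\<Sum>x\<in>{w..<y}. pmf p (y - x) * flow w x t)"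
proof -
  have "ennreal (flow w y t) \<le> ennreal (real (\<zeta> y) + (\<Sum>x\<in>{w..<y}. pmf p (y - x) * flow w x t))"
    using outflow_recursion[OF assms, of w y]
    by (simp add: ennreal_flow[OF assms, symmetric] ennreal_mult[symmetric] flow_nonneg sum_ennreal
        ennreal_of_nat_eq_real_of_nat ennreal_plus[symmetric] sum_nonneg del: ennreal_plus)
  then show ?thesis
    by (subst (asm) ennreal_le_iff) (auto intro!: add_nonneg_nonneg sum_nonneg mult_nonneg_nonneg
      flow_nonneg)
qed

lemma prob_greater_Suc:
  "measure (measure_pmf p) {z. i < z} = measure (measure_pmf p) {z. i + 1 < z} + pmf p (i + 1)"
proof -
  have eq: "{z. i < z} = {z. i + 1 < z} \<union> {i + 1}" by auto
  show ?thesis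
    unfolding eq by (subst measure_pmf.finite_measure_Union) (auto simp: measure_pmf_single)
qed

text \<open>
  The left hand side is the mean flux from \<open>[w, w + n]\<close> to the right. Passing from \<open>n\<close> to \<open>n + 1\<close>
  adds the departures from the new site \<open>y\<close> and removes the jumps that end at \<open>y\<close>; the difference
  is at most \<open>\<zeta> y\<close>.
\<close>

lemma flux_le:
  assumes "0 \<le> t"
  shows "(\<Sum>x\<in>{w..w + int n}. flow w x t * measure (measure_pmf p) {z. w + int n - x < z})
    \<le> \<alpha> w * t + (\<Sum>x\<in>{w<..w + int n}. real (\<zeta> x))"
proof (induction n)
  case 0
  have "flow w w t * measure (measure_pmf p) {z. 0 < z} \<le> flow w w t * 1"
    by (intro mult_left_mono flow_nonneg) simp
  with flow_source[OF assms, of w w] show ?case by simp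
next
  case (Suc n)
  define y where "y = w + int n + 1"
  have y: "w + int (Suc n) = y" "{w..y} = insert y {w..w + int n}" "{w<..y} = insert y {w<..w + int n}"
    "{w..<y} = {w..w + int n}"
    by (auto simp: y_def)
  have "(\<Sum>x\<in>{w..y}. flow w x t * measure (measure_pmf p) {z. y - x < z}) =
      flow w y t * measure (measure_pmf p) {z. 0 < z} +
      (\<Sum>x\<in>{w..w + int n}. flow w x t * measure (measure_pmf p) {z. y - x < z})"
    by (simp add: y(2)) (simp add: y_def)
  also have "(\<Sum>x\<in>{w..w + int n}. flow w x t * measure (measure_pmf p) {z. y - x < z}) =
      (\<Sum>x\<in>{w..w + int n}. flow w x t * measure (measure_pmf p) {z. w + int n - x < z}) -
      (\<Sum>x\<in>{w..<y}. pmf p (y - x) * flow w x t)"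
    unfolding y(4) sum_subtractf[symmetric]
  proof (rule sum.cong)
    fix x
    show "flow w x t * measure (measure_pmf p) {z. y - x < z} =
        flow w x t * measure (measure_pmf p) {z. w + int n - x < z} - pmf p (y - x) * flow w x t"
      using prob_greater_Suc[of "w + int n - x"] by (simp add: y_def algebra_simps)
  qed simp
  finally have "(\<Sum>x\<in>{w..y}. flow w x t * measure (measure_pmf p) {z. y - x < z}) =
      flow w y t * measure (measure_pmf p) {z. 0 < z} +
      ((\<Sum>x\<in>{w..w + int n}. flow w x t * measure (measure_pmf p) {z. w + int n - x < z}) -
      (\<Sum>x\<in>{w..<y}. pmf p (y - x) * flow w x t))" .
  moreover have "flow w y t * measure (measure_pmf p) {z. 0 < z} \<le> flow w y t * 1"
    by (intro mult_left_mono flow_nonneg) simp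
  moreover have "(\<Sum>x\<in>{w<..y}. real (\<zeta> x)) = real (\<zeta> y) + (\<Sum>x\<in>{w<..w + int n}. real (\<zeta> x))"
    unfolding y(3) by (subst sum.insert) (auto simp: y_def)
  ultimately show ?case
    unfolding y(1) using Suc.IH flow_recursion[OF assms, of w y] by linarith
qed

text \<open>
  The flux across \<open>(1, 2)\<close> bounds \<open>D(1) + (1 - p(1)) D(0)\<close> and the flux across \<open>(0, 1)\<close> bounds
  \<open>D(0)\<close>. The desired sum is the first quantity plus \<open>p(1)\<close> times the second one.
\<close>

lemma flow_at_0_and_1_le:
  assumes "0 \<le> t" "w \<le> 0"
  shows "flow w 0 t + flow w 1 t \<le> (1 + pmf p 1) * (\<alpha> w * t + (\<Sum>x\<in>{w<..1}. real (\<zeta> x)))"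
proof -
  define N where "N = \<alpha> w * t + (\<Sum>x\<in>{w<..1}. real (\<zeta> x))"
  let ?P = "\<lambda>i. measure (measure_pmf p) {z. i < z}"
  have "(AE z in measure_pmf p. 0 < z)"
    using p_pos by (auto simp: AE_measure_pmf_iff set_pmf_iff) (meson not_le)
  then have P0: "?P 0 = 1"
    by (subst measure_pmf.prob_eq_1) auto
  then have P1: "?P 1 = 1 - pmf p 1"
    using prob_greater_Suc[of 0] by simp
  have "flow w 0 t * ?P 0 \<le> (\<Sum>x\<in>{w..0}. flow w x t * ?P (0 - x))"
    using member_le_sum[of 0 "{w..0}" "\<lambda>x. flow w x t * ?P (0 - x)"] assms
    by (simp add: flow_nonneg)
  also have "\<dots> \<le> \<alpha> w * t + (\<Sum>x\<in>{w<..0}. real (\<zeta> x))"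
    using flux_le[OF assms(1), of w "nat (- w)"] assms by simp
  also have "\<dots> \<le> N"
    unfolding N_def by (intro add_left_mono sum_mono2) auto
  finally have 0: "flow w 0 t \<le> N" using P0 by simp
  have "flow w 1 t * ?P 0 + flow w 0 t * ?P 1 = (\<Sum>x\<in>{0, 1}. flow w x t * ?P (1 - x))"
    by simp
  also have "\<dots> \<le> (\<Sum>x\<in>{w..1}. flow w x t * ?P (1 - x))"
    using assms by (intro sum_mono2) (auto simp: flow_nonneg)
  also have "\<dots> \<le> N"
    unfolding N_def using flux_le[OF assms(1), of w "nat (1 - w)"] assms by simp
  finally have 1: "flow w 1 t + flow w 0 t * (1 - pmf p 1) \<le> N" using P0 P1 by simp
  have "flow w 0 t + flow w 1 t = (flow w 1 t + flow w 0 t * (1 - pmf p 1)) + pmf p 1 * flow w 0 t"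
    by (simp add: algebra_simps)
  also have "\<dots> \<le> N + pmf p 1 * N"
    using 0 1 by (intro add_mono mult_left_mono) auto
  finally show ?thesis by (simp add: N_def algebra_simps)
qed

end

section \<open>Time averages of the service rate at two sites\<close>

context zero_range
begin

text \<open>
  The rate at which particles leave \<open>{0, 1}\<close>, the test function that detects the failure of
  convergence.
\<close>

definition service :: "(int \<Rightarrow> enat) \<Rightarrow> real" where
  "service \<eta> = \<alpha> 0 * g_ext g (\<eta> 0) + \<alpha> 1 * g_ext g (\<eta> 1)"

lemma g_ext_bounds: "0 \<le> g_ext g n" "g_ext g n \<le> 1"
  by (cases n; simp add: g_ext_def g_nonneg g_le_1)+

lemma service_bounds: "0 \<le> service \<eta>" "service \<eta> \<le> 2"
  using mult_le_one[OF \<alpha>_le_1[of 0] g_ext_bounds(1,2)[of "\<eta> 0"]] mult_le_one[OF \<alpha>_le_1[of 1]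
    g_ext_bounds(1,2)[of "\<eta> 1"]]
    \<alpha>_pos[of 0] \<alpha>_pos[of 1] g_ext_bounds(1)[of "\<eta> 0"] g_ext_bounds(1)[of "\<eta> 1"]
  by (simp_all add: service_def)

definition window_service :: "int \<Rightarrow> (int \<times> nat \<Rightarrow> real \<times> real \<times> int) \<Rightarrow> real \<Rightarrow> ennreal" where
  "window_service w X t = ennreal (\<alpha> 0 * g (queue w X 0 t)) + ennreal (\<alpha> 1 * g (queue w X 1 t))"

lemma service_term_measurable:
  "(\<lambda>v. ennreal (\<alpha> y * g (queue w (fst v) y (snd v)))) \<in> borel_measurable (canonical p \<Otimes>\<^sub>M borel)"
proof -
  have gq: "(\<lambda>v. g (queue w (fst v) y (snd v))) \<in> borel_measurable (canonical p \<Otimes>\<^sub>M borel)"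
    by (rule measurable_compose[OF queue_measurable]) simp
  show ?thesis
    by (rule measurable_compose[OF borel_measurable_times[OF borel_measurable_const gq]
      measurable_ennreal])
qed

lemma window_service_measurable:
  "(\<lambda>v. window_service w (fst v) (snd v)) \<in> borel_measurable (canonical p \<Otimes>\<^sub>M borel)"
  unfolding window_service_def by (intro borel_measurable_add service_term_measurable)

lemma time_integral_window_service:
  "(\<integral>\<^sup>+X. \<integral>\<^sup>+s. indicator {0..T} s * window_service w X s \<partial>lborel \<partial>canonical p) =
    outflow w 0 T + outflow w 1 T"
proof -
  have lborel_sets: "borel_measurable (canonical p \<Otimes>\<^sub>M lborel) = borel_measurable (canonical p \<Otimes>\<^sub>M
    borel)"
    by (intro measurable_cong_sets sets_pair_measure_cong) auto
  have ind: "(\<lambda>v. indicator {0..T} (snd v) :: ennreal) \<in> borel_measurable (canonical p \<Otimes>\<^sub>M borel)"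
    by measurable
  have H: "(\<lambda>v. indicator {0..T} (snd v) * ennreal (\<alpha> y * g (queue w (fst v) y (snd v))))
      \<in> borel_measurable (canonical p \<Otimes>\<^sub>M lborel)" for y
    unfolding lborel_sets by (intro borel_measurable_times_ennreal ind service_term_measurable)
  have Hs: "(\<lambda>s. indicator {0..T} s * ennreal (\<alpha> y * g (queue w X y s))) \<in> borel_measurable lborel"
    for X y
    using measurable_compose[OF measurable_Pair1'[of X "canonical p" lborel] H[of y]] by simp
  have HX: "(\<lambda>X. \<integral>\<^sup>+s. indicator {0..T} s * ennreal (\<alpha> y * g (queue w X y s)) \<partial>lborel)
      \<in> borel_measurable (canonical p)" for y
    by (rule lborel.borel_measurable_nn_integral) (simp only: split_beta' H)
  show ?thesis
    unfolding window_service_def outflow_def distrib_left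
    by (simp only: nn_integral_add[OF Hs Hs] nn_integral_add[OF HX HX])
qed

text \<open>
  Either no chain from outside hits the window, and the actual process agrees with the restricted
  one at the sites \<open>0\<close> and \<open>1\<close>, or there is at least one chain. In the latter case the bound \<open>2\<close>
  on the service is paid for by twice the number of chains.
\<close>

lemma service_le_window_service:
  assumes proc: "zero_range_process M \<alpha> g p E U Z (\<lambda>x. enat (\<zeta> x)) \<eta>"
    and empty: "\<And>x. L < x \<Longrightarrow> x < w \<Longrightarrow> \<zeta> x = 0" and "w \<le> 0" and t: "0 \<le> t" "t \<le> T"
  shows "(\<integral>\<^sup>+\<omega>. ennreal (service (\<eta> t \<omega>)) \<partial>M) \<le>
    (\<integral>\<^sup>+X. window_service w X t \<partial>canonical p) +
    2 * (\<Sum>y\<in>{w..1}. \<integral>\<^sup>+X. chains L X (Suc m) y T \<partial>canonical p)"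
proof -
  have sys: "harris_system M p E U Z"
    and evo: "AE \<omega> in M. harris_evolution \<alpha> g (\<lambda>x k. ring_time E x k \<omega>) (\<lambda>x k. U x k \<omega>)
        (\<lambda>x k. Z x k \<omega>) (\<lambda>x. enat (\<zeta> x)) (\<lambda>t. \<eta> t \<omega>)"
    using proc by (simp_all add: zero_range_process_def)
  note nm = noise_distr(1)[OF sys] and nd = noise_distr(2)[OF sys]
  have cm: "(\<lambda>X. chains L X m y T) \<in> borel_measurable (canonical p)" for m y
    using measurable_compose[OF measurable_Pair2'[of T borel "canonical p"] chains_measurable[of L m
      y]] by simp
  have wm: "(\<lambda>X. window_service w X t) \<in> borel_measurable (canonical p)"
    using measurable_compose[OF measurable_Pair2'[of t borel "canonical p"]
      window_service_measurable[of w]] by simp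
  define h where "h X = window_service w X t + 2 * (\<Sum>y\<in>{w..1}. chains L X (Suc m) y T)" for X
  have hm: "h \<in> borel_measurable (canonical p)"
    unfolding h_def by (intro borel_measurable_add wm borel_measurable_times_ennreal
      borel_measurable_const borel_measurable_sum cm)
  have "AE X in distr M (canonical p) (noise E U Z). regular X"
    using AE_regular by (simp only: nd)
  then have reg: "AE \<omega> in M. regular (noise E U Z \<omega>)"
    by (rule AE_distrD[OF nm])
  have "(\<integral>\<^sup>+\<omega>. ennreal (service (\<eta> t \<omega>)) \<partial>M) \<le> (\<integral>\<^sup>+\<omega>. h (noise E U Z \<omega>) \<partial>M)"
  proof (rule nn_integral_mono_AE)
    show "AE \<omega> in M. ennreal (service (\<eta> t \<omega>)) \<le> h (noise E U Z \<omega>)"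
      using evo reg
    proof eventually_elim
      case (elim \<omega>)
      define X where "X = noise E U Z \<omega>"
      have "ring X = (\<lambda>x k. ring_time E x k \<omega>)"
        by (simp add: X_def noise_def clock_def ring_time_def lessThan_Suc_atMost fun_eq_iff del:
          sum.lessThan_Suc)
      moreover have "(\<lambda>x k. fst (mark X x k)) = (\<lambda>x k. U x k \<omega>)" "(\<lambda>x k. snd (mark X x k)) = (\<lambda>x k.
        Z x k \<omega>)"
        by (simp_all add: X_def noise_def mark_def)
      ultimately have ev: "evolves \<alpha> g X \<zeta> (\<lambda>t. \<eta> t \<omega>)"
        using elim(1) by (simp only:)
      have rX: "regular X" using elim(2) by (simp add: X_def)
      show "ennreal (service (\<eta> t \<omega>)) \<le> h (noise E U Z \<omega>)"
        unfolding X_def[symmetric]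
      proof (cases "(\<Sum>y\<in>{w..1}. chains L X (Suc m) y T) < 1")
        case True
        have out: "\<not> fires \<alpha> g X (\<lambda>t. \<eta> t \<omega>) x k" if "ring X x k \<le> T" "x < w" "x + snd (mark X x k)
          \<in> {w..1}" for x k
          by (rule no_arrivals_from_outside[OF rX ev empty True that])
        have "\<eta> t \<omega> y = enat (queue w X y t)" if "y \<in> {w..1}" for y
          by (rule evolution_eq_queue[OF rX ev out that t])
        then have "\<eta> t \<omega> 0 = enat (queue w X 0 t)" "\<eta> t \<omega> 1 = enat (queue w X 1 t)"
          using \<open>w \<le> 0\<close> by simp_all
        then have "ennreal (service (\<eta> t \<omega>)) = window_service w X t"
          by (simp add: service_def window_service_def g_ext_def service_le_1)
        then show "ennreal (service (\<eta> t \<omega>)) \<le> h X" by (simp add: h_def)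
      next
        case False
        have "ennreal (service (\<eta> t \<omega>)) \<le> ennreal 2"
          by (intro ennreal_leI service_bounds)
        also have "\<dots> = 2 * 1" by simp
        also have "\<dots> \<le> 2 * (\<Sum>y\<in>{w..1}. chains L X (Suc m) y T)"
          using False by (intro mult_left_mono) (auto simp: not_less)
        also have "\<dots> \<le> h X" by (simp add: h_def)
        finally show "ennreal (service (\<eta> t \<omega>)) \<le> h X" .
      qed
    qed
  qed
  also have "\<dots> = (\<integral>\<^sup>+X. h X \<partial>canonical p)"
    using nn_integral_distr[OF nm, of h] hm by (simp only: nd)
  also have "\<dots> = (\<integral>\<^sup>+X. window_service w X t \<partial>canonical p) +
      2 * (\<Sum>y\<in>{w..1}. \<integral>\<^sup>+X. chains L X (Suc m) y T \<partial>canonical p)"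
    unfolding h_def
    by (simp only: nn_integral_add[OF wm borel_measurable_times_ennreal[OF borel_measurable_const
      borel_measurable_sum[OF cm]]]
        nn_integral_cmult[OF borel_measurable_sum[OF cm]] nn_integral_sum[OF cm])
  finally show ?thesis .
qed

text \<open>
  A lower bound \<open>v\<close> for the mean service from time \<open>t0\<close> on is confronted with the flux. Only the
  restricted process is integrated over time, so joint measurability of the given trajectory in
  time and \<open>\<omega>\<close> is not an issue.
\<close>

lemma time_average_service:
  assumes proc: "zero_range_process M \<alpha> g p E U Z (\<lambda>x. enat (\<zeta> x)) \<eta>"
    and empty: "\<And>x. L < x \<Longrightarrow> x < w \<Longrightarrow> \<zeta> x = 0" and w: "w \<le> 0"
    and few: "(\<Sum>y\<in>{w..1}. \<integral>\<^sup>+X. chains L X (Suc m) y T \<partial>canonical p) \<le> ennreal \<delta>" and \<delta>: "0 \<le> \<delta>"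
    and v: "\<And>t. t0 \<le> t \<Longrightarrow> ennreal v \<le> (\<integral>\<^sup>+\<omega>. ennreal (service (\<eta> t \<omega>)) \<partial>M)" "0 \<le> v"
    and t0: "0 \<le> t0" "t0 \<le> T"
  shows "v * (T - t0) \<le> (1 + pmf p 1) * (\<alpha> w * T + (\<Sum>x\<in>{w<..1}. real (\<zeta> x))) + 2 * \<delta> * T"
proof -
  interpret ca: prob_space "canonical p" by (rule prob_space_canonical)
  interpret pair_sigma_finite "canonical p" lborel ..
  have "0 \<le> T" using t0 by simp
  have lborel_sets: "borel_measurable (canonical p \<Otimes>\<^sub>M lborel) = borel_measurable (canonical p \<Otimes>\<^sub>M
    borel)"
    by (intro measurable_cong_sets sets_pair_measure_cong) auto
  have ind: "(\<lambda>v. indicator {0..T} (snd v) :: ennreal) \<in> borel_measurable (canonical p \<Otimes>\<^sub>M borel)"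
    by measurable
  have H: "(\<lambda>v. indicator {0..T} (snd v) * window_service w (fst v) (snd v)) \<in> borel_measurable
    (canonical p \<Otimes>\<^sub>M lborel)"
    unfolding lborel_sets by (intro borel_measurable_times_ennreal ind window_service_measurable)
  have W: "(\<lambda>s. \<integral>\<^sup>+X. indicator {0..T} s * window_service w X s \<partial>canonical p) \<in> borel_measurable lborel"
    by (rule ca.borel_measurable_nn_integral)
      (use measurable_pair_swap[OF H] in \<open>simp only: split_beta' fst_conv snd_conv\<close>)
  have "ennreal (v * (T - t0)) = (\<integral>\<^sup>+s. ennreal v * indicator {t0..T} s \<partial>lborel)"
    using v(2) t0 by (simp add: nn_integral_cmult_indicator ennreal_mult)
  also have "\<dots> \<le> (\<integral>\<^sup>+s. ((\<integral>\<^sup>+X. indicator {0..T} s * window_service w X s \<partial>canonical p) +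
      ennreal (2 * \<delta>) * indicator {0..T} s) \<partial>lborel)"
  proof (rule nn_integral_mono)
    fix s
    show "ennreal v * indicator {t0..T} s \<le> (\<integral>\<^sup>+X. indicator {0..T} s * window_service w X s
      \<partial>canonical p) +
      ennreal (2 * \<delta>) * indicator {0..T} s"
    proof (cases "s \<in> {t0..T}")
      case True
      have "ennreal v \<le> (\<integral>\<^sup>+\<omega>. ennreal (service (\<eta> s \<omega>)) \<partial>M)" using True by (intro v) simp
      also have "\<dots> \<le> (\<integral>\<^sup>+X. window_service w X s \<partial>canonical p) +
          2 * (\<Sum>y\<in>{w..1}. \<integral>\<^sup>+X. chains L X (Suc m) y T \<partial>canonical p)"
        using True t0 by (intro service_le_window_service[OF proc empty w]) auto
      also have "\<dots> \<le> (\<integral>\<^sup>+X. window_service w X s \<partial>canonical p) + 2 * ennreal \<delta>"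
        by (intro add_left_mono mult_left_mono few) simp
      finally show ?thesis using True t0 \<delta> by (simp add: ennreal_mult)
    qed simp
  qed
  also have "\<dots> = (\<integral>\<^sup>+s. \<integral>\<^sup>+X. indicator {0..T} s * window_service w X s \<partial>canonical p \<partial>lborel) +
      ennreal (2 * \<delta> * T)"
    using \<open>0 \<le> T\<close> \<delta> by (subst nn_integral_add[OF W]) (simp_all add: nn_integral_cmult_indicator
      ennreal_mult)
  also have "(\<integral>\<^sup>+s. \<integral>\<^sup>+X. indicator {0..T} s * window_service w X s \<partial>canonical p \<partial>lborel) =
      (\<integral>\<^sup>+X. \<integral>\<^sup>+s. indicator {0..T} s * window_service w X s \<partial>lborel \<partial>canonical p)"
    by (rule Fubini') (simp only: split_beta' H)
  also have "\<dots> = outflow w 0 T + outflow w 1 T"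
    by (rule time_integral_window_service)
  also have "\<dots> = ennreal (flow w 0 T + flow w 1 T)"
    using \<open>0 \<le> T\<close> by (simp add: ennreal_flow flow_nonneg)
  also have "\<dots> + ennreal (2 * \<delta> * T) \<le>
      ennreal ((1 + pmf p 1) * (\<alpha> w * T + (\<Sum>x\<in>{w<..1}. real (\<zeta> x)))) + ennreal (2 * \<delta> * T)"
    by (intro add_right_mono ennreal_leI flow_at_0_and_1_le \<open>0 \<le> T\<close> w)
  finally have "ennreal (v * (T - t0)) \<le>
      ennreal ((1 + pmf p 1) * (\<alpha> w * T + (\<Sum>x\<in>{w<..1}. real (\<zeta> x))) + 2 * \<delta> * T)"
    using \<open>0 \<le> T\<close> \<delta> \<alpha>_pos[of w] by (subst ennreal_plus) (auto intro!: mult_nonneg_nonneg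
      add_nonneg_nonneg sum_nonneg)
  then show ?thesis
    using \<open>0 \<le> T\<close> \<delta> \<alpha>_pos[of w]
    by (subst (asm) ennreal_le_iff) (auto intro!: mult_nonneg_nonneg add_nonneg_nonneg sum_nonneg)
qed

end

section \<open>The service rate under the critical product measure\<close>

lemma open_singleton_enat: "open {enat n}"
proof -
  have "{enat n} = (if n = 0 then {..<enat 1} else {enat (n - 1)<..<enat (n + 1)})"
  proof (intro set_eqI)
    fix x show "x \<in> {enat n} \<longleftrightarrow> x \<in> (if n = 0 then {..<enat 1} else {enat (n - 1)<..<enat (n + 1)})"
      by (cases x) auto
  qed
  then show ?thesis by (cases "n = 0") (simp_all)
qed

text \<open>
  Finite values are isolated points of \<^typ>\<open>enat\<close>; at \<open>\<infinity>\<close> continuity is the convergence of \<open>g\<close> to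
  \<open>1 = g_ext g \<infinity>\<close>.
\<close>

lemma continuous_on_g_ext:
  assumes "g \<longlonglongrightarrow> 1"
  shows "continuous_on UNIV (g_ext g)"
  unfolding continuous_on_open_vimage[OF open_UNIV]
proof (intro allI impI)
  fix B :: "real set" assume B: "open B"
  show "open (g_ext g -` B \<inter> UNIV)"
  proof (subst open_subopen, intro ballI)
    fix x assume x: "x \<in> g_ext g -` B \<inter> UNIV"
    show "\<exists>T. open T \<and> x \<in> T \<and> T \<subseteq> g_ext g -` B \<inter> UNIV"
    proof (cases x)
      case (enat n)
      then show ?thesis using x open_singleton_enat[of n] by (intro exI[of _ "{enat n}"]) auto
    next
      case infinity
      then have "1 \<in> B" using x by (simp add: g_ext_def)
      then have "eventually (\<lambda>n. g n \<in> B) sequentially"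
        using assms B by (auto dest: topological_tendstoD)
      then obtain N where N: "\<And>n. N \<le> n \<Longrightarrow> g n \<in> B" by (auto simp: eventually_sequentially)
      have "{enat N<..} \<subseteq> g_ext g -` B \<inter> UNIV"
      proof
        fix y assume "y \<in> {enat N<..}"
        then show "y \<in> g_ext g -` B \<inter> UNIV"
          using N \<open>1 \<in> B\<close> by (cases y) (auto simp: g_ext_def)
      qed
      then show ?thesis using infinity by (intro exI[of _ "{enat N<..}"]) auto
    qed
  qed
qed

locale rate_function =
  fixes g :: "nat \<Rightarrow> real"
  assumes mono: "mono g" and zero: "g 0 = 0" and pos: "0 < g 1" and lim: "g \<longlonglongrightarrow> 1"
begin

lemma rate_pos: "0 < n \<Longrightarrow> 0 < g n"
  using monoD[OF mono, of 1 n] pos by simp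

lemma rate_le_1: "g n \<le> 1"
  by (rule incseq_le[OF mono lim])

lemma g_fact_pos: "0 < g_fact g n"
  unfolding g_fact_def by (intro prod_pos) (auto intro: rate_pos)

lemma weight_Suc: "l ^ Suc n / g_fact g (Suc n) * g (Suc n) = l * (l ^ n / g_fact g n)"
  using rate_pos[of "Suc n"] by (simp add: g_fact_def)

lemma summable_weights:
  assumes "0 < l" "l < 1"
  shows "summable (\<lambda>n. l ^ n / g_fact g n)"
proof -
  define r where "r = (1 + l) / 2"
  have r: "l < r" "r < 1" "0 < r" using assms by (auto simp: r_def)
  have "eventually (\<lambda>n. r < g n) sequentially"
    using lim r by (intro order_tendstoD)
  then obtain N where N: "\<And>n. N \<le> n \<Longrightarrow> r < g n" by (auto simp: eventually_sequentially)
  show ?thesis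
  proof (rule summable_ratio_test)
    show "l / r < 1" using r by simp
    fix n assume n: "N \<le> n"
    have "l ^ Suc n / g_fact g (Suc n) = l / g (Suc n) * (l ^ n / g_fact g n)"
      by (simp add: g_fact_def)
    also have "\<dots> \<le> l / r * (l ^ n / g_fact g n)"
      using N[of "Suc n"] n r assms g_fact_pos[of n] by (intro mult_right_mono divide_left_mono) auto
    finally show "norm (l ^ Suc n / g_fact g (Suc n)) \<le> l / r * norm (l ^ n / g_fact g n)"
      using assms g_fact_pos[of n] g_fact_pos[of "Suc n"] by simp
  qed
qed

text \<open>
  The weights \<open>a\<^sub>n = l\<^sup>n / g(n)!\<close> satisfy \<open>a\<^sub>n\<^sub>+\<^sub>1 g(n + 1) = l a\<^sub>n\<close>, and \<open>g(0) = 0\<close>. Summation gives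
  the mean rate \<open>l\<close>.
\<close>

lemma nn_integral_rate_theta:
  assumes "0 < l" "l < 1"
  shows "(\<integral>\<^sup>+n. ennreal (g n) \<partial>measure_pmf (theta g l)) = ennreal l"
proof -
  define a where "a n = l ^ n / g_fact g n" for n
  have a: "0 < a n" for n using assms g_fact_pos[of n] by (simp add: a_def)
  have sum: "summable a" using summable_weights[OF assms] by (simp add: a_def[abs_def])
  define Z where "Z = Z_fun g l"
  have Z_sums: "a sums Z" using sum by (simp add: Z_def Z_fun_def a_def[abs_def] summable_sums)
  have Z: "0 < Z" unfolding sums_unique[OF Z_sums] using sum a by (intro suminf_pos)
  have norm: "(\<lambda>n. a n / Z) sums 1" using sums_divide[OF Z_sums, of Z] Z by simp
  have "(\<Sum>n. ennreal (a n / Z)) = ennreal 1"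
    by (rule suminf_ennreal_eq[OF _ norm]) (use a Z in \<open>simp add: less_imp_le\<close>)
  then have "(\<integral>\<^sup>+n. ennreal (a n / Z) \<partial>count_space UNIV) = 1"
    by (simp add: nn_integral_count_space_nat)
  moreover have "theta g l = embed_pmf (\<lambda>n. a n / Z)" by (simp add: theta_def a_def Z_def)
  ultimately have pmf: "pmf (theta g l) n = a n / Z" for n
    using a Z by (simp add: pmf_embed_pmf less_imp_le)
  have "(\<lambda>n. a (Suc n) / Z * g (Suc n)) = (\<lambda>n. l * (a n / Z))"
  proof
    fix n
    have "a (Suc n) * g (Suc n) = l * a n" unfolding a_def by (rule weight_Suc)
    then show "a (Suc n) / Z * g (Suc n) = l * (a n / Z)" by simp
  qed
  then have "(\<lambda>n. a (Suc n) / Z * g (Suc n)) sums l"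
    using sums_mult[OF norm, of l] by simp
  then have sums: "(\<lambda>n. a n / Z * g n) sums l"
    by (subst (asm) sums_Suc_iff) (simp add: zero)
  have g_nonneg: "0 \<le> g n" for n using monoD[OF mono, of 0 n] by (simp add: zero)
  have "(\<integral>\<^sup>+n. ennreal (g n) \<partial>measure_pmf (theta g l)) = (\<Sum>n. ennreal (a n / Z * g n))"
    by (simp add: nn_integral_measure_pmf nn_integral_count_space_nat pmf ennreal_mult[symmetric] a
      Z less_imp_le g_nonneg)
  also have "\<dots> = ennreal l"
    using sums a Z g_nonneg by (intro suminf_ennreal_eq) (auto simp: less_imp_le)
  finally show ?thesis .
qed

lemma mean_rate_mu:
  assumes "0 < c" "c < \<alpha> y"
  shows "(\<integral>\<eta>. g_ext g (\<eta> y) \<partial>mu g \<alpha> c) = c / \<alpha> y"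
proof -
  have l: "0 < c / \<alpha> y" "c / \<alpha> y < 1" using assms by auto
  have g_nonneg: "0 \<le> g n" for n using monoD[OF mono, of 0 n] by (simp add: zero)
  let ?M = "\<lambda>x. distr (measure_pmf (theta g (c / \<alpha> x))) borel enat"
  have meas: "g_ext g \<in> borel_measurable borel"
    by (intro borel_measurable_continuous_onI continuous_on_g_ext lim)
  have M: "prob_space (?M x)" for x
    by (intro measure_pmf.prob_space_distr) simp
  have "(\<integral>\<eta>. g_ext g (\<eta> y) \<partial>mu g \<alpha> c) = (\<integral>n. g_ext g n \<partial>distr (mu g \<alpha> c) (?M y) (\<lambda>\<eta>. \<eta> y))"
    unfolding mu_def by (intro integral_distr[symmetric]) (use meas in auto)
  also have "distr (mu g \<alpha> c) (?M y) (\<lambda>\<eta>. \<eta> y) = ?M y"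
    unfolding mu_def by (rule distr_PiM_component) (auto intro: M)
  also have "(\<integral>n. g_ext g n \<partial>?M y) = (\<integral>n. g n \<partial>measure_pmf (theta g (c / \<alpha> y)))"
    using meas by (subst integral_distr) (simp_all add: g_ext_def)
  also have "\<dots> = c / \<alpha> y"
    using nn_integral_rate_theta[OF l] l g_nonneg by (simp add: integral_eq_nn_integral)
  finally show ?thesis .
qed

end

lemma (in zero_range) service_under_mu:
  assumes "0 < c" "\<And>x. c < \<alpha> x" "0 < g 1" "g \<longlonglongrightarrow> 1"
  shows "(\<integral>\<eta>. service \<eta> \<partial>mu g \<alpha> c) = 2 * c"
proof -
  interpret rate_function g by unfold_locales (use assms g_mono g_0 in auto)
  interpret mu: prob_space "mu g \<alpha> c"
    unfolding mu_def by (intro prob_space_PiM measure_pmf.prob_space_distr) simp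
  have meas: "g_ext g \<in> borel_measurable borel"
    by (intro borel_measurable_continuous_onI continuous_on_g_ext assms)
  have int: "integrable (mu g \<alpha> c) (\<lambda>\<eta>. g_ext g (\<eta> y))" for y
  proof (rule mu.integrable_const_bound[where B = 1])
    have "(\<lambda>\<eta>. \<eta> y) \<in> mu g \<alpha> c \<rightarrow>\<^sub>M borel"
      unfolding mu_def by (rule measurable_compose[OF measurable_component_singleton]) auto
    from measurable_compose[OF this meas]
    show "(\<lambda>\<eta>. g_ext g (\<eta> y)) \<in> borel_measurable (mu g \<alpha> c)" .
  qed (use g_ext_bounds in auto)
  have "(\<integral>\<eta>. service \<eta> \<partial>mu g \<alpha> c) = \<alpha> 0 * (c / \<alpha> 0) + \<alpha> 1 * (c / \<alpha> 1)"
    unfolding service_def using int by (simp add: mean_rate_mu assms)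
  then show ?thesis using \<alpha>_pos[of 0] \<alpha>_pos[of 1] by simp
qed

lemma (in zero_range) continuous_on_service:
  assumes "g \<longlonglongrightarrow> 1" shows "continuous_on UNIV service"
proof -
  have "continuous_on UNIV (\<lambda>\<eta>. g_ext g (\<eta> y))" for y :: int
    by (rule continuous_on_compose2[OF continuous_on_g_ext[OF assms]])
      (auto intro: continuous_on_product_coordinates)
  then show ?thesis unfolding service_def[abs_def] by (intro continuous_intros)
qed

lemma (in zero_range) expected_service_tendsto:
  assumes proc: "zero_range_process M \<alpha> g p E U Z \<zeta>' \<eta>"
    and conv: "converges_in_distribution M \<eta> (mu g \<alpha> c)"
    and c: "0 < c" "\<And>x. c < \<alpha> x" and g: "0 < g 1" "g \<longlonglongrightarrow> 1" and v: "v < 2 * c"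
  obtains t0 where "0 \<le> t0" "\<And>t. t0 \<le> t \<Longrightarrow> ennreal v \<le> (\<integral>\<^sup>+\<omega>. ennreal (service (\<eta> t \<omega>)) \<partial>M)"
proof -
  interpret prob_space M using proc by (simp add: zero_range_process_def harris_system_def)
  have cont: "continuous_on UNIV service" by (rule continuous_on_service[OF g(2)])
  have meas: "service \<in> borel_measurable borel" by (rule borel_measurable_continuous_onI[OF cont])
  have "bounded (range service)"
    using service_bounds by (intro boundedI[of _ 2]) auto
  then have "((\<lambda>t. integral\<^sup>L (distr M borel (\<eta> t)) service) \<longlongrightarrow> 2 * c) at_top"
    using conv cont service_under_mu[OF c g] unfolding converges_in_distribution_def by metis
  then have "eventually (\<lambda>t. v < integral\<^sup>L (distr M borel (\<eta> t)) service) at_top"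
    using v by (rule order_tendstoD)
  then obtain t1 where t1: "\<And>t. t1 \<le> t \<Longrightarrow> v < integral\<^sup>L (distr M borel (\<eta> t)) service"
    by (auto simp: eventually_at_top_linorder)
  have "ennreal v \<le> (\<integral>\<^sup>+\<omega>. ennreal (service (\<eta> t \<omega>)) \<partial>M)" if t: "max 0 t1 \<le> t" for t
  proof -
    have \<eta>: "\<eta> t \<in> M \<rightarrow>\<^sub>M borel" using proc t by (simp add: zero_range_process_def)
    have "integrable M (\<lambda>\<omega>. service (\<eta> t \<omega>))"
      by (rule integrable_const_bound[where B = 2])
        (use service_bounds measurable_compose[OF \<eta> meas] in auto)
    then have "(\<integral>\<^sup>+\<omega>. ennreal (service (\<eta> t \<omega>)) \<partial>M) = ennreal (\<integral>\<omega>. service (\<eta> t \<omega>) \<partial>M)"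
      by (intro nn_integral_eq_integral) (auto simp: service_bounds)
    also have "(\<integral>\<omega>. service (\<eta> t \<omega>) \<partial>M) = integral\<^sup>L (distr M borel (\<eta> t)) service"
      by (rule integral_distr[OF \<eta> meas, symmetric])
    finally show ?thesis using t1[of t] t by (simp add: ennreal_leI)
  qed
  then show ?thesis by (intro that[of "max 0 t1"]) auto
qed

section \<open>Sparse stacks\<close>

text \<open>
  The number \<open>m\<close> of steps is chosen first, to make the factorial term small, and then the
  distance \<open>n\<close>.
\<close>

lemma walk_tail_sum_small:
  assumes "0 \<le> T" "0 < \<delta>"
  shows "\<exists>m n0. \<forall>n\<ge>n0. (\<Sum>y\<in>{w..b}. ennreal (T ^ Suc m / fact (Suc m)) +
    ennreal (exp T) * walk_tail p (Suc m) (y + int n)) < ennreal \<delta>"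
proof -
  have "(\<lambda>m. real (card {w..b}) * (T ^ Suc m / fact (Suc m))) \<longlonglongrightarrow> real (card {w..b}) * 0"
    using summable_LIMSEQ_zero[OF summable_exp[of T]]
    by (intro tendsto_mult tendsto_const LIMSEQ_Suc) (simp add: divide_inverse mult.commute)
  then have "eventually (\<lambda>m. real (card {w..b}) * (T ^ Suc m / fact (Suc m)) < \<delta>) sequentially"
    using assms by (intro order_tendstoD(2)) auto
  then obtain m where m: "real (card {w..b}) * (T ^ Suc m / fact (Suc m)) < \<delta>"
    by (auto simp: eventually_sequentially)
  have "(\<lambda>n. \<Sum>y\<in>{w..b}. ennreal (T ^ Suc m / fact (Suc m)) + ennreal (exp T) * walk_tail p (Suc m)
    (y + int n))
      \<longlonglongrightarrow> (\<Sum>y\<in>{w..b}. ennreal (T ^ Suc m / fact (Suc m)) + ennreal (exp T) * 0)"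
    by (intro tendsto_sum tendsto_add tendsto_const tendsto_mult_ennreal walk_tail_tendsto_0) auto
  moreover have "(\<Sum>y\<in>{w..b}. ennreal (T ^ Suc m / fact (Suc m)) + ennreal (exp T) * 0) =
      ennreal (real (card {w..b}) * (T ^ Suc m / fact (Suc m)))"
  proof -
    have "of_nat n * ennreal a = ennreal (real n * a)" if "0 \<le> a" for n and a :: real
      using that by (simp add: ennreal_mult ennreal_of_nat_eq_real_of_nat)
    from this[of "T ^ Suc m / fact (Suc m)" "card {w..b}"] assms show ?thesis
      by (simp only: sum_constant mult_zero_right add_0_right) simp
  qed
  ultimately have "eventually (\<lambda>n. (\<Sum>y\<in>{w..b}. ennreal (T ^ Suc m / fact (Suc m)) +
      ennreal (exp T) * walk_tail p (Suc m) (y + int n)) < ennreal \<delta>) sequentially"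
    using m assms by (intro order_tendstoD(2)) (auto intro!: ennreal_lessI)
  then show ?thesis unfolding eventually_sequentially by blast
qed

text \<open>
  The time \<open>T\<^sub>k\<close> at which the stack at \<open>x = w\<^sub>k\<close> is observed. There are \<open>k\<close> stacks to the right of
  \<open>w\<^sub>k\<close>, each of height at most \<open>(k + 1) |w\<^sub>k|\<close>, so the cube makes their total mass at most
  \<open>T\<^sub>k / (k + 1)\<close>.
\<close>

definition horizon :: "nat \<Rightarrow> int \<Rightarrow> real" where
  "horizon k x = real (Suc k) ^ 3 * real_of_int (- x)"

text \<open>
  By \<open>chains_expectation_le\<close>, this condition bounds the mean number of chains that end in the
  window \<open>[x, 1]\<close> before the horizon; a particle that comes from a site \<open>\<le> y\<close> produces such a
  chain.
\<close>

definition far_below :: "int pmf \<Rightarrow> nat \<Rightarrow> int \<Rightarrow> int \<Rightarrow> bool" where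
  "far_below p k x y \<longleftrightarrow> (\<exists>m. (\<Sum>z\<in>{x..1}. ennreal (horizon k x ^ Suc m / fact (Suc m)) +
     ennreal (exp (horizon k x)) * walk_tail p (Suc m) (z - y)) \<le> ennreal (1 / real (Suc k)))"

lemma slow_sites_unbounded:
  fixes \<alpha> :: "int \<Rightarrow> real"
  assumes "Liminf at_bot (\<lambda>x. ereal (\<alpha> x)) = ereal c" "0 < \<epsilon>"
  shows "\<exists>x\<le>b. \<alpha> x \<le> c + \<epsilon>"
proof (rule ccontr)
  assume "\<not> ?thesis"
  then have "\<And>x. x \<le> b \<Longrightarrow> c + \<epsilon> \<le> \<alpha> x" by (meson not_le less_imp_le)
  then have "eventually (\<lambda>x. ereal (c + \<epsilon>) \<le> ereal (\<alpha> x)) at_bot"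
    by (auto simp: eventually_at_bot_linorder intro!: exI[of _ b])
  then have "ereal (c + \<epsilon>) \<le> Liminf at_bot (\<lambda>x. ereal (\<alpha> x))" by (rule Liminf_bounded)
  with assms show False by simp
qed

lemma stack_positions:
  fixes \<alpha> :: "int \<Rightarrow> real"
  assumes "Liminf at_bot (\<lambda>x. ereal (\<alpha> x)) = ereal c"
  obtains w :: "nat \<Rightarrow> int" where "\<And>k. w k \<le> - 1" "\<And>k. \<alpha> (w k) \<le> c + 1 / real (Suc k)"
    "\<And>k. w (Suc k) < w k" "\<And>k. far_below p k (w k) (w (Suc k))"
proof -
  have "\<exists>w. \<forall>k. (w k \<le> - 1 \<and> \<alpha> (w k) \<le> c + 1 / real (Suc k)) \<and>
      (w (Suc k) < w k \<and> far_below p k (w k) (w (Suc k)))"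
  proof (rule dependent_nat_choice)
    show "\<exists>x. x \<le> - 1 \<and> \<alpha> x \<le> c + 1 / real (Suc 0)"
      using slow_sites_unbounded[OF assms, of 1 "- 1"] by auto
  next
    fix x :: int and k assume x: "x \<le> - 1 \<and> \<alpha> x \<le> c + 1 / real (Suc k)"
    have "0 \<le> horizon k x" unfolding horizon_def using x by (intro mult_nonneg_nonneg) auto
    then obtain m n0 where n0: "\<And>n. n0 \<le> n \<Longrightarrow>
      (\<Sum>z\<in>{x..1}. ennreal (horizon k x ^ Suc m / fact (Suc m)) + ennreal (exp (horizon k x)) *
        walk_tail p (Suc m) (z + int n)) < ennreal (1 / real (Suc k))"
      using walk_tail_sum_small[where T = "horizon k x" and \<delta> = "1 / real (Suc k)" and w = x and b =
        1 and p = p,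
          OF _ divide_pos_pos[OF zero_less_one]] of_nat_0_less_iff[of "Suc k"]
      by blast
    obtain y where y: "y \<le> min (x - 1) (- int n0)" "\<alpha> y \<le> c + 1 / real (Suc (Suc k))"
      using slow_sites_unbounded[OF assms, of "1 / real (Suc (Suc k))" "min (x - 1) (- int n0)"] by auto
    have "n0 \<le> nat (- y)" "int (nat (- y)) = - y" using y by auto
    then have "far_below p k x y"
      unfolding far_below_def using n0[of "nat (- y)"]
      by (intro exI[of _ m] less_imp_le) (simp only: add_uminus_conv_diff)
    then show "\<exists>y. (y \<le> - 1 \<and> \<alpha> y \<le> c + 1 / real (Suc (Suc k))) \<and> (y < x \<and> far_below p k x y)"
      using x y by (intro exI[of _ y]) auto
  qed
  then show ?thesis using that by blast
qed

text \<open>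
  A stack has to make up for all empty sites up to the next stack at \<open>w (k + 1)\<close>; the factor
  \<open>k + 1\<close> lets the density diverge.
\<close>

definition stacks :: "(nat \<Rightarrow> int) \<Rightarrow> int \<Rightarrow> nat" where
  "stacks w x = (if x \<in> range w then Suc (inv w x) * nat (- w (Suc (inv w x))) else 0)"

context
  fixes w :: "nat \<Rightarrow> int"
  assumes w_neg: "\<And>k. w k \<le> - 1" and w_dec: "\<And>k. w (Suc k) < w k"
begin

lemma w_less_iff: "w j < w i \<longleftrightarrow> i < j"
proof -
  have "strict_mono (\<lambda>k. - w k)" using w_dec by (simp add: strict_mono_Suc_iff)
  from strict_mono_less[OF this, of i j] show ?thesis by simp
qed

lemma inj_w: "inj w"
  by (rule injI) (metis w_less_iff less_irrefl linorder_neqE_nat)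

lemma stacks_at: "stacks w (w k) = Suc k * nat (- w (Suc k))"
  by (simp add: stacks_def inj_w)

lemma stacks_between:
  assumes "w (Suc k) < x" "x < w k" shows "stacks w x = 0"
proof -
  have "x \<notin> range w"
  proof
    assume "x \<in> range w"
    then obtain j where "x = w j" by auto
    with assms have "j < Suc k" "k < j" by (simp_all add: w_less_iff)
    then show False by simp
  qed
  then show ?thesis by (simp add: stacks_def)
qed

lemma stacks_right:
  "real (Suc k) * (\<Sum>x\<in>{w k<..1}. real (stacks w x)) \<le> horizon k (w k)"
proof -
  have "(\<Sum>x\<in>{w k<..1}. real (stacks w x)) = (\<Sum>x\<in>{w k<..1} \<inter> w ` {..<k}. real (stacks w x))"
  proof (rule sum.mono_neutral_right)
    show "\<forall>x\<in>{w k<..1} - {w k<..1} \<inter> w ` {..<k}. real (stacks w x) = 0"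
      by (auto simp: stacks_def w_less_iff)
  qed auto
  also have "\<dots> \<le> (\<Sum>x\<in>w ` {..<k}. real (stacks w x))"
    by (intro sum_mono2) auto
  also have "\<dots> = (\<Sum>j<k. real (stacks w (w j)))"
    by (subst sum.reindex) (auto intro: inj_on_subset[OF inj_w])
  also have "\<dots> \<le> (\<Sum>j<k. real (Suc k) * real_of_int (- w k))"
  proof (rule sum_mono)
    fix j assume j: "j \<in> {..<k}"
    have "w k \<le> w (Suc j)"
      using j w_less_iff[of k "Suc j"] by (cases "Suc j = k") auto
    then show "real (stacks w (w j)) \<le> real (Suc k) * real_of_int (- w k)"
      using j w_neg[of k] w_neg[of "Suc j"] unfolding stacks_at of_nat_mult
      by (intro mult_mono) auto
  qed
  also have "\<dots> \<le> real (Suc k) * (real (Suc k) * real_of_int (- w k))"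
    using w_neg[of k] by (simp add: mult_right_mono)
  finally have "(\<Sum>x\<in>{w k<..1}. real (stacks w x)) \<le> real (Suc k) * (real (Suc k) * real_of_int (- w
    k))" .
  then show ?thesis
    unfolding horizon_def power3_eq_cube mult.assoc by (rule mult_left_mono) simp
qed

text \<open>
  If \<open>w k\<close> is the last stack in \<open>[-n, -1]\<close>, then \<open>n < |w (k + 1)|\<close>, so that this stack alone
  gives a density of at least \<open>k + 1\<close>.
\<close>

lemma stacks_density:
  "liminf (\<lambda>n. ereal ((\<Sum>x=-int n..-1. real (stacks w x)) / real n)) = \<infinity>"
proof -
  have w_le: "w k \<le> - int (Suc k)" for k
  proof (induction k)
    case (Suc k)
    then show ?case using w_dec[of k] by simp
  qed (use w_neg[of 0] in simp)
  have "((\<lambda>n. ereal ((\<Sum>x=-int n..-1. real (stacks w x)) / real n)) \<longlongrightarrow> \<infinity>) sequentially"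
    unfolding tendsto_PInfty
  proof
    fix r :: real
    obtain K :: nat where K: "r < real K" using reals_Archimedean2 by blast
    show "eventually (\<lambda>n. ereal r < ereal ((\<Sum>x=-int n..-1. real (stacks w x)) / real n)) sequentially"
      unfolding eventually_sequentially
    proof (intro exI[of _ "nat (- w K)"] allI impI)
      fix n assume n: "nat (- w K) \<le> n"
      define k where "k = (GREATEST k. - int n \<le> w k)"
      have bound: "j \<le> n" if "- int n \<le> w j" for j
        using that w_le[of j] by simp
      have K': "- int n \<le> w K" using n by simp
      have k: "- int n \<le> w k" "K \<le> k"
        unfolding k_def using GreatestI_nat[of "\<lambda>k. - int n \<le> w k" K n] Greatest_le_nat[of "\<lambda>k. -
          int n \<le> w k" K n] K' bound
        by auto
      have "\<not> - int n \<le> w (Suc k)"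
        using Greatest_le_nat[of "\<lambda>k. - int n \<le> w k" "Suc k" n] bound unfolding k_def[symmetric] by auto
      then have n_le: "real n \<le> real_of_int (- w (Suc k))" by linarith
      have "0 < n" using n w_neg[of K] by simp
      have "r * real n \<le> real K * real n" using K by (intro mult_right_mono) auto
      also have "\<dots> < real (Suc k) * real n" using k \<open>0 < n\<close> by (intro mult_strict_right_mono) auto
      also have "\<dots> \<le> real (Suc k) * real_of_int (- w (Suc k))" using n_le by (intro mult_left_mono) auto
      also have "\<dots> = real (stacks w (w k))"
        unfolding stacks_at of_nat_mult using w_neg[of "Suc k"] by simp
      also have "\<dots> \<le> (\<Sum>x=-int n..-1. real (stacks w x))"
        using k w_neg[of k] by (intro member_le_sum) auto
      finally show "ereal r < ereal ((\<Sum>x=-int n..-1. real (stacks w x)) / real n)"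
        using \<open>0 < n\<close> by (simp add: field_simps)
    qed
  qed
  then show ?thesis by (intro lim_imp_Liminf) auto
qed

end

section \<open>Failure of convergence\<close>

theorem theorem2p3:
  fixes c :: real and \<alpha> :: "int \<Rightarrow> real" and g :: "nat \<Rightarrow> real" and p :: "int pmf"
  assumes c: "0 < c" "c < 1"
    and env: "\<And>x. c < \<alpha> x" "\<And>x. \<alpha> x \<le> 1"
    and g: "mono g" "g 0 = 0" "0 < g 1" "g \<longlonglongrightarrow> 1"
    and liminf_env: "Liminf at_bot (\<lambda>x. ereal (\<alpha> x)) = ereal c"
    and avg: "\<And>l. 0 \<le> l \<Longrightarrow> l < c \<Longrightarrow> convergent (R_avg g \<alpha> l)"
    and tot_asym: "\<And>z. z \<le> 0 \<Longrightarrow> pmf p z = 0"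
    and p1: "pmf p 1 < 1"
  shows "\<exists>\<eta>\<^sub>0 :: int \<Rightarrow> nat.
    liminf (\<lambda>n. ereal ((\<Sum>x=-int n..-1. real (\<eta>\<^sub>0 x)) / real n)) \<ge> rho_c c g \<alpha> \<and>
    (\<forall>(M :: 'w measure) E U Z \<eta>.
       zero_range_process M \<alpha> g p E U Z (\<lambda>x. enat (\<eta>\<^sub>0 x)) \<eta> \<longrightarrow>
       \<not> converges_in_distribution M \<eta> (mu g \<alpha> c))"
proof -
  obtain w :: "nat \<Rightarrow> int" where w: "\<And>k. w k \<le> - 1" "\<And>k. \<alpha> (w k) \<le> c + 1 / real (Suc k)"
    "\<And>k. w (Suc k) < w k" "\<And>k. far_below p k (w k) (w (Suc k))"
    using stack_positions[OF liminf_env, of p] by blast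
  interpret rate_function g by unfold_locales (use g in auto)
  interpret zero_range \<alpha> g p "stacks w"
  proof
    show "0 < \<alpha> x" for x using c env(1)[of x] by simp
  qed (use env g tot_asym rate_le_1 in auto)
  have False
    if proc: "zero_range_process M \<alpha> g p E U Z (\<lambda>x. enat (stacks w x)) \<eta>"
      and conv: "converges_in_distribution M \<eta> (mu g \<alpha> c)" for M :: "'w measure" and E U Z \<eta>
  proof -
    \<comment> \<open>any number strictly between the flux bound \<open>(1 + p(1)) c\<close> and the equilibrium value \<open>2 c\<close>\<close>
    define v where "v = ((1 + pmf p 1) * c + 2 * c) / 2"
    have "(1 + pmf p 1) * c < 2 * c" using p1 c by (intro mult_strict_right_mono) auto
    then have v: "(1 + pmf p 1) * c < v" "v < 2 * c" "0 \<le> v"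
      using c by (auto simp: v_def)
    obtain t0 where t0: "0 \<le> t0" "\<And>t. t0 \<le> t \<Longrightarrow> ennreal v \<le> (\<integral>\<^sup>+\<omega>. ennreal (service (\<eta> t \<omega>)) \<partial>M)"
      using expected_service_tendsto[OF proc conv c(1) env(1) g(3,4) v(2)] by blast
    define r where "r k = 1 / real (Suc k)" for k
    have bound: "v \<le> (1 + pmf p 1) * (c + 2 * r k) + 2 * r k + v * t0 * r k" if k: "t0 \<le> real k" for k
    proof -
      define T where "T = horizon k (w k)"
      \<comment> \<open>the horizon tends to infinity, so that the initial period \<open>[0, t0]\<close> is negligible\<close>
      have "real (Suc k) * 1 \<le> real (Suc k) ^ 3 * real_of_int (- w k)"
        using w(1)[of k] self_le_power[of "real (Suc k)" 3] by (intro mult_mono) auto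
      then have T: "real (Suc k) \<le> T" by (simp add: T_def horizon_def)
      then have "t0 \<le> T" "0 < T" using k t0(1) by auto
      obtain m where m: "(\<Sum>z\<in>{w k..1}. ennreal (T ^ Suc m / fact (Suc m)) +
          ennreal (exp T) * walk_tail p (Suc m) (z - w (Suc k))) \<le> ennreal (r k)"
        using w(4)[of k] unfolding far_below_def T_def r_def by blast
      have "(\<Sum>y\<in>{w k..1}. \<integral>\<^sup>+X. chains (w (Suc k)) X (Suc m) y T \<partial>canonical p) \<le>
          (\<Sum>z\<in>{w k..1}. ennreal (T ^ Suc m / fact (Suc m)) +
            ennreal (exp T) * walk_tail p (Suc m) (z - w (Suc k)))"
        using \<open>0 < T\<close> by (intro sum_mono chains_expectation_le tot_asym) auto
      also note m
      finally have "v * (T - t0) \<le> (1 + pmf p 1) * (\<alpha> (w k) * T + (\<Sum>x\<in>{w k<..1}. real (stacks w x))) + 2 * r k * T"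
        using w(1)[of k] t0 v(3) \<open>t0 \<le> T\<close>
        by (intro time_average_service[OF proc stacks_between[where w = w, OF w(1) w(3)]]) (auto simp: r_def)
      also have "\<dots> \<le> (1 + pmf p 1) * ((c + r k) * T + r k * T) + 2 * r k * T"
      proof (intro add_right_mono mult_left_mono add_mono)
        show "\<alpha> (w k) * T \<le> (c + r k) * T"
          using w(2)[of k] \<open>0 < T\<close> by (intro mult_right_mono) (auto simp: r_def)
        show "(\<Sum>x\<in>{w k<..1}. real (stacks w x)) \<le> r k * T"
          using stacks_right[where w = w and k = k, OF w(1) w(3)] by (simp add: r_def T_def field_simps)
      qed simp
      finally have "v * T \<le> ((1 + pmf p 1) * (c + 2 * r k) + 2 * r k) * T + v * t0"
        by (simp add: algebra_simps)
      also have "v * t0 \<le> v * t0 * r k * T"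
        using mult_left_mono[of 1 "r k * T" "v * t0"] T v(3) t0(1) by (simp add: r_def field_simps)
      finally have "v * T \<le> ((1 + pmf p 1) * (c + 2 * r k) + 2 * r k + v * t0 * r k) * T"
        by (simp add: algebra_simps)
      with \<open>0 < T\<close> show ?thesis by simp
    qed
    have r0: "r \<longlonglongrightarrow> 0"
      unfolding r_def using LIMSEQ_inverse_real_of_nat by (simp add: inverse_eq_divide)
    have "(\<lambda>k. (1 + pmf p 1) * (c + 2 * r k) + 2 * r k + v * t0 * r k) \<longlonglongrightarrow>
        (1 + pmf p 1) * (c + 2 * 0) + 2 * 0 + v * t0 * 0"
      by (intro tendsto_intros r0)
    moreover have "eventually (\<lambda>k. v \<le> (1 + pmf p 1) * (c + 2 * r k) + 2 * r k + v * t0 * r k) sequentially"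
    proof -
      obtain K :: nat where "t0 \<le> real K" using real_arch_simple by blast
      then show ?thesis
        by (auto simp: eventually_sequentially intro!: exI[of _ K] bound)
    qed
    ultimately have "v \<le> (1 + pmf p 1) * (c + 2 * 0) + 2 * 0 + v * t0 * 0"
      by (intro tendsto_lowerbound[where F = sequentially]) auto
    with v(1) show False by simp
  qed
  moreover have "rho_c c g \<alpha> \<le> liminf (\<lambda>n. ereal ((\<Sum>x=-int n..-1. real (stacks w x)) / real n))"
    by (simp only: stacks_density[where w = w, OF w(1) w(3)]) simp
  ultimately show ?thesis by (intro exI[of _ "stacks w"]) blast
qed

end
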